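(* Let $p\in(1,\infty)$, let $\Omega\subseteq\mathbb{R}^n$ be open and let $u\in C^1(\Omega)$ be a real-valued function such that $|Du|$ has no local minima in $\Omega$. For each nonempty open $\Omega'\Subset\Omega$ put $$\Omega'(u):=\Big\{x\in\overline{\Omega'}\ :\ |Du(x)|=\|Du\|_{L^\infty(\Omega')}\Big\}$$ and let $\mathcal{A}^{\pm,p}_{\Omega'}(u)$ be the set consisting of all constant functions $\mathbb{R}^n\to\mathbb{R}$ together with all affine functions $A:\mathbb{R}^n\to\mathbb{R}$ for which there exist $\xi\in\mathbb{R}^{\pm}$, $x\in\Omega'(u)$ and $\mathbf{X}_x\in D^{2,\pm}u(x)$ such that $$DA\equiv\xi\,\Big((p-2)\mathbf{X}_x+(I:\mathbf{X}_x)\,I\Big)Du(x).$$ Then the following statements are equivalent: (a) $\operatorname{div}\big(|Du|^{p-2}Du\big)\geq0$ weakly on $\Omega$; (b) $\big((p-2)Du\otimes Du+|Du|^2I\big):D^2u\geq0$ on $\Omega$ in the feeble viscosity sense; (c) for all nonempty open $\Omega'\Subset\Omega$ and all $A\in\mathcal{A}^{+,p}_{\Omega'}(u)$, $\ \|Du\|_{L^\infty(\Omega')}\leq\|Du+DA\|_{L^\infty(\Omega')}$. Symmetrically, the following statements are equivalent: (a') $\operatorname{div}\big(|Du|^{p-2}Du\big)\leq0$ weakly on $\Omega$; (b') $\big((p-2)Du\otimes Du+|Du|^2I\big):D^2u\leq0$ on $\Omega$ in the feeble viscosity sense; (c') for all nonempty open $\Omega'\Subset\Omega$ and all $A\in\mathcal{A}^{-,p}_{\Omega'}(u)$,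 $\ \|Du\|_{L^\infty(\Omega')}\leq\|Du+DA\|_{L^\infty(\Omega')}$.
   Context: $\mathbb{R}^+=[0,\infty)$, $\mathbb{R}^-=(-\infty,0]$; $\mathbb{R}^{n^2}_s$ is the space of symmetric $n\times n$ real matrices; $I$ is the identity matrix; $\mathbf{X}:\mathbf{Y}=\sum_{i,j}\mathbf{X}_{ij}\mathbf{Y}_{ij}$; $|\cdot|$ is the Euclidean norm; $\Omega'\Subset\Omega$ means that $\overline{\Omega'}$ is compact and contained in $\Omega$; $\|Du\|_{L^\infty(\Omega')}=\operatorname{ess\,sup}_{\Omega'}|Du|$. Weakly: $\operatorname{div}(|Du|^{p-2}Du)\ge0$ (resp. $\le0$) weakly on $\Omega$ means $\int_\Omega|Du|^{p-2}Du\cdot D\varphi\,dx\le0$ (resp. $\ge0$) for all $\varphi\in C^\infty_c(\Omega)$ with $\varphi\ge0$. Feeble jets: for continuous $u:\Omega\to\mathbb{R}$ and $x\in\Omega$, $J_0^{2,+}u(x)$ (resp. $J_0^{2,-}u(x)$) is the set of all $(P,\mathbf{X})\in(\mathbb{R}^n\setminus\{0\})\times\mathbb{R}^{n^2}_s$ such that $$u(z+x)\le\ (\text{resp. }\ge)\ \ u(x)+P\cdot z+\tfrac12\mathbf{X}:z\otimes z+o(|z|^2)\quad\text{as }z\to0.$$ If $u\in C^1(\Omega)$ then every such $P$ equals $Du(x)$, and $D^{2,\pm}u(x):=\{\mathbf{X}\in\mathbb{R}^{n^2}_s:\ (Du(x),\mathbf{X})\in J_0^{2,\pm}u(x)\}$.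 Feeble viscosity sense: for continuous $F:(\mathbb{R}^n\setminus\{0\})\times\mathbb{R}^{n^2}_s\to\mathbb{R}$, $u$ satisfies $F(Du,D^2u)\ge0$ (resp. $\le0$) on $\Omega$ in the feeble viscosity sense when, for every $x\in\Omega$, $F(P,\mathbf{X})\ge0$ for all $(P,\mathbf{X})\in J_0^{2,+}u(x)$ (resp. $F(P,\mathbf{X})\le0$ for all $(P,\mathbf{X})\in J_0^{2,-}u(x)$). Here $F(P,\mathbf{X})=\big((p-2)P\otimes P+|P|^2I\big):\mathbf{X}$. *)

theory Defs
  imports
    "HOL-Analysis.Analysis"
    "HOL-Library.Landau_Symbols"
    "HOL-Probability.Essential_Supremum"
begin

text \<open>A function on an open set \<open>\<Omega>\<close> is modelled by a total function; every notion below
  depends only on its values on \<open>\<Omega>\<close>.\<close>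

definition grad :: "(real ^ 'n \<Rightarrow> real) \<Rightarrow> real ^ 'n \<Rightarrow> real ^ 'n" where
  "grad f x = (THE D. GDERIV f x :> D)"

lemma grad_eqI:
  assumes "GDERIV f x :> D"
  shows "grad f x = D"
  unfolding grad_def
proof (rule the_equality)
  show "GDERIV f x :> D" by (rule assms)
next
  fix D' assume "GDERIV f x :> D'"
  then have "(\<lambda>h. h \<bullet> D') = (\<lambda>h. h \<bullet> D)"
    using assms unfolding gderiv_def by (rule has_derivative_unique)
  then have "\<forall>h. h \<bullet> D' = h \<bullet> D"
    by (rule fun_cong[THEN allI])
  then show "D' = D"
    using vector_eq_ldot[of D' D] by simp
qed

text \<open>The partial derivatives of \<open>f\<close> are the components of its gradient; the definition is meant
  for open \<open>S\<close>.\<close>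

primrec Ck_on :: "nat \<Rightarrow> (real ^ 'n) set \<Rightarrow> (real ^ 'n \<Rightarrow> real) \<Rightarrow> bool" where
  "Ck_on 0 S f \<longleftrightarrow> continuous_on S f"
| "Ck_on (Suc k) S f \<longleftrightarrow>
     (\<forall>x\<in>S. f differentiable (at x)) \<and> (\<forall>i. Ck_on k S (\<lambda>x. grad f x $ i))"

text \<open>\<open>C\<^sub>c\<^sup>\<infinity>(\<Omega>)\<close>, with each function extended by zero to the whole space.\<close>

definition test_functions :: "(real ^ 'n) set \<Rightarrow> (real ^ 'n \<Rightarrow> real) set" where
  "test_functions \<Omega> = {\<phi>. (\<forall>k. Ck_on k UNIV \<phi>) \<and>
     compact (closure {x. \<phi> x \<noteq> 0}) \<and> closure {x. \<phi> x \<noteq> 0} \<subseteq> \<Omega>}"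

definition has_local_min_at :: "('a::topological_space \<Rightarrow> real) \<Rightarrow> 'a \<Rightarrow> bool" where
  "has_local_min_at f x \<longleftrightarrow> (\<forall>\<^sub>F y in nhds x. f x \<le> f y)"

definition weak_pLaplace_ge0 :: "real \<Rightarrow> (real ^ 'n) set \<Rightarrow> (real ^ 'n \<Rightarrow> real) \<Rightarrow> bool" where
  "weak_pLaplace_ge0 p \<Omega> u \<longleftrightarrow>
     (\<forall>\<phi>\<in>test_functions \<Omega>. (\<forall>x. 0 \<le> \<phi> x) \<longrightarrow>
        (LINT x:\<Omega>|lebesgue. (norm (grad u x) powr (p - 2) *\<^sub>R grad u x) \<bullet> grad \<phi> x) \<le> 0)"

definition weak_pLaplace_le0 :: "real \<Rightarrow> (real ^ 'n) set \<Rightarrow> (real ^ 'n \<Rightarrow> real) \<Rightarrow> bool" where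
  "weak_pLaplace_le0 p \<Omega> u \<longleftrightarrow>
     (\<forall>\<phi>\<in>test_functions \<Omega>. (\<forall>x. 0 \<le> \<phi> x) \<longrightarrow>
        (LINT x:\<Omega>|lebesgue. (norm (grad u x) powr (p - 2) *\<^sub>R grad u x) \<bullet> grad \<phi> x) \<ge> 0)"

definition tensor :: "real ^ 'n \<Rightarrow> real ^ 'n \<Rightarrow> real ^ 'n ^ 'n" where
  "tensor a b = (\<chi> i j. a $ i * b $ j)"

text \<open>The inner product of matrices is the product \<open>X : Y\<close>.\<close>

lemma inner_matrix_eq: "X \<bullet> Y = (\<Sum>i\<in>UNIV. \<Sum>j\<in>UNIV. X $ i $ j * Y $ i $ j)"
  for X Y :: "real ^ 'n ^ 'n"
  by (simp add: inner_vec_def)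

definition feeble_superjet ::
    "(real ^ 'n \<Rightarrow> real) \<Rightarrow> real ^ 'n \<Rightarrow> ((real ^ 'n) \<times> (real ^ 'n ^ 'n)) set" where
  "feeble_superjet u x = {(P, X). P \<noteq> 0 \<and> transpose X = X \<and>
     (\<exists>r. r \<in> o[at 0](\<lambda>z. (norm z)\<^sup>2) \<and>
       (\<forall>\<^sub>F z in at 0. u (z + x) \<le> u x + P \<bullet> z + 1/2 * (X \<bullet> tensor z z) + r z))}"

definition feeble_subjet ::
    "(real ^ 'n \<Rightarrow> real) \<Rightarrow> real ^ 'n \<Rightarrow> ((real ^ 'n) \<times> (real ^ 'n ^ 'n)) set" where
  "feeble_subjet u x = {(P, X). P \<noteq> 0 \<and> transpose X = X \<and>
     (\<exists>r. r \<in> o[at 0](\<lambda>z. (norm z)\<^sup>2) \<and>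
       (\<forall>\<^sub>F z in at 0. u (z + x) \<ge> u x + P \<bullet> z + 1/2 * (X \<bullet> tensor z z) + r z))}"

definition D2_plus :: "(real ^ 'n \<Rightarrow> real) \<Rightarrow> real ^ 'n \<Rightarrow> (real ^ 'n ^ 'n) set" where
  "D2_plus u x = {X. (grad u x, X) \<in> feeble_superjet u x}"

definition D2_minus :: "(real ^ 'n \<Rightarrow> real) \<Rightarrow> real ^ 'n \<Rightarrow> (real ^ 'n ^ 'n) set" where
  "D2_minus u x = {X. (grad u x, X) \<in> feeble_subjet u x}"

definition feeble_visc_ge0 ::
    "(real ^ 'n \<Rightarrow> real ^ 'n ^ 'n \<Rightarrow> real) \<Rightarrow> (real ^ 'n) set \<Rightarrow> (real ^ 'n \<Rightarrow> real) \<Rightarrow> bool" where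
  "feeble_visc_ge0 F \<Omega> u \<longleftrightarrow> (\<forall>x\<in>\<Omega>. \<forall>(P, X)\<in>feeble_superjet u x. F P X \<ge> 0)"

definition feeble_visc_le0 ::
    "(real ^ 'n \<Rightarrow> real ^ 'n ^ 'n \<Rightarrow> real) \<Rightarrow> (real ^ 'n) set \<Rightarrow> (real ^ 'n \<Rightarrow> real) \<Rightarrow> bool" where
  "feeble_visc_le0 F \<Omega> u \<longleftrightarrow> (\<forall>x\<in>\<Omega>. \<forall>(P, X)\<in>feeble_subjet u x. F P X \<le> 0)"

definition pLaplace_op :: "real \<Rightarrow> real ^ 'n \<Rightarrow> real ^ 'n ^ 'n \<Rightarrow> real" where
  "pLaplace_op p P X = ((p - 2) *\<^sub>R tensor P P + (norm P)\<^sup>2 *\<^sub>R mat 1) \<bullet> X"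

definition compactly_inside :: "'a::topological_space set \<Rightarrow> 'a set \<Rightarrow> bool" where
  "compactly_inside S \<Omega> \<longleftrightarrow> compact (closure S) \<and> closure S \<subseteq> \<Omega>"

definition Linf_norm :: "(real ^ 'n) set \<Rightarrow> (real ^ 'n \<Rightarrow> real ^ 'n) \<Rightarrow> ereal" where
  "Linf_norm S v = esssup (lebesgue_on S) (\<lambda>x. ereal (norm (v x)))"

definition max_grad_set :: "(real ^ 'n \<Rightarrow> real) \<Rightarrow> (real ^ 'n) set \<Rightarrow> (real ^ 'n) set" where
  "max_grad_set u S = {x \<in> closure S. ereal (norm (grad u x)) = Linf_norm S (grad u)}"

definition affine_fun :: "(real ^ 'n \<Rightarrow> real) \<Rightarrow> bool" where
  "affine_fun A \<longleftrightarrow> (\<exists>l c. linear l \<and> A = (\<lambda>y. l y + c))"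

definition affine_class_plus ::
    "real \<Rightarrow> (real ^ 'n \<Rightarrow> real) \<Rightarrow> (real ^ 'n) set \<Rightarrow> (real ^ 'n \<Rightarrow> real) set" where
  "affine_class_plus p u S = {A. \<exists>c. A = (\<lambda>_. c)} \<union>
     {A. affine_fun A \<and> (\<exists>\<xi>\<ge>0. \<exists>x\<in>max_grad_set u S. \<exists>X\<in>D2_plus u x.
        \<forall>y. grad A y = \<xi> *\<^sub>R (((p - 2) *\<^sub>R X + (mat 1 \<bullet> X) *\<^sub>R mat 1) *v grad u x))}"

definition affine_class_minus ::
    "real \<Rightarrow> (real ^ 'n \<Rightarrow> real) \<Rightarrow> (real ^ 'n) set \<Rightarrow> (real ^ 'n \<Rightarrow> real) set" where
  "affine_class_minus p u S = {A. \<exists>c. A = (\<lambda>_. c)} \<union>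
     {A. affine_fun A \<and> (\<exists>\<xi>\<le>0. \<exists>x\<in>max_grad_set u S. \<exists>X\<in>D2_minus u x.
        \<forall>y. grad A y = \<xi> *\<^sub>R (((p - 2) *\<^sub>R X + (mat 1 \<bullet> X) *\<^sub>R mat 1) *v grad u x))}"

end

theory Submission
  imports Defs "HOL-Probability.Distributions"
begin

text \<open>The absence of local minima of \<open>|Du|\<close> forces \<open>Du \<noteq> 0\<close> on \<open>\<Omega>\<close>, so the operator is uniformly
  elliptic along \<open>u\<close> on compact sets. The statements about supersolutions follow from those about
  subsolutions applied to \<open>-u\<close>.

  From viscosity to weak subsolutions: a sup-convolution of \<open>u\<close> followed by a much finer inf-convolution
  yields a \<open>C\<^sup>1\<^sup>,\<^sup>1\<close> function \<open>w\<close> which is almost a viscosity subsolution, with a gradient close to \<open>Du\<close>.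
  Since \<open>Dw\<close> is Lipschitz, the coefficients may be frozen on small balls. There the maximum principle,
  applied to \<open>w\<close> and its constant-coefficient heat flow, shows that \<open>w\<close> is almost below its Gaussian
  means; this survives mollification, and letting the time of the flow tend to zero gives the
  pointwise differential inequality for the mollified function. Integrating by parts and removing the
  regularisations gives the weak inequality, without any almost everywhere second derivatives.

  From weak to viscosity subsolutions: a paraboloid \<open>\<psi>\<close> that touches \<open>u\<close> from above and violates the
  inequality is a strict supersolution nearby, which the test function \<open>((u - \<psi> + \<delta>)\<^sup>+)\<^sup>2\<close> contradicts by
  monotonicity of \<open>P \<mapsto> |P|\<^sup>p\<^sup>-\<^sup>2P\<close>.

  Minimality: with \<open>a = ((p-2)X + (I:X)I)Du(x)\<close> the operator is \<open>a \<cdot> Du(x)\<close>. If it is negative, then adding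
  a small positive multiple of \<open>a\<close> to \<open>Du\<close> lowers the maximum of \<open>|Du|\<close> over the part of a small ball around \<open>x\<close>
  where \<open>|Du| < |Du(x)|\<close>, and \<open>x\<close> is in the closure of that part because it is not a local minimum.\<close>

section \<open>Symmetric matrices and the p-Laplacian\<close>

text \<open>A viscosity inequality speaks only at points where some paraboloid touches from above,
  and on its own it says nothing almost everywhere, even for a C^{1,1} function. The maximum
  principle is the tool that fits: it uses one paraboloid, at the maximum. With the gradient frozen
  at a fixed \<open>P\<close> the operator is linear in \<open>X\<close> and invariant under
  translations, so the mean value inequality it yields can be averaged. The regularisation rests on
  the order of its constants. The width \<open>e\<close> of the sup-convolution fixes a lower
  curvature bound which the inf-convolution keeps for every small width \<open>d\<close>.
  Ellipticity then gives a threshold \<open>T\<close>, depending on \<open>e\<close>,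
  \<open>p\<close> and the dimension but not on \<open>d\<close>, beyond which the operator is
  automatically nonnegative. Only then is \<open>d\<close> chosen, so small that the loss
  \<open>d T^2\<close> is negligible. The curvature of \<open>w\<close> is of order
  \<open>1/d\<close> and may be huge; this is harmless, because the radius for freezing and
  mollifying is chosen last.\<close>

lemma inner_tensor: "X \<bullet> tensor z z = z \<bullet> (X *v z)" for z :: "real ^ 'n"
  by (simp add: inner_vec_def tensor_def matrix_vector_mult_def sum_distrib_left mult_ac)

lemma inner_mat_1: "mat 1 \<bullet> X = trace X" for X :: "real ^ 'n ^ 'n"
  by (simp add: inner_vec_def trace_def mat_def if_distrib[of "\<lambda>x. x * _"] cong: if_cong)

lemma pLaplace_op_eq:
  "pLaplace_op p P X = (p - 2) * (P \<bullet> (X *v P)) + (norm P)\<^sup>2 * trace X"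
  by (simp add: pLaplace_op_def inner_add_left inner_mat_1 inner_tensor inner_commute[of "tensor P P"])

lemma trace_scaleR: "trace (c *\<^sub>R A) = c * trace A" for A :: "real ^ 'n ^ 'n"
  by (simp add: trace_def sum_distrib_left)

lemma trace_mat: "trace (mat c :: real ^ 'n ^ 'n) = c * CARD('n)"
  by (simp add: trace_def mat_def)

lemma pLaplace_op_add_mat:
  "pLaplace_op p P (X + c *\<^sub>R mat 1) = pLaplace_op p P X + c * (norm P)\<^sup>2 * (real CARD('n) + p - 2)"
  for P :: "real ^ 'n"
  by (simp add: pLaplace_op_eq matrix_vector_mult_add_rdistrib scaleR_matrix_vector_assoc[symmetric]
      inner_add_right trace_add trace_scaleR trace_mat algebra_simps dot_square_norm)

lemma transpose_add_mat:
  "transpose X = X \<Longrightarrow> transpose (X + c *\<^sub>R mat 1) = X + c *\<^sub>R mat 1" for X :: "real ^ 'n ^ 'n"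
  by (auto simp: transpose_def mat_def vec_eq_iff)

lemma quadratic_add_mat:
  "d \<bullet> ((X + c *\<^sub>R mat 1) *v d) = d \<bullet> (X *v d) + c * (norm d)\<^sup>2" for d :: "real ^ 'n"
  by (simp add: matrix_vector_mult_add_rdistrib scaleR_matrix_vector_assoc[symmetric]
      inner_add_right dot_square_norm)

lemma symmetric_inner:
  fixes X :: "real ^ 'n ^ 'n"
  assumes "transpose X = X"
  shows "a \<bullet> (X *v b) = b \<bullet> (X *v a)"
  using assms by (metis dot_lmul_matrix inner_commute transpose_matrix_vector)

text \<open>For symmetric \<open>X\<close> the form controls the operator norm by polarisation: it
  is applied to \<open>d\<close> and to the multiple \<open>e\<close> of \<open>X *v d\<close> with
  the length of \<open>d\<close>, for which \<open>e \<bullet> (X *v d)\<close> is the full product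
  of the norms.\<close>

lemma symmetric_norm_le:
  fixes X :: "real ^ 'n ^ 'n"
  assumes "transpose X = X" and "\<And>d. \<bar>d \<bullet> (X *v d)\<bar> \<le> T * (norm d)\<^sup>2"
  shows "norm (X *v d) \<le> T * norm d"
proof (cases "X *v d = 0 \<or> d = 0")
  case True
  have "0 \<le> T * (norm d)\<^sup>2" using assms(2)[of d] by linarith
  then have "0 \<le> T * norm d" by (cases "d = 0") (simp_all add: zero_le_mult_iff)
  then show ?thesis using True by auto
next
  case False
  define e where "e = (norm d / norm (X *v d)) *\<^sub>R (X *v d)"
  have ne: "norm e = norm d" using False by (simp add: e_def)
  have "4 * (e \<bullet> (X *v d)) = (d+e) \<bullet> (X *v (d+e)) - (d-e) \<bullet> (X *v (d-e))"
    using symmetric_inner[OF assms(1), of e d]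
    by (simp add: matrix_vector_right_distrib matrix_vector_mult_diff_distrib inner_add_left inner_add_right
        inner_diff_left inner_diff_right)
  also have "\<dots> \<le> T * (norm (d+e))\<^sup>2 + T * (norm (d-e))\<^sup>2"
    using assms(2)[of "d+e"] assms(2)[of "d-e"] by linarith
  also have "\<dots> = T * (2 * (norm d)\<^sup>2 + 2 * (norm e)\<^sup>2)"
    by (simp add: power2_norm_eq_inner inner_add_left inner_add_right inner_diff_left inner_diff_right algebra_simps inner_commute)
  finally have "e \<bullet> (X *v d) \<le> T * (norm d)\<^sup>2" by (simp add: ne)
  moreover have "e \<bullet> (X *v d) = norm d * norm (X *v d)"
    using False by (simp add: e_def dot_square_norm power2_eq_square)
  ultimately show ?thesis using False by (simp add: power2_eq_square)
qed

lemma quadratic_le_onorm: "k \<bullet> (X *v k) \<le> onorm ((*v) X) * (norm k)\<^sup>2" for X :: "real ^ 'n ^ 'n"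
proof -
  have "norm (X *v k) \<le> onorm ((*v) X) * norm k" by (rule onorm) simp
  then have "k \<bullet> (X *v k) \<le> norm k * (onorm ((*v) X) * norm k)"
    by (intro order_trans[OF norm_cauchy_schwarz] mult_left_mono) auto
  then show ?thesis by (simp add: power2_eq_square mult_ac)
qed

lemma inner_axis_matrix: "axis i 1 \<bullet> (X *v axis j 1) = X $ i $ j" for X :: "real ^ 'n ^ 'n"
  by (simp add: inner_axis' matrix_vector_mult_basis column_def)

text \<open>Cauchy-Schwarz for a possibly degenerate form: it is nonnegative at
  \<open>a + t *\<^sub>R b\<close> for every real \<open>t\<close>.\<close>

lemma psd_entry_sq_le:
  fixes X :: "real ^ 'n ^ 'n"
  assumes "transpose X = X" and "\<And>d. 0 \<le> d \<bullet> (X *v d)"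
  shows "(a \<bullet> (X *v b))\<^sup>2 \<le> (a \<bullet> (X *v a)) * (b \<bullet> (X *v b))"
proof -
  have q: "0 \<le> (a \<bullet> (X *v a)) + 2 * t * (a \<bullet> (X *v b)) + t\<^sup>2 * (b \<bullet> (X *v b))" for t
    using assms(2)[of "a + t *\<^sub>R b"] symmetric_inner[OF assms(1), of b a]
    by (simp add: matrix_vector_right_distrib matrix_vector_mult_scaleR inner_add_left inner_add_right
        power2_eq_square algebra_simps)
  show ?thesis
  proof (cases "b \<bullet> (X *v b) = 0")
    case True
    have "a \<bullet> (X *v b) = 0"
    proof (rule ccontr)
      assume ne: "a \<bullet> (X *v b) \<noteq> 0"
      \<comment> \<open>The quadratic coefficient is zero, so the expression is affine in
        \<open>t\<close>; at this \<open>t\<close> it equals -1.\<close>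
      show False
        using q[of "- (a \<bullet> (X *v a) + 1) / (2 * (a \<bullet> (X *v b)))"] ne True by (simp add: field_simps)
    qed
    then show ?thesis using True by simp
  next
    case False
    then have pos: "0 < b \<bullet> (X *v b)" using assms(2)[of b] by simp
    \<comment> \<open>This \<open>t\<close> minimises the quadratic.\<close>
    show ?thesis
      using q[of "- (a \<bullet> (X *v b)) / (b \<bullet> (X *v b))"] pos
      by (simp add: field_simps power2_eq_square)
  qed
qed

text \<open>No diagonalisation is involved: \<open>psd_entry_sq_le\<close> bounds the entries by
  \<open>s i * s j\<close>, and Cauchy-Schwarz for sums collects the squares of the
  \<open>s i\<close> into the trace.\<close>

lemma psd_quadratic_le_trace:
  fixes X :: "real ^ 'n ^ 'n"
  assumes "transpose X = X" and "\<And>d. 0 \<le> d \<bullet> (X *v d)"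
  shows "e \<bullet> (X *v e) \<le> (norm e)\<^sup>2 * trace X"
proof -
  define s where "s i = sqrt (X $ i $ i)" for i
  have d: "0 \<le> X $ i $ i" for i using assms(2)[of "axis i 1"] by (simp add: inner_axis_matrix)
  have x: "\<bar>X $ i $ j\<bar> \<le> s i * s j" for i j
  proof -
    have "(X $ i $ j)\<^sup>2 \<le> (X $ i $ i) * (X $ j $ j)"
      using psd_entry_sq_le[OF assms, of "axis i 1" "axis j 1"] by (simp add: inner_axis_matrix)
    then have "sqrt ((X $ i $ j)\<^sup>2) \<le> sqrt ((X $ i $ i) * (X $ j $ j))" by (rule real_sqrt_le_mono)
    then show ?thesis by (simp add: s_def real_sqrt_mult)
  qed
  have "e \<bullet> (X *v e) = (\<Sum>i\<in>UNIV. \<Sum>j\<in>UNIV. e $ i * (X $ i $ j * e $ j))"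
    by (simp add: inner_vec_def matrix_vector_mult_def sum_distrib_left)
  also have "\<dots> \<le> (\<Sum>i\<in>UNIV. \<Sum>j\<in>UNIV. (\<bar>e $ i\<bar> * s i) * (\<bar>e $ j\<bar> * s j))"
  proof (intro sum_mono)
    fix i j
    have "e $ i * (X $ i $ j * e $ j) \<le> \<bar>e $ i\<bar> * \<bar>X $ i $ j\<bar> * \<bar>e $ j\<bar>"
      by (metis abs_ge_self abs_mult mult.assoc)
    also have "\<dots> \<le> \<bar>e $ i\<bar> * (s i * s j) * \<bar>e $ j\<bar>"
      by (intro mult_right_mono mult_left_mono x) auto
    finally show "e $ i * (X $ i $ j * e $ j) \<le> (\<bar>e $ i\<bar> * s i) * (\<bar>e $ j\<bar> * s j)" by (simp add: mult_ac)
  qed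
  also have "\<dots> = (\<Sum>i\<in>UNIV. \<bar>e $ i\<bar> * s i)\<^sup>2"
    by (simp add: power2_eq_square sum_product)
  also have "\<dots> \<le> (\<Sum>i\<in>UNIV. \<bar>e $ i\<bar>\<^sup>2) * (\<Sum>i\<in>UNIV. (s i)\<^sup>2)"
    by (rule Cauchy_Schwarz_ineq_sum)
  also have "\<dots> = (norm e)\<^sup>2 * trace X"
    using d by (simp add: s_def trace_def power2_norm_eq_inner inner_vec_def power2_eq_square[of "e $ _"])
  finally show ?thesis .
qed

lemma psd_trace_nonneg:
  fixes X :: "real ^ 'n ^ 'n"
  assumes "\<And>d. 0 \<le> d \<bullet> (X *v d)"
  shows "0 \<le> trace X"
  unfolding trace_def using assms[of "axis _ 1"] by (intro sum_nonneg) (simp add: inner_axis_matrix)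

text \<open>For \<open>p \<ge> 2\<close> the rank-one term only helps. For \<open>p < 2\<close> its
  negative coefficient is charged to the trace by \<open>psd_quadratic_le_trace\<close>, which
  leaves the factor \<open>p - 1\<close>.\<close>

lemma pLaplace_op_elliptic:
  fixes X :: "real ^ 'n ^ 'n"
  assumes "1 < p" and "transpose X = X" and "\<And>d. 0 \<le> d \<bullet> (X *v d)"
  shows "min 1 (p - 1) * (norm P)\<^sup>2 * trace X \<le> pLaplace_op p P X"
proof -
  have t: "0 \<le> (norm P)\<^sup>2 * trace X" using psd_trace_nonneg[OF assms(3)] by simp
  have q: "P \<bullet> (X *v P) \<le> (norm P)\<^sup>2 * trace X" by (rule psd_quadratic_le_trace[OF assms(2,3)])
  show ?thesis
  proof (cases "p \<ge> 2")
    case True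
    have "0 \<le> (p - 2) * (P \<bullet> (X *v P))" using True assms(3) by simp
    then show ?thesis using True by (simp add: pLaplace_op_eq)
  next
    case False
    then have "(p - 2) * ((norm P)\<^sup>2 * trace X) \<le> (p - 2) * (P \<bullet> (X *v P))"
      using q by (intro mult_left_mono_neg) auto
    then show ?thesis using False by (simp add: pLaplace_op_eq algebra_simps)
  qed
qed

text \<open>The operator is quadratic in the gradient, so a change of gradient costs a factor
  \<open>norm (P - Q)\<close>. This is the price of freezing and unfreezing the
  coefficients.\<close>

lemma pLaplace_op_diff_le:
  fixes X :: "real ^ 'n ^ 'n"
  assumes N: "\<And>d. norm (X *v d) \<le> N * norm d"
  shows "\<bar>pLaplace_op p P X - pLaplace_op p Q X\<bar>
      \<le> (\<bar>p - 2\<bar> + CARD('n)) * N * norm (P - Q) * (norm P + norm Q)"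
proof -
  have "P \<bullet> (X *v P) - Q \<bullet> (X *v Q) = (P - Q) \<bullet> (X *v P) + Q \<bullet> (X *v (P - Q))"
    by (simp add: matrix_vector_mult_diff_distrib inner_diff_left inner_diff_right)
  also have "\<bar>\<dots>\<bar> \<le> norm (P - Q) * norm (X *v P) + norm Q * norm (X *v (P - Q))"
    by (intro order_trans[OF abs_triangle_ineq] add_mono Cauchy_Schwarz_ineq2)
  also have "\<dots> \<le> norm (P - Q) * (N * norm P) + norm Q * (N * norm (P - Q))"
    by (intro add_mono mult_left_mono N) auto
  finally have 1: "\<bar>P \<bullet> (X *v P) - Q \<bullet> (X *v Q)\<bar> \<le> N * norm (P - Q) * (norm P + norm Q)"
    by (simp add: algebra_simps)
  have tr: "\<bar>trace X\<bar> \<le> CARD('n) * N"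
  proof -
    have "\<bar>X $ i $ i\<bar> \<le> N" for i
      using order_trans[OF Cauchy_Schwarz_ineq2[of "axis i 1" "X *v axis i 1"]] N[of "axis i 1"]
      by (simp add: inner_axis_matrix)
    then show ?thesis unfolding trace_def
      by (intro order_trans[OF sum_abs]) (use sum_bounded_above[of UNIV "\<lambda>i. \<bar>X$i$i\<bar>" N] in auto)
  qed
  have "\<bar>(norm P)\<^sup>2 - (norm Q)\<^sup>2\<bar> = \<bar>norm P - norm Q\<bar> * (norm P + norm Q)"
    by (simp add: power2_eq_square square_diff_square_factored abs_mult mult.commute)
  also have "\<dots> \<le> norm (P - Q) * (norm P + norm Q)"
    by (intro mult_right_mono norm_triangle_ineq3) auto
  finally have 2: "\<bar>(norm P)\<^sup>2 - (norm Q)\<^sup>2\<bar> \<le> norm (P - Q) * (norm P + norm Q)" .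
  have "pLaplace_op p P X - pLaplace_op p Q X
      = (p - 2) * (P \<bullet> (X *v P) - Q \<bullet> (X *v Q)) + ((norm P)\<^sup>2 - (norm Q)\<^sup>2) * trace X"
    by (simp add: pLaplace_op_eq algebra_simps)
  also have "\<bar>\<dots>\<bar> \<le> \<bar>p - 2\<bar> * (N * norm (P - Q) * (norm P + norm Q))
      + (norm (P - Q) * (norm P + norm Q)) * (CARD('n) * N)"
    unfolding abs_mult
    by (intro order_trans[OF abs_triangle_ineq] add_mono, unfold abs_mult)
       (auto intro!: mult_mono 1 2 tr)
  finally show ?thesis by (simp add: algebra_simps)
qed

section \<open>Sup- and inf-convolutions\<close>

lemma norm_add_sq: "(norm (a + b))\<^sup>2 = (norm a)\<^sup>2 + 2 * (a \<bullet> b) + (norm b)\<^sup>2" for a :: "'a::real_inner"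
  by (simp add: power2_norm_eq_inner inner_add_left inner_add_right inner_commute)

lemma norm_diff_sq: "(norm (a - b))\<^sup>2 = (norm a)\<^sup>2 - 2 * (a \<bullet> b) + (norm b)\<^sup>2" for a :: "'a::real_inner"
  by (simp add: power2_norm_eq_inner inner_diff_left inner_diff_right inner_commute)

text \<open>Replaces the passage to the limit \<open>t\<close> to 0 in many arguments below.\<close>

lemma le_if_le_add_small:
  fixes A B C :: real
  assumes "\<And>t. 0 < t \<Longrightarrow> t \<le> 1 \<Longrightarrow> B \<le> A + t * C"
  shows "B \<le> A"
proof (rule field_le_epsilon)
  fix e :: real assume e: "0 < e"
  define t where "t = min 1 (e / (\<bar>C\<bar> + 1))"
  have t: "0 < t" "t \<le> 1" using e by (auto simp: t_def)
  have "t * C \<le> t * (\<bar>C\<bar> + 1)" using t by (intro mult_left_mono) auto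
  also have "\<dots> \<le> e / (\<bar>C\<bar> + 1) * (\<bar>C\<bar> + 1)" by (intro mult_right_mono) (auto simp: t_def)
  also have "\<dots> = e" by (simp add: add_nonneg_eq_0_iff)
  finally show "B \<le> A + e" using assms[OF t] by linarith
qed

text \<open>With a compact \<open>K\<close> the supremum is attained, and the result is a function
  on the whole space although \<open>u\<close> matters only on \<open>K\<close>.\<close>

definition sup_conv :: "real \<Rightarrow> 'a::euclidean_space set \<Rightarrow> ('a \<Rightarrow> real) \<Rightarrow> 'a \<Rightarrow> real" where
  "sup_conv e K u z = (SUP y\<in>K. u y - (norm (z - y))\<^sup>2 / (2 * e))"

text \<open>The Moreau envelope, with the infimum over the whole space; it is evaluated at points
  where \<open>inf_conv_eq\<close> shows that it is attained.\<close>

definition inf_conv :: "real \<Rightarrow> ('a::euclidean_space \<Rightarrow> real) \<Rightarrow> 'a \<Rightarrow> real" where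
  "inf_conv d v x = (INF z. v z + (norm (x - z))\<^sup>2 / (2 * d))"

text \<open>Equivalently, \<open>q + (1/e) *\<^sub>R z\<close> is a subgradient at \<open>z\<close>
  of the function \<open>v\<close> plus \<open>1/(2e)\<close> times the squared norm.\<close>

definition prox_subgrad :: "real \<Rightarrow> ('a::euclidean_space \<Rightarrow> real) \<Rightarrow> 'a \<Rightarrow> 'a set" where
  "prox_subgrad e v z = {q. \<forall>h. v z + q \<bullet> h - (norm h)\<^sup>2 / (2 * e) \<le> v (z + h)}"

lemma prox_subgradD: "q \<in> prox_subgrad e v z \<Longrightarrow> v z + q \<bullet> h - (norm h)\<^sup>2 / (2 * e) \<le> v (z + h)"
  by (simp add: prox_subgrad_def)

lemma convex_prox_subgrad: "convex (prox_subgrad e v z)"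
proof (rule convexI)
  fix p q and s t :: real
  assume pq: "p \<in> prox_subgrad e v z" "q \<in> prox_subgrad e v z" and st: "0 \<le> s" "0 \<le> t" "s + t = 1"
  have "v z + (s *\<^sub>R p + t *\<^sub>R q) \<bullet> h - (norm h)\<^sup>2 / (2 * e) \<le> v (z + h)" for h
  proof -
    have "s * (p \<bullet> h) + t * (q \<bullet> h) \<le> v (z + h) - v z + (norm h)\<^sup>2 / (2 * e)"
      by (rule convex_bound_le) (use st prox_subgradD[OF pq(1), of h] prox_subgradD[OF pq(2), of h] in auto)
    then show ?thesis by (simp add: inner_add_left)
  qed
  then show "s *\<^sub>R p + t *\<^sub>R q \<in> prox_subgrad e v z" by (simp add: prox_subgrad_def)
qed

text \<open>A function with a supporting affine function at every point is convex; each element of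
  \<open>prox_subgrad\<close> supplies one.\<close>

lemma semiconvex_if_prox_subgrad:
  assumes "\<And>z. prox_subgrad e v z \<noteq> {}"
  shows "convex_on UNIV (\<lambda>z. v z + (norm z)\<^sup>2 / (2 * e))"
proof (rule convex_onI)
  fix t :: real and a b :: 'a
  assume t: "0 < t" "t < 1"
  define z where "z = (1 - t) *\<^sub>R a + t *\<^sub>R b"
  obtain q where q: "q \<in> prox_subgrad e v z" using assms[of z] by auto
  define g where "g x = v x + (norm x)\<^sup>2 / (2 * e)" for x
  have g: "g z + (q + (1/e) *\<^sub>R z) \<bullet> (x - z) \<le> g x" for x
  proof -
    have "(norm x)\<^sup>2 = (norm z)\<^sup>2 + 2 * (z \<bullet> (x - z)) + (norm (x - z))\<^sup>2"
      using norm_add_sq[of z "x - z"] by simp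
    then have "(norm x)\<^sup>2 / (2 * e) = (norm z)\<^sup>2 / (2 * e) + (z \<bullet> (x - z)) / e + (norm (x - z))\<^sup>2 / (2 * e)"
      by (simp add: add_divide_distrib)
    then show ?thesis
      using prox_subgradD[OF q, of "x - z"] by (simp add: g_def inner_add_left)
  qed
  have "(1 - t) * (g z + (q + (1/e) *\<^sub>R z) \<bullet> (a - z)) + t * (g z + (q + (1/e) *\<^sub>R z) \<bullet> (b - z))
     \<le> (1 - t) * g a + t * g b"
    using t g by (intro add_mono mult_left_mono) auto
  also have "(1 - t) * (g z + (q + (1/e) *\<^sub>R z) \<bullet> (a - z)) + t * (g z + (q + (1/e) *\<^sub>R z) \<bullet> (b - z))
     = g z + (q + (1/e) *\<^sub>R z) \<bullet> ((1 - t) *\<^sub>R (a - z) + t *\<^sub>R (b - z))"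
    by (simp only: inner_add_right inner_scaleR_right) (simp add: algebra_simps)
  also have "(1 - t) *\<^sub>R (a - z) + t *\<^sub>R (b - z) = 0" by (simp add: z_def algebra_simps)
  finally show "v ((1 - t) *\<^sub>R a + t *\<^sub>R b) + (norm ((1 - t) *\<^sub>R a + t *\<^sub>R b))\<^sup>2 / (2 * e)
      \<le> (1 - t) * (v a + (norm a)\<^sup>2 / (2 * e)) + t * (v b + (norm b)\<^sup>2 / (2 * e))"
    by (simp add: g_def z_def)
qed simp

text \<open>A minimiser for the inf-convolution yields a lower bound with the weaker constant \<open>1/d\<close>;
  semiconvexity along segments improves it to \<open>1/e\<close>.\<close>

lemma prox_subgrad_if_minimizer:
  fixes v :: "'a::euclidean_space \<Rightarrow> real"
  assumes ne: "\<And>z. prox_subgrad e v z \<noteq> {}" and d: "0 < d"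
    and min: "\<And>z'. v z + (norm (x - z))\<^sup>2 / (2 * d) \<le> v z' + (norm (x - z'))\<^sup>2 / (2 * d)"
  shows "(1/d) *\<^sub>R (x - z) \<in> prox_subgrad e v z"
  unfolding prox_subgrad_def
proof (clarify, rule le_if_le_add_small)
  fix h and t :: real assume t: "0 < t" "t \<le> 1"
  define q where "q = (1/d) *\<^sub>R (x - z)"
  have "v ((1 - t) *\<^sub>R z + t *\<^sub>R (z + h)) + (norm ((1 - t) *\<^sub>R z + t *\<^sub>R (z + h)))\<^sup>2 / (2 * e)
     \<le> (1 - t) * (v z + (norm z)\<^sup>2 / (2 * e)) + t * (v (z + h) + (norm (z + h))\<^sup>2 / (2 * e))"
    using convex_onD[OF semiconvex_if_prox_subgrad[OF ne], of t z "z + h"] t by simp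
  also have "(1 - t) *\<^sub>R z + t *\<^sub>R (z + h) = z + t *\<^sub>R h" by (simp add: algebra_simps)
  finally have 1: "v (z + t *\<^sub>R h) \<le> (1 - t) * v z + t * v (z + h) + t * (1 - t) * (norm h)\<^sup>2 / (2 * e)"
    unfolding norm_add_sq
    by (simp add: power_mult_distrib add_divide_distrib diff_divide_distrib power2_eq_square[of t] algebra_simps)
  have "v z + (norm (x - z))\<^sup>2 / (2 * d) \<le> v (z + t *\<^sub>R h) + (norm ((x - z) - t *\<^sub>R h))\<^sup>2 / (2 * d)"
    using min[of "z + t *\<^sub>R h"] by (simp add: diff_diff_add)
  then have 2: "v z + t * (q \<bullet> h) - t\<^sup>2 * (norm h)\<^sup>2 / (2 * d) \<le> v (z + t *\<^sub>R h)"
    unfolding norm_diff_sq q_def using d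
    by (simp add: power_mult_distrib add_divide_distrib diff_divide_distrib)
  \<comment> \<open>Fact 1 is convexity along the segment, fact 2 is minimality at its point
    \<open>z + t *\<^sub>R h\<close>. After division by \<open>t\<close> the defect still carries
    one factor \<open>t\<close>, so the constant \<open>1/d\<close> disappears in the limit.\<close>
  have "t * (v z + q \<bullet> h - (norm h)\<^sup>2 / (2 * e))
      \<le> t * (v (z + h) + t * ((norm h)\<^sup>2 / (2 * d) - (norm h)\<^sup>2 / (2 * e)))"
    using order_trans[OF 2 1] by (simp add: power2_eq_square algebra_simps diff_divide_distrib)
  then show "v z + ((1 / d) *\<^sub>R (x - z)) \<bullet> h - (norm h)\<^sup>2 / (2 * e)
      \<le> v (z + h) + t * ((norm h)\<^sup>2 / (2 * d) - (norm h)\<^sup>2 / (2 * e))"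
    using t by (simp add: q_def)
qed

text \<open>The penalty of curvature \<open>1/d\<close> dominates the concavity \<open>1/e\<close>
  of \<open>v\<close>, so completing the square shows that \<open>z\<close> is the minimiser for
  \<open>z + d *\<^sub>R q\<close>. The envelope is thus explicit along these points.\<close>

lemma inf_conv_eq:
  assumes q: "q \<in> prox_subgrad e v z" and d: "0 < d" "d \<le> e"
  shows "inf_conv d v (z + d *\<^sub>R q) = v z + d * (norm q)\<^sup>2 / 2"
    and "inf_conv d v (z + d *\<^sub>R q) \<le> v z' + (norm (z + d *\<^sub>R q - z'))\<^sup>2 / (2 * d)"
proof -
  have lb: "v z + d * (norm q)\<^sup>2 / 2 \<le> v z' + (norm (z + d *\<^sub>R q - z'))\<^sup>2 / (2 * d)" for z'
  proof -
    have "(norm (z + d *\<^sub>R q - z'))\<^sup>2 = (norm (d *\<^sub>R q - (z' - z)))\<^sup>2" by (simp add: algebra_simps)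
    also have "\<dots> = d\<^sup>2 * (norm q)\<^sup>2 - 2 * d * (q \<bullet> (z' - z)) + (norm (z' - z))\<^sup>2"
      by (simp add: norm_diff_sq power_mult_distrib)
    finally have "(norm (z + d *\<^sub>R q - z'))\<^sup>2 / (2 * d)
        = d * (norm q)\<^sup>2 / 2 - q \<bullet> (z' - z) + (norm (z' - z))\<^sup>2 / (2 * d)"
      using d by (simp add: add_divide_distrib diff_divide_distrib power2_eq_square)
    moreover have "(norm (z' - z))\<^sup>2 / (2 * e) \<le> (norm (z' - z))\<^sup>2 / (2 * d)"
      using d by (intro divide_left_mono) auto
    ultimately show ?thesis using prox_subgradD[OF q, of "z' - z"] by simp
  qed
  have at: "v z + (norm (z + d *\<^sub>R q - z))\<^sup>2 / (2 * d) = v z + d * (norm q)\<^sup>2 / 2"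
    using d by (simp add: power2_eq_square)
  show eq: "inf_conv d v (z + d *\<^sub>R q) = v z + d * (norm q)\<^sup>2 / 2"
    unfolding inf_conv_def
    by (rule cInf_eq_minimum) (use lb at in \<open>auto simp: image_iff intro!: exI[of _ z]\<close>)
  show "inf_conv d v (z + d *\<^sub>R q) \<le> v z' + (norm (z + d *\<^sub>R q - z'))\<^sup>2 / (2 * d)"
    unfolding eq by (rule lb)
qed

text \<open>A minimiser for the envelope at \<open>x\<close> is the required \<open>z\<close>, by
  \<open>prox_subgrad_if_minimizer\<close>. It exists because the subgradient \<open>r\<close> at
  \<open>x\<close> confines all competitors to a ball of radius
  \<open>4 * d * norm r\<close>.\<close>

lemma resolvent_exists:
  fixes v :: "'a::euclidean_space \<Rightarrow> real"
  assumes ne: "\<And>z. prox_subgrad e v z \<noteq> {}" and d: "0 < d" "2 * d \<le> e"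
    and r: "r \<in> prox_subgrad e v x"
  obtains z q where "q \<in> prox_subgrad e v z" "x = z + d *\<^sub>R q" "norm (x - z) \<le> 4 * d * norm r"
proof -
  define \<Phi> where "\<Phi> z = v z + (norm (x - z))\<^sup>2 / (2 * d)" for z
  have e: "0 < e" using d by linarith
  have "continuous_on UNIV (\<lambda>z. v z + (norm z)\<^sup>2 / (2 * e))"
    by (rule convex_on_continuous[OF open_UNIV semiconvex_if_prox_subgrad[OF ne]])
  then have "continuous_on UNIV (\<lambda>z. (v z + (norm z)\<^sup>2 / (2 * e)) - (norm z)\<^sup>2 / (2 * e))"
    by (rule continuous_on_diff) (use e in \<open>auto intro!: continuous_intros\<close>)
  then have cv: "continuous_on UNIV v" by simp
  then have c: "continuous_on A \<Phi>" for A
    unfolding \<Phi>_def using d by (intro continuous_intros) (auto intro: continuous_on_subset)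
  have far: "norm (x - z) \<le> 4 * d * norm r" if "\<Phi> z \<le> \<Phi> x" for z
  proof -
    define h where "h = z - x"
    have "v x + r \<bullet> h - (norm h)\<^sup>2 / (2 * e) \<le> v z" using prox_subgradD[OF r, of h] by (simp add: h_def)
    moreover have "v z + (norm h)\<^sup>2 / (2 * d) \<le> v x"
      using that by (simp add: \<Phi>_def h_def norm_minus_commute)
    \<comment> \<open>Half of the penalty absorbs the concavity of \<open>v\<close>; the other half
      bounds \<open>h\<close>.\<close>
    moreover have "(norm h)\<^sup>2 / (2 * e) \<le> (norm h)\<^sup>2 / (4 * d)"
      using d by (intro divide_left_mono) auto
    moreover have "- (norm r * norm h) \<le> r \<bullet> h" using Cauchy_Schwarz_ineq2[of r h] by linarith
    moreover have "(norm h)\<^sup>2 / (2 * d) = 2 * ((norm h)\<^sup>2 / (4 * d))" by simp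
    ultimately have "(norm h)\<^sup>2 / (4 * d) \<le> norm r * norm h" by linarith
    then have "norm h * norm h \<le> (4 * d * norm r) * norm h"
      using d by (simp add: power2_eq_square field_simps)
    then have "norm h \<le> 4 * d * norm r"
      using d by (cases "norm h = 0") auto
    then show ?thesis by (simp add: h_def norm_minus_commute)
  qed
  define B where "B = cball x (4 * d * norm r)"
  have "x \<in> B" using d by (simp add: B_def)
  obtain z where z: "z \<in> B" "\<And>z'. z' \<in> B \<Longrightarrow> \<Phi> z \<le> \<Phi> z'"
    using continuous_attains_inf[of B \<Phi>] c \<open>x \<in> B\<close> by (auto simp: B_def)
  have "\<Phi> z \<le> \<Phi> z'" for z'
  proof (cases "z' \<in> B")
    case False
    then have "\<Phi> x < \<Phi> z'" using far[of z'] by (force simp: B_def dist_norm)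
    then show ?thesis using z(2)[OF \<open>x \<in> B\<close>] by linarith
  qed (rule z(2))
  then have "(1/d) *\<^sub>R (x - z) \<in> prox_subgrad e v z"
    by (intro prox_subgrad_if_minimizer[OF ne d(1)]) (simp add: \<Phi>_def)
  then show thesis
    using z(1) d by (intro that[of "(1/d) *\<^sub>R (x - z)" z]) (auto simp: B_def dist_norm)
qed

text \<open>The old minimiser \<open>z\<close> stays a competitor at the shifted point.\<close>

lemma inf_conv_upper:
  assumes q: "q \<in> prox_subgrad e v z" and d: "0 < d" "d \<le> e"
    and ub: "\<And>x z'. inf_conv d v x \<le> v z' + (norm (x - z'))\<^sup>2 / (2 * d)"
  shows "inf_conv d v (z + d *\<^sub>R q + h) \<le> inf_conv d v (z + d *\<^sub>R q) + q \<bullet> h + (norm h)\<^sup>2 / (2 * d)"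
proof -
  have "inf_conv d v (z + d *\<^sub>R q + h) \<le> v z + (norm (d *\<^sub>R q + h))\<^sup>2 / (2 * d)"
    using ub[of "z + d *\<^sub>R q + h" z] by simp
  also have "\<dots> = v z + d * (norm q)\<^sup>2 / 2 + q \<bullet> h + (norm h)\<^sup>2 / (2 * d)"
    unfolding norm_add_sq using d by (simp add: power_mult_distrib add_divide_distrib power2_eq_square)
  finally show ?thesis by (simp add: inf_conv_eq(1)[OF q d])
qed

text \<open>The constant involves \<open>e\<close> only, which later allows \<open>d\<close> to be
  chosen after the curvature threshold. The shift \<open>h\<close> splits into the motion
  \<open>k\<close> of the minimiser and \<open>h - k = d *\<^sub>R (q' - q)\<close>; the penalty of
  the second part pays for its share of the squared norm of \<open>k\<close>.\<close>

lemma inf_conv_lower: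
  fixes v :: "'a::euclidean_space \<Rightarrow> real"
  assumes q: "q \<in> prox_subgrad e v z" and d: "0 < d" "2 * d \<le> e"
    and ne: "\<And>z. prox_subgrad e v z \<noteq> {}"
  shows "inf_conv d v (z + d *\<^sub>R q) + q \<bullet> h - (norm h)\<^sup>2 / e \<le> inf_conv d v (z + d *\<^sub>R q + h)"
proof -
  have de: "d \<le> e" using d by linarith
  obtain r where "r \<in> prox_subgrad e v (z + d *\<^sub>R q + h)" using ne by blast
  from resolvent_exists[OF ne d this] obtain z' q' where
    z': "q' \<in> prox_subgrad e v z'" "z + d *\<^sub>R q + h = z' + d *\<^sub>R q'" by metis
  define k where "k = z' - z"
  have dq: "d *\<^sub>R q' = d *\<^sub>R q + (h - k)" using z'(2) by (simp add: k_def algebra_simps)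
  have "inf_conv d v (z + d *\<^sub>R q + h) = v z' + d * (norm q')\<^sup>2 / 2"
    unfolding z'(2) by (rule inf_conv_eq[OF z'(1) d(1) de])
  also have "d * (norm q')\<^sup>2 / 2 = (norm (d *\<^sub>R q'))\<^sup>2 / (2 * d)"
    using d by (simp add: power_mult_distrib power2_eq_square)
  also have "\<dots> = d * (norm q)\<^sup>2 / 2 + q \<bullet> (h - k) + (norm (h - k))\<^sup>2 / (2 * d)"
    unfolding dq norm_add_sq using d by (simp add: power_mult_distrib add_divide_distrib power2_eq_square)
  finally have eq: "inf_conv d v (z + d *\<^sub>R q + h)
     = v z' + (d * (norm q)\<^sup>2 / 2 + q \<bullet> (h - k) + (norm (h - k))\<^sup>2 / (2 * d))" .
  have "v z + q \<bullet> k - (norm k)\<^sup>2 / (2 * e) \<le> v z'" using prox_subgradD[OF q, of k] by (simp add: k_def)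
  moreover have "(norm k)\<^sup>2 / (2 * e) \<le> (norm h)\<^sup>2 / e + (norm (h - k))\<^sup>2 / (2 * d)"
  proof -
    have "0 \<le> (norm (h + (h - k)))\<^sup>2" by simp
    then have "- 2 * (h \<bullet> (h - k)) \<le> (norm h)\<^sup>2 + (norm (h - k))\<^sup>2" by (simp add: norm_add_sq)
    moreover have "(norm k)\<^sup>2 = (norm h)\<^sup>2 - 2 * (h \<bullet> (h - k)) + (norm (h - k))\<^sup>2"
      using norm_diff_sq[of h "h - k"] by simp
    ultimately have "(norm k)\<^sup>2 \<le> 2 * (norm h)\<^sup>2 + 2 * (norm (h - k))\<^sup>2" by linarith
    then have "(norm k)\<^sup>2 / (2 * e) \<le> (2 * (norm h)\<^sup>2 + 2 * (norm (h - k))\<^sup>2) / (2 * e)"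
      using d by (intro divide_right_mono) auto
    also have "\<dots> = (norm h)\<^sup>2 / e + (norm (h - k))\<^sup>2 / e" by (simp add: add_divide_distrib)
    also have "(norm (h - k))\<^sup>2 / e \<le> (norm (h - k))\<^sup>2 / (2 * d)" using d by (intro divide_left_mono) auto
    finally show ?thesis by simp
  qed
  ultimately show ?thesis unfolding eq inf_conv_eq(1)[OF q d(1) de] by (simp add: inner_diff_right)
qed

text \<open>If \<open>q\<close> and \<open>q'\<close> differed, the envelope would be a parabola of
  curvature \<open>1/d\<close> along the points \<open>z + d *\<^sub>R r\<close> with
  \<open>r\<close> between them, by convexity of \<open>prox_subgrad\<close> and
  \<open>inf_conv_eq\<close>. A paraboloid of curvature \<open>T\<close> below \<open>1/d\<close>
  cannot lie above it.\<close>

lemma prox_subgrad_unique_if_touched: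
  assumes q: "q \<in> prox_subgrad e v z" "q' \<in> prox_subgrad e v z" and d: "0 < d" "d \<le> e"
    and \<rho>: "0 < \<rho>"
    and t: "\<And>h. norm h \<le> \<rho> \<Longrightarrow>
      inf_conv d v (z + d *\<^sub>R q + h) \<le> inf_conv d v (z + d *\<^sub>R q) + q \<bullet> h + T / 2 * (norm h)\<^sup>2"
    and T: "T * d < 1"
  shows "q' = q"
proof (rule ccontr)
  assume ne: "q' \<noteq> q"
  \<comment> \<open>Keeps the displacement \<open>h\<close> within the radius on which the touching
    holds.\<close>
  define s where "s = min 1 (\<rho> / (d * norm (q' - q)))"
  have s: "0 < s" "s \<le> 1" using ne d \<rho> by (auto simp: s_def)
  define h where "h = (s * d) *\<^sub>R (q' - q)"
  have "s * (d * norm (q' - q)) \<le> \<rho> / (d * norm (q' - q)) * (d * norm (q' - q))"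
    using d by (intro mult_right_mono) (auto simp: s_def)
  then have h: "norm h \<le> \<rho>" using s d ne by (simp add: h_def mult.assoc)
  define r where "r = q + s *\<^sub>R (q' - q)"
  have "(1 - s) *\<^sub>R q + s *\<^sub>R q' \<in> prox_subgrad e v z"
    using convexD[OF convex_prox_subgrad q, of "1 - s" s] s by simp
  then have r: "r \<in> prox_subgrad e v z" by (simp add: r_def algebra_simps)
  have zr: "z + d *\<^sub>R q + h = z + d *\<^sub>R r" by (simp add: h_def r_def algebra_simps)
  have le: "v z + d * (norm r)\<^sup>2 / 2 \<le> v z + d * (norm q)\<^sup>2 / 2 + q \<bullet> h + T / 2 * (norm h)\<^sup>2"
    using t[OF h] unfolding zr inf_conv_eq(1)[OF r d] inf_conv_eq(1)[OF q(1) d] .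
  moreover have "d * (norm r)\<^sup>2 / 2 = d * (norm q)\<^sup>2 / 2 + q \<bullet> h + d * s\<^sup>2 * (norm (q' - q))\<^sup>2 / 2"
    unfolding r_def norm_add_sq h_def by (simp add: power_mult_distrib add_divide_distrib distrib_left inner_add_left)
  moreover have "T / 2 * (norm h)\<^sup>2 = (T * d) * (d * s\<^sup>2 * (norm (q' - q))\<^sup>2 / 2)"
    by (simp add: h_def power_mult_distrib power2_eq_square)
  moreover have "(T * d) * (d * s\<^sup>2 * (norm (q' - q))\<^sup>2 / 2) < 1 * (d * s\<^sup>2 * (norm (q' - q))\<^sup>2 / 2)"
    using T s d ne by (intro mult_strict_right_mono) auto
  ultimately show False by linarith
qed

text \<open>The loss \<open>d T\<^sup>2\<close> in the transferred paraboloid replaces the exact Hessian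
  \<open>X (I - d X)\<^sup>-\<^sup>1\<close> of the transfer and tends to zero with \<open>d\<close>.\<close>

lemma touching_transfer:
  fixes v :: "real ^ 'n \<Rightarrow> real"
  assumes q: "q \<in> prox_subgrad e v z" and d: "0 < d" "d \<le> e"
    and \<rho>: "0 < \<rho>"
    and t: "\<And>h. norm h \<le> \<rho> \<Longrightarrow>
      inf_conv d v (z + d *\<^sub>R q + h) \<le> inf_conv d v (z + d *\<^sub>R q) + q \<bullet> h + 1 / 2 * (h \<bullet> (X *v h))"
    and X: "transpose X = X" "\<And>h. \<bar>h \<bullet> (X *v h)\<bar> \<le> T * (norm h)\<^sup>2"
    and T: "2 * (T * d) \<le> 1"
    and near: "\<And>\<kappa>. 0 < \<kappa> \<Longrightarrow> \<exists>\<rho>'>0. \<forall>k. norm k < \<rho>' \<longrightarrow> (\<exists>q'\<in>prox_subgrad e v (z + k). norm (q' - q) < \<kappa>)"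
  shows "\<exists>\<rho>'>0. \<forall>k. norm k < \<rho>' \<longrightarrow>
    v (z + k) \<le> v z + q \<bullet> k + 1 / 2 * (k \<bullet> (X *v k)) + d * T\<^sup>2 * (norm k)\<^sup>2"
proof -
  obtain \<rho>' where \<rho>': "0 < \<rho>'"
      "\<And>k. norm k < \<rho>' \<Longrightarrow> \<exists>q'\<in>prox_subgrad e v (z + k). norm (q' - q) < \<rho> / (2 * d)"
    using near[of "\<rho> / (2 * d)"] \<rho> d by auto
  show ?thesis
  proof (intro exI[of _ "min \<rho>' (\<rho> / 2)"] conjI allI impI)
    show "0 < min \<rho>' (\<rho> / 2)" using \<rho>' \<rho> by simp
    fix k :: "real ^ 'n" assume k: "norm k < min \<rho>' (\<rho> / 2)"
    then obtain q' where q': "q' \<in> prox_subgrad e v (z + k)" "norm (q' - q) < \<rho> / (2 * d)"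
      using \<rho>'(2)[of k] by auto
    \<comment> \<open>The point \<open>z + d *\<^sub>R q + h\<close> has minimiser
      \<open>z + k\<close>, so the touching inequality at \<open>h\<close> becomes an upper bound
      for \<open>v (z + k)\<close> whose only unknown is \<open>\<tau>\<close>.\<close>
    define \<tau> where "\<tau> = d *\<^sub>R (q' - q)"
    define h where "h = k + \<tau>"
    have "norm \<tau> \<le> \<rho> / 2" using q'(2) d by (simp add: \<tau>_def pos_less_divide_eq mult.commute mult.left_commute)
    then have h: "norm h \<le> \<rho>" using k norm_triangle_ineq[of k \<tau>] by (simp add: h_def)
    have zr: "z + d *\<^sub>R q + h = z + k + d *\<^sub>R q'" by (simp add: h_def \<tau>_def algebra_simps)
    have 1: "v (z + k) + d * (norm q')\<^sup>2 / 2 \<le> v z + d * (norm q)\<^sup>2 / 2 + q \<bullet> h + 1 / 2 * (h \<bullet> (X *v h))"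
      using t[OF h] unfolding zr inf_conv_eq(1)[OF q'(1) d] inf_conv_eq(1)[OF q d] .
    have 2: "d * (norm q')\<^sup>2 / 2 = d * (norm q)\<^sup>2 / 2 + q \<bullet> \<tau> + (norm \<tau>)\<^sup>2 / (2 * d)"
    proof -
      have "(norm q')\<^sup>2 = (norm q)\<^sup>2 + 2 * (q \<bullet> (q' - q)) + (norm (q' - q))\<^sup>2"
        using norm_add_sq[of q "q' - q"] by simp
      moreover have "(norm \<tau>)\<^sup>2 / (2 * d) = d * (norm (q' - q))\<^sup>2 / 2"
        using d by (simp add: \<tau>_def power_mult_distrib power2_eq_square)
      ultimately show ?thesis by (simp add: \<tau>_def distrib_left add_divide_distrib)
    qed
    have 3: "h \<bullet> (X *v h) = k \<bullet> (X *v k) + 2 * (\<tau> \<bullet> (X *v k)) + \<tau> \<bullet> (X *v \<tau>)"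
      using symmetric_inner[OF X(1), of k \<tau>]
      by (simp add: h_def matrix_vector_right_distrib inner_add_left inner_add_right)
    have Xk: "norm (X *v k) \<le> T * norm k" by (rule symmetric_norm_le[OF X])
    \<comment> \<open>The gain \<open>(norm \<tau>)\<^sup>2 / (2 * d)\<close> of fact 2 is spent in
      equal parts on the mixed term, by Young's inequality, and on the quadratic term in
      \<open>\<tau>\<close>, by \<open>2 * (T * d) \<le> 1\<close>. What remains is the loss
      \<open>d * T\<^sup>2 * (norm k)\<^sup>2\<close>.\<close>
    have "2 * (\<tau> \<bullet> (X *v k)) \<le> 2 * (norm \<tau> * (T * norm k))"
      using Cauchy_Schwarz_ineq2[of \<tau> "X *v k"] mult_left_mono[OF Xk, of "norm \<tau>"] by simp
    moreover have "2 * (norm \<tau> * (T * norm k)) \<le> (norm \<tau>)\<^sup>2 / (2 * d) + 2 * d * T\<^sup>2 * (norm k)\<^sup>2"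
    proof -
      have "0 \<le> (norm \<tau> - 2 * d * T * norm k)\<^sup>2 / (2 * d)" using d by simp
      also have "\<dots> = (norm \<tau>)\<^sup>2 / (2 * d) + 2 * d * T\<^sup>2 * (norm k)\<^sup>2 - 2 * (norm \<tau> * (T * norm k))"
        using d by (simp add: power2_eq_square field_simps)
      finally show ?thesis by simp
    qed
    moreover have "\<tau> \<bullet> (X *v \<tau>) \<le> (norm \<tau>)\<^sup>2 / (2 * d)"
    proof -
      have "\<tau> \<bullet> (X *v \<tau>) \<le> T * (norm \<tau>)\<^sup>2" using X(2)[of \<tau>] by linarith
      also have "\<dots> \<le> 1 / (2 * d) * (norm \<tau>)\<^sup>2"
        using T d by (intro mult_right_mono) (auto simp: field_simps)
      finally show ?thesis by simp
    qed
    moreover have "(norm \<tau>)\<^sup>2 / (2 * d) \<ge> 0" using d by simp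
    ultimately have "1/2 * (h \<bullet> (X *v h)) \<le> 1/2 * (k \<bullet> (X *v k)) + (norm \<tau>)\<^sup>2 / (2 * d) + d * T\<^sup>2 * (norm k)\<^sup>2"
      unfolding 3 by argo
    then show "v (z + k) \<le> v z + q \<bullet> k + 1 / 2 * (k \<bullet> (X *v k)) + d * T\<^sup>2 * (norm k)\<^sup>2"
      using 1 2 by (simp add: h_def inner_add_right)
  qed
qed

context
  fixes e :: real and K :: "'a::euclidean_space set" and u :: "'a \<Rightarrow> real"
  assumes e: "0 < e" and K: "compact K" "K \<noteq> {}" "continuous_on K u"
begin

lemma sup_conv_attained:
  obtains y where "y \<in> K" "sup_conv e K u z = u y - (norm (z - y))\<^sup>2 / (2 * e)"
    "\<And>y'. y' \<in> K \<Longrightarrow> u y' - (norm (z - y'))\<^sup>2 / (2 * e) \<le> sup_conv e K u z"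
proof -
  have "continuous_on K (\<lambda>y. u y - (norm (z - y))\<^sup>2 / (2 * e))"
    using e K(3) by (intro continuous_intros) auto
  then obtain y where y: "y \<in> K"
     "\<And>y'. y' \<in> K \<Longrightarrow> u y' - (norm (z - y'))\<^sup>2 / (2 * e) \<le> u y - (norm (z - y))\<^sup>2 / (2 * e)"
    using continuous_attains_sup[OF K(1,2), of "\<lambda>y. u y - (norm (z - y))\<^sup>2 / (2 * e)"] by auto
  have "sup_conv e K u z = u y - (norm (z - y))\<^sup>2 / (2 * e)"
    unfolding sup_conv_def by (rule cSup_eq_maximum) (use y in auto)
  then show thesis using y by (intro that[of y]) auto
qed

lemma sup_conv_ge: "y \<in> K \<Longrightarrow> u y - (norm (z - y))\<^sup>2 / (2 * e) \<le> sup_conv e K u z"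
  using sup_conv_attained by metis

text \<open>The paraboloid belonging to the maximiser \<open>y\<close> lies below the
  sup-convolution and meets it at \<open>z\<close>; the subgradient is its slope there.\<close>

lemma maximizer_prox_subgrad:
  assumes "y \<in> K" "sup_conv e K u z = u y - (norm (z - y))\<^sup>2 / (2 * e)"
  shows "(1/e) *\<^sub>R (y - z) \<in> prox_subgrad e (sup_conv e K u) z"
  unfolding prox_subgrad_def
proof clarify
  fix h
  have "(norm (z + h - y))\<^sup>2 = (norm (z - y))\<^sup>2 - 2 * ((y - z) \<bullet> h) + (norm h)\<^sup>2"
    using norm_add_sq[of "z - y" h] by (simp add: algebra_simps)
  then have "(norm (z + h - y))\<^sup>2 / (2 * e) = (norm (z - y))\<^sup>2 / (2 * e) - (y - z) \<bullet> h / e + (norm h)\<^sup>2 / (2 * e)"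
    by (simp add: add_divide_distrib diff_divide_distrib)
  then show "sup_conv e K u z + ((1 / e) *\<^sub>R (y - z)) \<bullet> h - (norm h)\<^sup>2 / (2 * e) \<le> sup_conv e K u (z + h)"
    using sup_conv_ge[OF assms(1), of "z + h"] assms(2) by simp
qed

lemma sup_conv_prox_subgrad_nonempty: "prox_subgrad e (sup_conv e K u) z \<noteq> {}"
  using sup_conv_attained maximizer_prox_subgrad by (metis empty_iff)

text \<open>Compactness: maximisers for points tending to \<open>z\<close> accumulate at a maximiser
  for \<open>z\<close>, whose subgradient can only be \<open>q\<close>. This supplies the assumption
  \<open>near\<close> of \<open>touching_transfer\<close>.\<close>

lemma prox_subgrad_near_if_unique:
  assumes uniq: "\<And>q'. q' \<in> prox_subgrad e (sup_conv e K u) z \<Longrightarrow> q' = q" and \<kappa>: "0 < \<kappa>"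
  shows "\<exists>\<rho>>0. \<forall>k. norm k < \<rho> \<longrightarrow> (\<exists>q'\<in>prox_subgrad e (sup_conv e K u) (z + k). norm (q' - q) < \<kappa>)"
proof (rule ccontr)
  assume "\<not> ?thesis"
  then have "\<forall>n. \<exists>k. norm k < inverse (real (Suc n)) \<and>
      (\<forall>q'\<in>prox_subgrad e (sup_conv e K u) (z + k). \<kappa> \<le> norm (q' - q))"
    by (metis inverse_positive_iff_positive not_less of_nat_0_less_iff zero_less_Suc)
  then obtain k where k: "\<And>n. norm (k n) < inverse (real (Suc n))"
      "\<And>n q'. q' \<in> prox_subgrad e (sup_conv e K u) (z + k n) \<Longrightarrow> \<kappa> \<le> norm (q' - q)"
    by metis
  have k0: "k \<longlonglongrightarrow> 0"
    by (rule Lim_null_comparison[OF _ LIMSEQ_inverse_real_of_nat])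
       (use k(1) in \<open>auto intro!: always_eventually less_imp_le\<close>)
  have "\<exists>y. \<forall>n. y n \<in> K \<and> sup_conv e K u (z + k n) = u (y n) - (norm (z + k n - y n))\<^sup>2 / (2 * e)"
    by (intro choice allI) (metis sup_conv_attained)
  then obtain y where y: "\<And>n. y n \<in> K"
    "\<And>n. sup_conv e K u (z + k n) = u (y n) - (norm (z + k n - y n))\<^sup>2 / (2 * e)" by auto
  obtain \<sigma> and l :: 'a where l: "l \<in> K" "strict_mono \<sigma>" "(y \<circ> \<sigma>) \<longlonglongrightarrow> l"
    using K(1) y(1) unfolding compact_def by metis
  have k\<sigma>: "(\<lambda>n. k (\<sigma> n)) \<longlonglongrightarrow> 0" using LIMSEQ_subseq_LIMSEQ[OF k0 l(2)] by (simp add: o_def)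
  have y\<sigma>: "(\<lambda>n. y (\<sigma> n)) \<longlonglongrightarrow> l" using l(3) by (simp add: o_def)
  have uy: "(\<lambda>n. u (y (\<sigma> n))) \<longlonglongrightarrow> u l"
    by (rule continuous_on_tendsto_compose[OF K(3) y\<sigma> l(1)]) (simp add: y(1))
  have "u y' - (norm (z - y'))\<^sup>2 / (2 * e) \<le> u l - (norm (z - l))\<^sup>2 / (2 * e)" if "y' \<in> K" for y'
  proof (rule LIMSEQ_le)
    show "(\<lambda>n. u y' - (norm (z + k (\<sigma> n) - y'))\<^sup>2 / (2 * e)) \<longlonglongrightarrow> u y' - (norm (z - y'))\<^sup>2 / (2 * e)"
      by (rule tendsto_eq_intros k\<sigma> refl | use e in simp)+
    show "(\<lambda>n. u (y (\<sigma> n)) - (norm (z + k (\<sigma> n) - y (\<sigma> n)))\<^sup>2 / (2 * e)) \<longlonglongrightarrow> u l - (norm (z - l))\<^sup>2 / (2 * e)"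
      by (rule tendsto_eq_intros k\<sigma> y\<sigma> uy refl | use e in simp)+
    show "\<exists>N. \<forall>n\<ge>N. u y' - (norm (z + k (\<sigma> n) - y'))\<^sup>2 / (2 * e)
       \<le> u (y (\<sigma> n)) - (norm (z + k (\<sigma> n) - y (\<sigma> n)))\<^sup>2 / (2 * e)"
      using sup_conv_ge[OF that] y(2) by metis
  qed
  then have "sup_conv e K u z = u l - (norm (z - l))\<^sup>2 / (2 * e)"
    by (metis l(1) order_antisym sup_conv_attained)
  from uniq[OF maximizer_prox_subgrad[OF l(1) this]] have q: "q = (1/e) *\<^sub>R (l - z)" by simp
  have "(\<lambda>n. (1/e) *\<^sub>R (y (\<sigma> n) - (z + k (\<sigma> n))) - q) \<longlonglongrightarrow> (1/e) *\<^sub>R (l - (z + 0)) - q"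
    by (intro tendsto_intros k\<sigma> y\<sigma>)
  then have "(\<lambda>n. norm ((1/e) *\<^sub>R (y (\<sigma> n) - (z + k (\<sigma> n))) - q)) \<longlonglongrightarrow> 0"
    using q by (intro tendsto_norm_zero) simp
  then have "eventually (\<lambda>n. norm ((1/e) *\<^sub>R (y (\<sigma> n) - (z + k (\<sigma> n))) - q) < \<kappa>) sequentially"
    using \<kappa> by (rule order_tendstoD)
  then obtain n where "norm ((1/e) *\<^sub>R (y (\<sigma> n) - (z + k (\<sigma> n))) - q) < \<kappa>"
    by (auto simp: eventually_sequentially)
  then show False using k(2)[OF maximizer_prox_subgrad[OF y(1) y(2)]] by (meson not_less)
qed

end

section \<open>Regularising viscosity subsolutions\<close>

lemma gderiv_grad:
  fixes f :: "real ^ 'n \<Rightarrow> real"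
  assumes "f differentiable (at x)"
  shows "GDERIV f x :> grad f x"
proof -
  obtain f' where f': "(f has_derivative f') (at x)" using assms by (auto simp: differentiable_def)
  interpret bounded_linear f' by (rule has_derivative_bounded_linear[OF f'])
  have "f' = (\<lambda>h. h \<bullet> (\<chi> i. f' (axis i 1)))"
  proof
    fix h :: "real ^ 'n"
    have "f' h = f' (\<Sum>i\<in>UNIV. h $ i *\<^sub>R axis i 1)" using basis_expansion[of h] by (simp add: scalar_mult_eq_scaleR)
    also have "\<dots> = h \<bullet> (\<chi> i. f' (axis i 1))" by (simp add: sum scaleR inner_vec_def)
    finally show "f' h = h \<bullet> (\<chi> i. f' (axis i 1))" .
  qed
  then have "GDERIV f x :> (\<chi> i. f' (axis i 1))" using f' by (simp add: gderiv_def)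
  then show ?thesis using grad_eqI by metis
qed

lemma Ck_on_1_iff:
  "Ck_on 1 S f \<longleftrightarrow> (\<forall>x\<in>S. f differentiable (at x)) \<and> continuous_on S (grad f)"
proof -
  have "(\<forall>i. continuous_on S (\<lambda>x. grad f x $ i)) \<longleftrightarrow> continuous_on S (grad f)"
    using continuous_on_vec_lambda[of S "\<lambda>i x. grad f x $ i"] by (auto intro: continuous_on_component)
  then show ?thesis by (simp only: One_nat_def Ck_on.simps)
qed

text \<open>Touching by an exact paraboloid on a ball, instead of up to a remainder of higher order.
  Passing from jets to this notion costs an arbitrarily small multiple of the identity
  (\<open>superjet_touches_above\<close>); the converse costs nothing.\<close>

definition touches_above ::
    "(real ^ 'n \<Rightarrow> real) \<Rightarrow> real ^ 'n \<Rightarrow> real ^ 'n \<Rightarrow> real ^ 'n ^ 'n \<Rightarrow> bool" where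
  "touches_above w x q X \<longleftrightarrow>
     (\<exists>\<rho>>0. \<forall>h. norm h \<le> \<rho> \<longrightarrow> w (x + h) \<le> w x + q \<bullet> h + 1 / 2 * (h \<bullet> (X *v h)))"

lemma touches_above_superjet:
  assumes "touches_above u x q X" "q \<noteq> 0" "transpose X = X"
  shows "(q, X) \<in> feeble_superjet u x"
proof -
  obtain \<rho> where \<rho>: "0 < \<rho>" "\<And>h. norm h \<le> \<rho> \<Longrightarrow> u (x + h) \<le> u x + q \<bullet> h + 1 / 2 * (h \<bullet> (X *v h))"
    using assms(1) by (auto simp: touches_above_def)
  have "\<forall>\<^sub>F z in at 0. u (z + x) \<le> u x + q \<bullet> z + 1 / 2 * (X \<bullet> tensor z z) + 0"
    unfolding eventually_at using \<rho>
    by (intro exI[of _ \<rho>]) (auto simp: inner_tensor add.commute[of _ x])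
  then show ?thesis
    unfolding feeble_superjet_def using assms(2,3) by (auto intro!: exI[of _ "\<lambda>_. 0"])
qed

text \<open>The mean value inequality for \<open>u\<close> minus the linear function with slope
  \<open>P\<close>.\<close>

lemma gradient_almost_constant:
  fixes u :: "real ^ 'n \<Rightarrow> real"
  assumes "\<And>y. y \<in> C \<Longrightarrow> GDERIV u y :> g y" "convex C" "\<And>y. y \<in> C \<Longrightarrow> norm (g y - P) \<le> \<eta>"
    and "a \<in> C" "b \<in> C"
  shows "u a - u b \<le> P \<bullet> (a - b) + \<eta> * norm (a - b)"
proof -
  have "norm ((u a - P \<bullet> a) - (u b - P \<bullet> b)) \<le> \<eta> * norm (a - b)"
  proof (rule differentiable_bound[OF assms(2) _ _ assms(4,5)])
    fix y assume y: "y \<in> C"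
    have "(u has_derivative (\<lambda>h. h \<bullet> g y)) (at y within C)"
      using assms(1)[OF y] unfolding gderiv_def by (rule has_derivative_at_withinI)
    from has_derivative_diff[OF this bounded_linear.has_derivative[OF bounded_linear_inner_right has_derivative_ident, of P]]
    show "((\<lambda>y. u y - P \<bullet> y) has_derivative (\<lambda>h. h \<bullet> (g y - P))) (at y within C)"
      by (simp add: inner_diff_right inner_commute)
    show "onorm (\<lambda>h. h \<bullet> (g y - P)) \<le> \<eta>"
    proof (rule onorm_le)
      fix h
      have "norm (h \<bullet> (g y - P)) \<le> norm (g y - P) * norm h"
        using Cauchy_Schwarz_ineq2[of h "g y - P"] by (simp add: mult.commute)
      also have "\<dots> \<le> \<eta> * norm h" by (intro mult_right_mono assms(3) y) auto
      finally show "norm (h \<bullet> (g y - P)) \<le> \<eta> * norm h" .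
    qed
  qed
  then show ?thesis by (simp add: inner_diff_right)
qed

lemma quadratic_lower_bound:
  fixes X :: "real ^ 'n ^ 'n"
  assumes "0 < \<rho>" and "\<And>h. norm h \<le> \<rho> \<Longrightarrow> - c * (norm h)\<^sup>2 \<le> h \<bullet> (X *v h)"
  shows "- c * (norm h)\<^sup>2 \<le> h \<bullet> (X *v h)"
proof (cases "h = 0")
  case False
  define s where "s = \<rho> / norm h"
  have s: "0 < s" using assms(1) False by (simp add: s_def)
  have "norm (s *\<^sub>R h) \<le> \<rho>" using False assms(1) by (simp add: s_def)
  from assms(2)[OF this] have "s\<^sup>2 * (- c * (norm h)\<^sup>2) \<le> s\<^sup>2 * (h \<bullet> (X *v h))"
    by (simp add: matrix_vector_mult_scaleR power_mult_distrib power2_eq_square mult_ac)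
  then show ?thesis by (rule mult_left_le_imp_le) (use s in simp)
qed simp

text \<open>One direction with curvature above \<open>T\<close> outweighs all others, which are at
  least \<open>- c\<close>: the matrix \<open>X + c *\<^sub>R mat 1\<close> is positive semidefinite
  with trace at least \<open>T\<close>, and ellipticity applies to it. The viscosity inequality is
  therefore used only for matrices bounded by \<open>T\<close>.\<close>

lemma pLaplace_op_nonneg_if_large:
  fixes X :: "real ^ 'n ^ 'n"
  assumes "1 < p" "transpose X = X" and lb: "\<And>h. - c * (norm h)\<^sup>2 \<le> h \<bullet> (X *v h)"
    and e: "T * (norm e)\<^sup>2 < e \<bullet> (X *v e)"
    and T: "c * (real CARD('n) + p - 2) \<le> min 1 (p - 1) * T" and c: "0 \<le> c"
  shows "0 \<le> pLaplace_op p P X"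
proof -
  define Y where "Y = X + c *\<^sub>R mat 1"
  have e0: "e \<noteq> 0" using e by auto
  have Y: "transpose Y = Y" "\<And>h. 0 \<le> h \<bullet> (Y *v h)"
    unfolding Y_def using lb transpose_add_mat[OF assms(2)] by (auto simp: quadratic_add_mat) (smt (verit) lb)
  have "T * (norm e)\<^sup>2 \<le> e \<bullet> (Y *v e)" using e c by (simp add: Y_def quadratic_add_mat add_increasing2 less_imp_le)
  also have "\<dots> \<le> (norm e)\<^sup>2 * trace Y" by (rule psd_quadratic_le_trace[OF Y])
  finally have "T \<le> trace Y" using e0 by (simp add: mult.commute)
  then have "min 1 (p - 1) * (norm P)\<^sup>2 * T \<le> min 1 (p - 1) * (norm P)\<^sup>2 * trace Y"
    using assms(1) by (intro mult_left_mono) auto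
  also have "\<dots> \<le> pLaplace_op p P Y" by (rule pLaplace_op_elliptic[OF assms(1) Y])
  finally have "min 1 (p - 1) * T * (norm P)\<^sup>2 \<le> pLaplace_op p P X + c * (norm P)\<^sup>2 * (real CARD('n) + p - 2)"
    by (simp add: Y_def pLaplace_op_add_mat mult_ac)
  moreover have "c * (real CARD('n) + p - 2) * (norm P)\<^sup>2 \<le> min 1 (p - 1) * T * (norm P)\<^sup>2"
    by (intro mult_right_mono T) auto
  ultimately show ?thesis by (simp add: mult_ac)
qed

text \<open>A paraboloid touching \<open>w\<close> at \<open>x\<close> is carried to
  \<open>v\<close> at \<open>z x\<close> and then to \<open>u\<close> at a maximiser
  \<open>y\<close>, always with the same nonzero gradient \<open>q x\<close>, so the feeble jet of
  \<open>u\<close> at \<open>y\<close> applies. The last conclusion allows every \<open>P\<close>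
  near \<open>q x'\<close>, which is what freezing the coefficients requires.\<close>

lemma sup_inf_regularisation:
  fixes u :: "real ^ 'n \<Rightarrow> real"
  assumes p: "1 < p" and \<Omega>: "open \<Omega>" and u: "Ck_on 1 \<Omega> u"
    and nz: "\<And>x. x \<in> \<Omega> \<Longrightarrow> grad u x \<noteq> 0"
    and visc: "feeble_visc_ge0 (pLaplace_op p) \<Omega> u"
    and S: "compact S" "S \<noteq> {}" "S \<subseteq> \<Omega>" and \<eta>: "0 < \<eta>"
  obtains w q C R \<kappa> where "0 < C" "0 < R" "0 < \<kappa>"
    "\<And>x h. \<bar>w (x + h) - w x - q x \<bullet> h\<bar> \<le> C * (norm h)\<^sup>2"
    "\<And>x. x \<in> S \<Longrightarrow> norm (q x - grad u x) \<le> \<eta>"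
    "\<And>x. x \<in> S \<Longrightarrow> q x \<noteq> 0"
    "\<And>x x' X P. \<lbrakk>x \<in> S; norm (x' - x) \<le> R; transpose X = X; touches_above w x' (q x') X; norm (P - q x') \<le> \<kappa>\<rbrakk>
        \<Longrightarrow> - \<eta> \<le> pLaplace_op p P X"
proof -
  have ud: "GDERIV u x :> grad u x" if "x \<in> \<Omega>" for x
    using u that gderiv_grad unfolding Ck_on_1_iff by blast
  have gc: "continuous_on \<Omega> (grad u)" using u unfolding Ck_on_1_iff by blast
  have uc: "continuous_on \<Omega> u"
    using ud unfolding gderiv_def by (meson continuous_at_imp_continuous_on has_derivative_continuous)
  obtain e0 where e0: "0 < e0" "{x. infdist x S \<le> e0} \<subseteq> \<Omega>"
    using compact_in_open_separated[OF S(2,1) \<Omega> S(3)] by auto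
  define K where "K = {x. infdist x S \<le> e0}"
  have K: "compact K" unfolding K_def by (rule compact_infdist_le[OF S(2,1) e0(1)])
  have K\<Omega>: "K \<subseteq> \<Omega>" using e0(2) by (simp add: K_def)
  have inK: "y \<in> K" if "x \<in> S" "norm (y - x) \<le> e0" for x y
    using infdist_le[OF that(1), of y] that(2) by (simp add: K_def dist_norm)
  obtain s0 where "s0 \<in> S" using S(2) by blast
  then have Kne: "K \<noteq> {}" using inK[of s0 s0] e0(1) by auto
  have cK: "continuous_on K u" "continuous_on K (grad u)"
    using uc gc K\<Omega> by (auto intro: continuous_on_subset)
  obtain M where M: "0 < M" "\<And>x. x \<in> K \<Longrightarrow> \<bar>u x\<bar> \<le> M"
    using compact_imp_bounded[OF compact_continuous_image[OF cK(1) K]] by (force simp: bounded_pos)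
  obtain B where B: "0 < B" "\<And>x. x \<in> K \<Longrightarrow> norm (grad u x) \<le> B"
    using compact_imp_bounded[OF compact_continuous_image[OF cK(2) K]] by (force simp: bounded_pos)
  obtain xm where xm: "xm \<in> K" "\<And>x. x \<in> K \<Longrightarrow> norm (grad u xm) \<le> norm (grad u x)"
    using continuous_attains_inf[OF K Kne continuous_on_norm[OF cK(2)]] by auto
  define m where "m = norm (grad u xm)"
  have m: "0 < m" "\<And>x. x \<in> K \<Longrightarrow> m \<le> norm (grad u x)"
    using xm nz K\<Omega> by (auto simp: m_def)
  define \<eta>1 where "\<eta>1 = min \<eta> (m / 2)"
  have \<eta>1: "0 < \<eta>1" "\<eta>1 \<le> \<eta>" "\<eta>1 \<le> m / 2" using \<eta> m by (auto simp: \<eta>1_def)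
  \<comment> \<open>The distance \<open>e0\<close> is shared by four moves of length at most
    \<open>\<rho>0\<close>: from \<open>s\<close> to \<open>x\<close>, to \<open>z x\<close>, to the
    maximiser \<open>y\<close>, and to \<open>y + k\<close>.\<close>
  define \<rho>0 where "\<rho>0 = e0 / 4"
  have \<rho>0: "0 < \<rho>0" "e0 = 4 * \<rho>0" using e0 by (auto simp: \<rho>0_def)
  obtain R0 where R0: "0 < R0" "\<And>x y. x \<in> K \<Longrightarrow> y \<in> K \<Longrightarrow> dist y x < R0 \<Longrightarrow> dist (grad u y) (grad u x) < \<eta>1"
    using compact_uniformly_continuous[OF cK(2) K] \<eta>1(1) unfolding uniformly_continuous_on_def by metis
  define R where "R = min \<rho>0 (R0 / 2)"
  have R: "0 < R" "R \<le> \<rho>0" "R < R0" using R0 \<rho>0 by (auto simp: R_def)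
  \<comment> \<open>Chosen so that a maximiser \<open>y\<close> for a point \<open>z\<close> of
    \<open>K\<close> satisfies
    \<open>(norm (z - y))\<^sup>2 \<le> 4 * M * e = (R / 8)\<^sup>2\<close>.\<close>
  define e where "e = R\<^sup>2 / (256 * M)"
  have e: "0 < e" using R M by (simp add: e_def)
  \<comment> \<open>By \<open>inf_conv_lower\<close> a matrix touching \<open>w\<close> from above
    has curvature at least \<open>- c\<close>.\<close>
  define c where "c = 2 / e"
  have c: "0 < c" using e by (simp add: c_def)
  define N where "N = real CARD('n) + p"
  have n1: "1 \<le> real CARD('n)" using zero_less_card_finite[where 'a='n] by linarith
  have N: "1 < N" "0 < N - 2" unfolding N_def using p n1 by linarith+
  \<comment> \<open>The threshold for \<open>pLaplace_op_nonneg_if_large\<close>, fixed before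
    \<open>d\<close>.\<close>
  define T where "T = c * N / min 1 (p - 1)"
  have T: "0 < T" using c N p by (simp add: T_def)
  have TN: "min 1 (p - 1) * T = c * N" using p by (simp add: T_def)
  have cT: "c \<le> T"
  proof -
    have "min 1 (p - 1) * T \<le> 1 * T" using T by (intro mult_right_mono) auto
    moreover have "c * 1 \<le> c * N" using c N by (intro mult_left_mono) auto
    ultimately show ?thesis using TN by simp
  qed
  \<comment> \<open>The three bounds serve the resolvent, the smallness of \<open>T * d\<close> for
    uniqueness and transfer, and a transfer loss that changes the operator by at most
    \<open>\<eta> / 2\<close>.\<close>
  define d where "d = min (e / 2) (min (1 / (4 * T)) (\<eta> / (4 * T\<^sup>2 * (B + \<eta>1)\<^sup>2 * N)))"
  have d: "0 < d" "2 * d \<le> e" "d \<le> e" using e T \<eta> B \<eta>1 N by (auto simp: d_def)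
  have dT: "4 * (T * d) \<le> 1"
  proof -
    have "d \<le> 1 / (4 * T)" by (simp add: d_def)
    then show ?thesis using T by (simp add: field_simps)
  qed
  have d\<eta>: "2 * d * T\<^sup>2 * ((B + \<eta>1)\<^sup>2 * N) \<le> \<eta> / 2"
  proof -
    have "d \<le> \<eta> / (4 * T\<^sup>2 * (B + \<eta>1)\<^sup>2 * N)" by (simp add: d_def)
    then show ?thesis using T B \<eta>1 N by (simp add: field_simps)
  qed
  define v where "v = sup_conv e K u"
  define w where "w = inf_conv d v"
  note sc = e K Kne cK(1)
  have ne: "prox_subgrad e v z \<noteq> {}" for z
    unfolding v_def by (rule sup_conv_prox_subgrad_nonempty[OF sc])
  have near: "norm (y - z) \<le> R / 8"
    if "z \<in> K" "y \<in> K" "v z = u y - (norm (z - y))\<^sup>2 / (2 * e)" for y z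
  proof -
    have "u z \<le> v z" using sup_conv_ge[OF sc that(1), of z] by (simp add: v_def)
    then have "(norm (z - y))\<^sup>2 / (2 * e) \<le> 2 * M" using that(3) M(2)[OF that(1)] M(2)[OF that(2)] by linarith
    then have "(norm (z - y))\<^sup>2 \<le> 4 * M * e" using e by (simp add: field_simps)
    also have "\<dots> = (R / 8)\<^sup>2" using M by (simp add: e_def power2_eq_square)
    finally show ?thesis using R by (simp add: norm_minus_commute power2_le_iff_abs_le)
  qed
  \<comment> \<open>Every \<open>x\<close> is written as \<open>z x + d *\<^sub>R q x\<close>. The
    factor 2 comes from \<open>4 * d / e \<le> 2\<close>; the selected \<open>q\<close> turns out to
    be the gradient of \<open>w\<close>.\<close>
  have "\<forall>x. \<exists>q z y. y \<in> K \<and> v x = u y - (norm (x - y))\<^sup>2 / (2 * e) \<and> q \<in> prox_subgrad e v z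
      \<and> x = z + d *\<^sub>R q \<and> norm (x - z) \<le> 2 * norm (y - x)"
  proof
    fix x
    obtain y where y: "y \<in> K" "v x = u y - (norm (x - y))\<^sup>2 / (2 * e)"
      using sup_conv_attained[OF sc] unfolding v_def by metis
    have r: "(1/e) *\<^sub>R (y - x) \<in> prox_subgrad e v x"
      using maximizer_prox_subgrad[OF sc] y unfolding v_def by blast
    obtain z q where zq: "q \<in> prox_subgrad e v z" "x = z + d *\<^sub>R q"
        "norm (x - z) \<le> 4 * d * norm ((1/e) *\<^sub>R (y - x))"
      using resolvent_exists[OF ne d(1,2) r] by metis
    have "4 * d * norm ((1/e) *\<^sub>R (y - x)) = (2 * (2 * d) / e) * norm (y - x)" using e by simp
    also have "\<dots> \<le> 2 * norm (y - x)" using d e by (intro mult_right_mono) (auto simp: field_simps)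
    finally have "norm (x - z) \<le> 2 * norm (y - x)" using zq(3) by linarith
    then show "\<exists>q z y. y \<in> K \<and> v x = u y - (norm (x - y))\<^sup>2 / (2 * e) \<and> q \<in> prox_subgrad e v z
      \<and> x = z + d *\<^sub>R q \<and> norm (x - z) \<le> 2 * norm (y - x)"
      using y zq(1,2) by blast
  qed
  then obtain q z y0 where qz: "\<And>x. y0 x \<in> K" "\<And>x. v x = u (y0 x) - (norm (x - y0 x))\<^sup>2 / (2 * e)"
      "\<And>x. q x \<in> prox_subgrad e v (z x)" "\<And>x. x = z x + d *\<^sub>R q x" "\<And>x. norm (x - z x) \<le> 2 * norm (y0 x - x)"
    by metis
  have ub: "w x \<le> v z' + (norm (x - z'))\<^sup>2 / (2 * d)" for x z'
    using inf_conv_eq(2)[OF qz(3)[of x] d(1,3)] qz(4)[of x] unfolding w_def by metis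
  have wx: "w x = v (z x) + d * (norm (q x))\<^sup>2 / 2" for x
    using inf_conv_eq(1)[OF qz(3)[of x] d(1,3)] qz(4)[of x] unfolding w_def by metis
  have up: "w (x + h) \<le> w x + q x \<bullet> h + (norm h)\<^sup>2 / (2 * d)" for x h
    using inf_conv_upper[OF qz(3)[of x] d(1,3) ub[unfolded w_def]] qz(4)[of x] unfolding w_def by metis
  have lo: "w x + q x \<bullet> h - (norm h)\<^sup>2 / e \<le> w (x + h)" for x h
    using inf_conv_lower[OF qz(3)[of x] d(1,2) ne] qz(4)[of x] unfolding w_def by metis
  have zx: "norm (x - z x) \<le> R / 4" if "x \<in> K" for x
    using near[OF that qz(1,2)[of x]] qz(5)[of x] by simp
  have qP: "norm (q x - grad u x) \<le> \<eta>1" if s: "s \<in> S" "norm (x - s) \<le> \<rho>0" for s x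
  proof -
    define P where "P = grad u x"
    have ballK: "y \<in> K" if "norm (y - x) \<le> R" for y
      using inK[OF s(1), of y] s(2) that R \<rho>0 norm_triangle_ineq[of "y - x" "x - s"] by simp
    have xK: "x \<in> K" using ballK[of x] R by simp
    \<comment> \<open>Both points are shifted by the displacement \<open>k\<close> of the maximiser
      for \<open>a\<close>; the two penalties cancel and the estimate reduces to one for
      \<open>u\<close>.\<close>
    have vl: "v a - v b \<le> P \<bullet> (a - b) + \<eta>1 * norm (a - b)" if ab: "norm (a - x) \<le> R/2" "norm (b - x) \<le> R/2" for a b
    proof -
      have aK: "a \<in> K" using ballK[of a] ab R by simp
      define k where "k = y0 a - a"
      have k: "norm k \<le> R / 8" using near[OF aK qz(1,2)[of a]] by (simp add: k_def)
      have ak: "a + k \<in> cball x R" "b + k \<in> cball x R"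
        using ab k norm_triangle_ineq[of "a - x" k] norm_triangle_ineq[of "b - x" k] R
        by (auto simp: dist_norm norm_minus_commute algebra_simps)
      have "u (a + k) - u (b + k) \<le> P \<bullet> ((a + k) - (b + k)) + \<eta>1 * norm ((a + k) - (b + k))"
      proof (rule gradient_almost_constant[OF _ convex_cball _ ak])
        fix y assume "y \<in> cball x R"
        then have y: "norm (y - x) \<le> R" by (simp add: dist_norm norm_minus_commute)
        show "GDERIV u y :> grad u y" using ud ballK[OF y] K\<Omega> by blast
        show "norm (grad u y - P) \<le> \<eta>1"
          using R0(2)[OF xK ballK[OF y]] y R by (simp add: P_def dist_norm)
      qed
      moreover have "v a = u (a + k) - (norm k)\<^sup>2 / (2 * e)"
        using qz(2)[of a] by (simp add: k_def norm_minus_commute)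
      moreover have "u (b + k) - (norm k)\<^sup>2 / (2 * e) \<le> v b"
      proof -
        have "b + k \<in> K" using ballK[of "b + k"] ak(2) by (simp add: dist_norm norm_minus_commute)
        from sup_conv_ge[OF sc this, of b] show ?thesis by (simp add: v_def)
      qed
      ultimately show ?thesis by simp
    qed
    define g where "g = q x - P"
    \<comment> \<open>The lower expansion of \<open>w\<close> at \<open>x\<close> is played against
      the almost linear growth of \<open>v\<close> at \<open>z x\<close>. Taking \<open>h\<close>
      along \<open>g\<close> and shrinking it gives \<open>norm g \<le> \<eta>1\<close>.\<close>
    have key: "g \<bullet> h \<le> \<eta>1 * norm h + (norm h)\<^sup>2 / e" if "norm h \<le> R / 8" for h
    proof -
      have zn: "norm (z x - x) \<le> R / 4" using zx[OF xK] by (simp add: norm_minus_commute)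
      have "norm (z x + h - x) \<le> R / 2"
        using norm_triangle_ineq[of "z x - x" h] zn that R by (simp add: algebra_simps)
      then have "v (z x + h) - v (z x) \<le> P \<bullet> h + \<eta>1 * norm h"
        using vl[of "z x + h" "z x"] zn R by simp
      moreover have "w (x + h) \<le> v (z x + h) + d * (norm (q x))\<^sup>2 / 2"
      proof -
        have "x + h - (z x + h) = d *\<^sub>R q x" using qz(4)[of x] by (simp add: algebra_simps)
        then show ?thesis using ub[of "x + h" "z x + h"] d by (simp add: power2_eq_square mult_ac)
      qed
      ultimately show ?thesis using lo[of x h] wx[of x] by (simp add: g_def inner_diff_left)
    qed
    have "norm g \<le> \<eta>1"
    proof (cases "g = 0")
      case False
      show ?thesis
      proof (rule le_if_le_add_small)
        fix t :: real assume t: "0 < t" "t \<le> 1"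
        define h where "h = (t * (R / 8) / norm g) *\<^sub>R g"
        have nh: "norm h = t * (R / 8)" using False t R by (simp add: h_def)
        have "norm h \<le> R / 8" unfolding nh using t R by (simp add: mult_left_le_one_le)
        from key[OF this] have "norm g * (t * (R / 8)) \<le> (\<eta>1 + t * (R / 8) / e) * (t * (R / 8))"
          unfolding nh using False by (simp add: h_def dot_square_norm power2_eq_square algebra_simps)
        then have "norm g \<le> \<eta>1 + t * (R / 8) / e"
          by (rule mult_right_le_imp_le) (use t R in simp)
        then show "norm g \<le> \<eta>1 + t * ((R / 8) / e)" by simp
      qed
    qed (use \<eta>1 in simp)
    then show ?thesis by (simp add: g_def P_def)
  qed
  have inK': "x \<in> K" if "s \<in> S" "norm (x - s) \<le> \<rho>0" for s x
    using inK[OF that(1), of x] that(2) \<rho>0 by simp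
  have q0: "q x \<noteq> 0" if "s \<in> S" "norm (x - s) \<le> \<rho>0" for s x
    using qP[OF that] m(1) m(2)[OF inK'[OF that]] \<eta>1 norm_triangle_ineq2[of "grad u x" "q x"]
    by (auto simp: norm_minus_commute)
  have qB: "norm (q x) \<le> B + \<eta>1" if "s \<in> S" "norm (x - s) \<le> \<rho>0" for s x
    using qP[OF that] B(2)[OF inK'[OF that]] norm_triangle_ineq2[of "q x" "grad u x"] by linarith
  define G where "G = (\<bar>p - 2\<bar> + real CARD('n)) * T * (2 * (B + \<eta>1) + 1)"
  have G: "0 < G" using T B \<eta>1 n1 by (auto simp: G_def intro!: mult_pos_pos add_nonneg_pos)
  define \<kappa> where "\<kappa> = min 1 (\<eta> / (2 * G))"
  have \<kappa>: "0 < \<kappa>" "\<kappa> \<le> 1" "G * \<kappa> \<le> \<eta> / 2"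
  proof -
    show "0 < \<kappa>" "\<kappa> \<le> 1" using \<eta> G by (auto simp: \<kappa>_def)
    have "\<kappa> \<le> \<eta> / (2 * G)" by (simp add: \<kappa>_def)
    then show "G * \<kappa> \<le> \<eta> / 2" using G by (simp add: field_simps)
  qed
  have main: "- \<eta> \<le> pLaplace_op p P X"
    if s: "s \<in> S" "norm (x - s) \<le> \<rho>0" and X: "transpose X = X" and t: "touches_above w x (q x) X"
      and P: "norm (P - q x) \<le> \<kappa>" for s x X P
  proof -
    obtain \<rho> where \<rho>: "0 < \<rho>"
        "\<And>h. norm h \<le> \<rho> \<Longrightarrow> w (x + h) \<le> w x + q x \<bullet> h + 1 / 2 * (h \<bullet> (X *v h))"
      using t by (auto simp: touches_above_def)
    have lb: "- c * (norm h)\<^sup>2 \<le> h \<bullet> (X *v h)" for h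
    proof (rule quadratic_lower_bound[OF \<rho>(1)])
      fix h :: "real ^ 'n" assume "norm h \<le> \<rho>"
      from \<rho>(2)[OF this] lo[of x h] show "- c * (norm h)\<^sup>2 \<le> h \<bullet> (X *v h)"
        by (simp add: c_def)
    qed
    \<comment> \<open>Either some curvature exceeds \<open>T\<close> and ellipticity alone decides,
      or \<open>X\<close> is bounded by \<open>T\<close> and the touching can be
      transferred.\<close>
    show ?thesis
    proof (cases "\<exists>a. T * (norm a)\<^sup>2 < a \<bullet> (X *v a)")
      case True
      then obtain a where a: "T * (norm a)\<^sup>2 < a \<bullet> (X *v a)" by blast
      have "c * (real CARD('n) + p - 2) \<le> min 1 (p - 1) * T"
        unfolding TN N_def using c by (intro mult_left_mono) auto
      from pLaplace_op_nonneg_if_large[OF p X lb a this] c \<eta> show ?thesis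
        by (meson less_imp_le neg_le_0_iff_le order_trans)
    next
      case False
      have XT: "\<bar>h \<bullet> (X *v h)\<bar> \<le> T * (norm h)\<^sup>2" for h
      proof -
        have "h \<bullet> (X *v h) \<le> T * (norm h)\<^sup>2" using False by (meson not_less)
        moreover have "c * (norm h)\<^sup>2 \<le> T * (norm h)\<^sup>2" by (intro mult_right_mono cT) auto
        ultimately show ?thesis using lb[of h] by linarith
      qed
      have tw: "inf_conv d v (z x + d *\<^sub>R q x + h)
          \<le> inf_conv d v (z x + d *\<^sub>R q x) + q x \<bullet> h + 1 / 2 * (h \<bullet> (X *v h))" if "norm h \<le> \<rho>" for h
        using \<rho>(2)[OF that] qz(4)[of x] unfolding w_def by simp
      have tw': "inf_conv d v (z x + d *\<^sub>R q x + h)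
          \<le> inf_conv d v (z x + d *\<^sub>R q x) + q x \<bullet> h + T / 2 * (norm h)\<^sup>2" if "norm h \<le> \<rho>" for h
        using tw[OF that] XT[of h] by simp
      have uniq: "q' = q x" if "q' \<in> prox_subgrad e v (z x)" for q'
        by (rule prox_subgrad_unique_if_touched[OF qz(3) that d(1,3) \<rho>(1) tw']) (use dT in auto)
      have nr: "\<exists>\<rho>>0. \<forall>k. norm k < \<rho> \<longrightarrow> (\<exists>q'\<in>prox_subgrad e v (z x + k). norm (q' - q x) < \<kappa>')"
        if "0 < \<kappa>'" for \<kappa>'
        using prox_subgrad_near_if_unique[OF sc uniq[unfolded v_def] that] unfolding v_def .
      obtain \<rho>' where \<rho>': "0 < \<rho>'" "\<And>k. norm k < \<rho>' \<Longrightarrow>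
          v (z x + k) \<le> v (z x) + q x \<bullet> k + 1 / 2 * (k \<bullet> (X *v k)) + d * T\<^sup>2 * (norm k)\<^sup>2"
        using touching_transfer[OF qz(3) d(1,3) \<rho>(1) tw X XT _ nr] dT by auto
      have xK: "x \<in> K" by (rule inK'[OF s])
      have zK: "z x \<in> K"
        using inK[OF s(1), of "z x"] s(2) zx[OF xK] R \<rho>0 norm_triangle_ineq[of "z x - x" "x - s"]
        by (simp add: norm_minus_commute)
      define y where "y = y0 (z x)"
      have y: "y \<in> K" "v (z x) = u y - (norm (z x - y))\<^sup>2 / (2 * e)" using qz(1,2) by (auto simp: y_def)
      have yS: "norm (y - s) \<le> 3 * \<rho>0"
        using near[OF zK y] zx[OF xK] s(2) R norm_triangle_ineq[of "y - z x" "z x - s"]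
          norm_triangle_ineq[of "z x - x" "x - s"] by (simp add: norm_minus_commute)
      have qy: "q x = (1/e) *\<^sub>R (y - z x)"
        using uniq maximizer_prox_subgrad[OF sc] y unfolding v_def by metis
      \<comment> \<open>Half the quadratic form of the added multiple of the identity is exactly the
        transfer loss.\<close>
      define X' where "X' = X + (2 * d * T\<^sup>2) *\<^sub>R mat 1"
      have "touches_above u y (q x) X'"
        unfolding touches_above_def
      proof (intro exI[of _ "min (\<rho>' / 2) \<rho>0"] conjI allI impI)
        show "0 < min (\<rho>' / 2) \<rho>0" using \<rho>' \<rho>0 by simp
        fix k :: "real ^ 'n" assume k: "norm k \<le> min (\<rho>' / 2) \<rho>0"
        have "norm k < \<rho>'" using k \<rho>' by linarith
        have "y + k \<in> K"
          using inK[OF s(1), of "y + k"] yS k \<rho>0 norm_triangle_ineq[of "y - s" k] by (simp add: algebra_simps)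
        \<comment> \<open>The competitor \<open>y + k\<close> for \<open>z x + k\<close> has the
          same penalty as \<open>y\<close> for \<open>z x\<close>, so the bound for \<open>v\<close>
          passes to \<open>u\<close> unchanged.\<close>
        from sup_conv_ge[OF sc this, of "z x + k"]
        have "u (y + k) \<le> v (z x + k) + (norm (z x - y))\<^sup>2 / (2 * e)" by (simp add: v_def)
        with \<rho>'(2)[OF \<open>norm k < \<rho>'\<close>] y(2)
        show "u (y + k) \<le> u y + q x \<bullet> k + 1 / 2 * (k \<bullet> (X' *v k))"
          unfolding X'_def quadratic_add_mat by argo
      qed
      from touches_above_superjet[OF this q0[OF s]] transpose_add_mat[OF X]
      have "(q x, X') \<in> feeble_superjet u y" by (simp add: X'_def)
      then have "0 \<le> pLaplace_op p (q x) X'"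
        using visc y(1) K\<Omega> unfolding feeble_visc_ge0_def by blast
      then have "- (2 * d * T\<^sup>2 * ((norm (q x))\<^sup>2 * (N - 2))) \<le> pLaplace_op p (q x) X"
        by (simp add: X'_def pLaplace_op_add_mat N_def mult_ac algebra_simps)
      moreover have "2 * d * T\<^sup>2 * ((norm (q x))\<^sup>2 * (N - 2)) \<le> 2 * d * T\<^sup>2 * ((B + \<eta>1)\<^sup>2 * N)"
        using qB[OF s] N d by (intro mult_left_mono mult_mono power_mono) auto
      ultimately have 1: "- (\<eta> / 2) \<le> pLaplace_op p (q x) X" using d\<eta> by linarith
      have "\<bar>pLaplace_op p P X - pLaplace_op p (q x) X\<bar>
          \<le> (\<bar>p - 2\<bar> + CARD('n)) * T * norm (P - q x) * (norm P + norm (q x))"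
        by (rule pLaplace_op_diff_le[OF symmetric_norm_le[OF X XT]])
      also have "\<dots> \<le> (\<bar>p - 2\<bar> + CARD('n)) * T * \<kappa> * (2 * (B + \<eta>1) + 1)"
      proof -
        have "norm P \<le> B + \<eta>1 + 1" using qB[OF s] P \<kappa>(2) norm_triangle_ineq2[of P "q x"] by linarith
        then show ?thesis using qB[OF s] T P \<kappa>(1) by (intro mult_mono) auto
      qed
      also have "\<dots> = G * \<kappa>" by (simp add: G_def)
      finally show ?thesis using 1 \<kappa>(3) by linarith
    qed
  qed
  show thesis
  proof (rule that[of "1 / (2 * d) + 1 / e" \<rho>0 \<kappa> w q])
    show "0 < 1 / (2 * d) + 1 / e" using d e by (simp add: add_pos_pos)
    show "\<bar>w (x + h) - w x - q x \<bullet> h\<bar> \<le> (1 / (2 * d) + 1 / e) * (norm h)\<^sup>2" for x h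
    proof -
      have "0 \<le> (norm h)\<^sup>2 / (2 * d)" "0 \<le> (norm h)\<^sup>2 / e" using d e by auto
      then show ?thesis using up[of x h] lo[of x h] by (simp add: distrib_right abs_le_iff)
    qed
    show "norm (q x - grad u x) \<le> \<eta>" if "x \<in> S" for x using qP[OF that, of x] \<rho>0 \<eta>1 by simp
    show "q x \<noteq> 0" if "x \<in> S" for x using q0[OF that, of x] \<rho>0 by simp
  qed (use \<rho>0 \<kappa> main in auto)
qed

section \<open>The Gaussian kernel\<close>

lemma has_derivative_quadratic_bound:
  fixes F :: "'a::euclidean_space \<Rightarrow> real"
  assumes r: "0 < r" and b: "\<And>e. norm e \<le> r \<Longrightarrow> \<bar>F (x + e) - F x - D \<bullet> e\<bar> \<le> C * (norm e)\<^sup>2"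
  shows "(F has_derivative (\<lambda>e. D \<bullet> e)) (at x)"
proof -
  have "((\<lambda>e. \<bar>F (x + e) - F x - D \<bullet> e\<bar> / norm e) \<longlongrightarrow> 0) (at 0)"
  proof (rule Lim_null_comparison)
    show "\<forall>\<^sub>F e in at 0. norm (\<bar>F (x + e) - F x - D \<bullet> e\<bar> / norm e) \<le> C * norm e"
      unfolding eventually_at
    proof (intro exI[of _ r] conjI ballI impI r)
      fix e :: 'a assume e: "e \<noteq> 0 \<and> dist e 0 < r"
      then have "\<bar>F (x + e) - F x - D \<bullet> e\<bar> \<le> C * norm e * norm e"
        using b[of e] by (simp add: power2_eq_square)
      then show "norm (\<bar>F (x + e) - F x - D \<bullet> e\<bar> / norm e) \<le> C * norm e"
        using e by (simp add: pos_divide_le_eq)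
    qed
    have "((\<lambda>e::'a. C * norm e) \<longlongrightarrow> C * norm (0::'a)) (at 0)" by (intro tendsto_intros)
    then show "((\<lambda>e::'a. C * norm e) \<longlongrightarrow> 0) (at 0)" by simp
  qed
  then show ?thesis
    unfolding has_derivative_at by (simp add: bounded_linear_inner_right)
qed

lemma lborel_translate:
  fixes f :: "'a::euclidean_space \<Rightarrow> 'b::{banach, second_countable_topology}"
  assumes [measurable]: "f \<in> borel_measurable borel"
  shows "integrable lborel (\<lambda>y. f (c + y)) \<longleftrightarrow> integrable lborel f"
    and "(\<integral>y. f (c + y) \<partial>lborel) = (\<integral>y. f y \<partial>lborel)"
proof -
  have "integrable (distr lborel borel ((+) c)) f \<longleftrightarrow> integrable lborel (\<lambda>y. f (c + y))"
    by (rule integrable_distr_eq) auto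
  then show "integrable lborel (\<lambda>y. f (c + y)) \<longleftrightarrow> integrable lborel f" by (simp add: lborel_distr_plus)
  have "integral\<^sup>L (distr lborel borel ((+) c)) f = (\<integral>y. f (c + y) \<partial>lborel)"
    by (rule integral_distr) auto
  then show "(\<integral>y. f (c + y) \<partial>lborel) = (\<integral>y. f y \<partial>lborel)" by (simp add: lborel_distr_plus)
qed

text \<open>Differentiation under the integral with all derivatives on the kernel, whose second
  order remainder is dominated by \<open>m\<close>. It serves the Gaussian and the mollifiers
  alike.\<close>

lemma kernel_has_derivative:
  fixes f k m :: "real ^ 'n \<Rightarrow> real" and g :: "real ^ 'n \<Rightarrow> real ^ 'n"
  assumes k: "\<And>e y. norm e \<le> 1 \<Longrightarrow> \<bar>k (y + e) - k y - g y \<bullet> e\<bar> \<le> (norm e)\<^sup>2 * m y"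
    and ik: "\<And>e. norm e \<le> 1 \<Longrightarrow> integrable lborel (\<lambda>y. f y * k (y + e))"
    and ig: "integrable lborel (\<lambda>y. f y *\<^sub>R g y)"
    and im: "integrable lborel (\<lambda>y. \<bar>f y\<bar> * m y)"
  shows "((\<lambda>e. \<integral>y. f y * k (y + e) \<partial>lborel) has_derivative (\<lambda>e. (\<integral>y. f y *\<^sub>R g y \<partial>lborel) \<bullet> e)) (at 0)"
proof (rule has_derivative_quadratic_bound[where r = 1 and C = "\<integral>y. \<bar>f y\<bar> * m y \<partial>lborel"])
  fix e :: "real ^ 'n" assume e: "norm e \<le> 1"
  note i = ik[OF e] ik[of 0, simplified]
  have igi: "integrable lborel (\<lambda>y. (f y *\<^sub>R g y) \<bullet> e)" by (rule integrable_inner_left) (rule ig)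
  then have ig': "integrable lborel (\<lambda>y. f y * (g y \<bullet> e))" by simp
  have eg: "(\<integral>y. (f y *\<^sub>R g y) \<bullet> e \<partial>lborel) = (\<integral>y. f y *\<^sub>R g y \<partial>lborel) \<bullet> e"
    by (rule integral_inner_left) (rule ig)
  have "(\<integral>y. f y * k (y + e) \<partial>lborel) - (\<integral>y. f y * k y \<partial>lborel) - (\<integral>y. f y *\<^sub>R g y \<partial>lborel) \<bullet> e
      = (\<integral>y. f y * (k (y + e) - k y - g y \<bullet> e) \<partial>lborel)"
    using i ig' by (simp add: right_diff_distrib eg[symmetric])
  also have "\<bar>\<dots>\<bar> \<le> (\<integral>y. (norm e)\<^sup>2 * (\<bar>f y\<bar> * m y) \<partial>lborel)"
  proof (rule order_trans[OF integral_abs_bound integral_mono])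
    show "integrable lborel (\<lambda>y. \<bar>f y * (k (y + e) - k y - g y \<bullet> e)\<bar>)"
      using i ig' by (simp add: right_diff_distrib)
    show "integrable lborel (\<lambda>y. (norm e)\<^sup>2 * (\<bar>f y\<bar> * m y))" using im by simp
    show "\<bar>f y * (k (y + e) - k y - g y \<bullet> e)\<bar> \<le> (norm e)\<^sup>2 * (\<bar>f y\<bar> * m y)" for y
      using mult_left_mono[OF k[OF e, of y], of "\<bar>f y\<bar>"] by (simp add: abs_mult mult_ac)
  qed
  also have "\<dots> = (\<integral>y. \<bar>f y\<bar> * m y \<partial>lborel) * (norm e)\<^sup>2" using im by simp
  finally show "\<bar>(\<integral>y. f y * k (y + (0 + e)) \<partial>lborel) - (\<integral>y. f y * k (y + 0) \<partial>lborel) - (\<integral>y. f y *\<^sub>R g y \<partial>lborel) \<bullet> e\<bar>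
      \<le> (\<integral>y. \<bar>f y\<bar> * m y \<partial>lborel) * (norm e)\<^sup>2"
    by simp
qed simp

text \<open>The standard normal density, written as a product so that its total mass reduces to the
  one-dimensional case.\<close>

definition gauss :: "real ^ 'n \<Rightarrow> real" where
  "gauss y = (\<Prod>b\<in>Basis. std_normal_density (y \<bullet> b))"

lemma prod_exp_sq:
  fixes y :: "'a::euclidean_space"
  shows "(\<Prod>b\<in>Basis. exp (- (c * (y \<bullet> b)\<^sup>2))) = exp (- (c * (norm y)\<^sup>2))"
proof -
  have "(norm y)\<^sup>2 = (\<Sum>b\<in>Basis. (y \<bullet> b)\<^sup>2)"
    unfolding power2_norm_eq_inner by (subst euclidean_inner) (simp add: power2_eq_square)
  then show ?thesis by (simp add: sum_negf[symmetric] sum_distrib_left exp_sum)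
qed

lemma gauss_eq: "gauss y = (1 / sqrt (2 * pi)) ^ DIM(real ^ 'n) * exp (- (norm y)\<^sup>2 / 2)" for y :: "real ^ 'n"
  using prod_exp_sq[of "1/2" y] by (simp add: gauss_def std_normal_density_def prod_dividef prod_constant power_divide)

lemma gauss_pos: "0 < gauss y"
  unfolding gauss_eq by (intro mult_pos_pos zero_less_power) auto

lemma borel_measurable_gauss [measurable]: "gauss \<in> borel_measurable borel"
  unfolding gauss_def[abs_def] by measurable

lemma integral_gauss: "(\<integral>y. gauss (y::real^'n) \<partial>lborel) = 1"
  and integrable_gauss: "integrable lborel (gauss :: real^'n \<Rightarrow> real)"
proof -
  have "(\<integral>\<^sup>+x. std_normal_density x \<partial>lborel) = 1"
    by (subst nn_integral_eq_integral) auto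
  moreover have "(\<integral>\<^sup>+y. ennreal (gauss (y::real^'n)) \<partial>lborel) = (\<integral>\<^sup>+y. (\<Prod>b\<in>Basis. ennreal (std_normal_density ((y::real^'n) \<bullet> b))) \<partial>lborel)"
    by (simp add: gauss_def prod_ennreal)
  ultimately have nn: "(\<integral>\<^sup>+y. ennreal (gauss (y::real^'n)) \<partial>lborel) = 1"
    using nn_integral_lborel_prod[where f = "\<lambda>_ x. ennreal (std_normal_density x)" and 'a = "real^'n"] by simp
  show "integrable lborel (gauss :: real^'n \<Rightarrow> real)"
    by (rule integrableI_nonneg) (use nn gauss_pos in \<open>auto intro: less_imp_le\<close>)
  show "(\<integral>y. gauss (y::real^'n) \<partial>lborel) = 1"
    by (rule integral_eq_nn_integral[THEN trans]) (use nn gauss_pos in \<open>auto intro: less_imp_le\<close>)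
qed

lemma integrable_exp_quarter: "integrable lborel (\<lambda>y::real^'n. exp (- ((norm y)\<^sup>2 / 4)))"
proof -
  have "(\<integral>\<^sup>+x. exp (- (x\<^sup>2 / 4)) \<partial>lborel) < \<infinity>"
  proof -
    \<comment> \<open>Variance 2 gives the exponent \<open>- (x\<^sup>2 / 4)\<close>, with
      normalising factor \<open>1 / sqrt (4 * pi)\<close>.\<close>
    have "integrable lborel (\<lambda>x. sqrt (4 * pi) * normal_density 0 (sqrt 2) x)" by simp
    also have "(\<lambda>x. sqrt (4 * pi) * normal_density 0 (sqrt 2) x) = (\<lambda>x. exp (- (x\<^sup>2 / 4)))"
      by (simp add: normal_density_def fun_eq_iff)
    finally show ?thesis by (simp add: integrable_iff_bounded)
  qed
  moreover have "(\<integral>\<^sup>+y. ennreal (exp (- ((norm (y::real^'n))\<^sup>2 / 4))) \<partial>lborel)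
      = (\<integral>\<^sup>+y. (\<Prod>b\<in>Basis. ennreal (exp (- (((y::real^'n) \<bullet> b)\<^sup>2 / 4)))) \<partial>lborel)"
    using prod_exp_sq[where c = "1/4" and 'a = "real^'n"] by (simp add: prod_ennreal)
  ultimately have nn: "(\<integral>\<^sup>+y. ennreal (exp (- ((norm (y::real^'n))\<^sup>2 / 4))) \<partial>lborel) < \<infinity>"
    using nn_integral_lborel_prod[where f = "\<lambda>_ x. ennreal (exp (- (x\<^sup>2 / 4)))" and 'a = "real^'n"]
    by (simp add: power_less_top_ennreal)
  show ?thesis by (rule integrableI_nonneg) (use nn in auto)
qed

text \<open>Exponential growth is paid for with half of the Gaussian exponent. The rate 4 has room
  for \<open>exp (3 * norm y)\<close> from \<open>gauss_kernel_bound\<close> times a further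
  \<open>exp (norm y)\<close>, and for \<open>norm y ^ 4\<close>.\<close>

lemma gauss_integrable:
  fixes f :: "real ^ 'n \<Rightarrow> 'b::{banach, second_countable_topology}"
  assumes [measurable]: "f \<in> borel_measurable borel" and b: "\<And>y. norm (f y) \<le> C * exp (4 * norm y)"
  shows "integrable lborel (\<lambda>y. gauss y *\<^sub>R f y)"
proof (rule Bochner_Integration.integrable_bound)
  define c where "c = (1 / sqrt (2 * pi)) ^ DIM(real ^ 'n)"
  have c: "0 < c" by (simp add: c_def)
  show "integrable lborel (\<lambda>y::real^'n. (c * C * exp 16) * exp (- ((norm y)\<^sup>2 / 4)))"
    by (intro integrable_mult_right integrable_exp_quarter)
  have "norm (gauss y *\<^sub>R f y) \<le> norm ((c * C * exp 16) * exp (- ((norm y)\<^sup>2 / 4)))" for y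
  proof -
    have C: "0 \<le> C" using order_trans[OF norm_ge_zero b[of 0]] by simp
    \<comment> \<open>Expanding this square gives
      \<open>4 * norm y \<le> (norm y)\<^sup>2 / 4 + 16\<close>, whence the factor
      \<open>exp 16\<close>.\<close>
    have "0 \<le> (norm y / 2 - 4)\<^sup>2" by simp
    then have "4 * norm y - (norm y)\<^sup>2 / 2 \<le> 16 - (norm y)\<^sup>2 / 4"
      by (simp add: power2_eq_square field_simps)
    then have e: "exp (4 * norm y) * exp (- (norm y)\<^sup>2 / 2) \<le> exp 16 * exp (- ((norm y)\<^sup>2 / 4))"
      unfolding exp_add[symmetric] by simp
    have "norm (gauss y *\<^sub>R f y) \<le> (c * exp (- (norm y)\<^sup>2 / 2)) * (C * exp (4 * norm y))"
      using c b[of y] unfolding gauss_eq c_def[symmetric] by (simp add: mult_left_mono)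
    also have "\<dots> = c * C * (exp (4 * norm y) * exp (- (norm y)\<^sup>2 / 2))" by (simp add: mult_ac)
    also have "\<dots> \<le> c * C * (exp 16 * exp (- ((norm y)\<^sup>2 / 4)))" using c C by (intro mult_left_mono e) auto
    finally show ?thesis using c C by (simp add: mult_ac)
  qed
  then show "AE y in lborel. norm (gauss y *\<^sub>R f y) \<le> norm ((c * C * exp 16) * exp (- ((norm y)\<^sup>2 / 4)))"
    by simp
qed measurable

lemma exp_minus_linear_le: "\<bar>exp a - 1 - a\<bar> \<le> a\<^sup>2 * exp \<bar>a\<bar>" for a :: real
proof -
  have 1: "1 + a \<le> exp a" by simp
  have "1 - a \<le> exp (- a)" using exp_ge_add_one_self[of "- a"] by simp
  then have "(1 - a) * exp a \<le> exp (- a) * exp a" by (intro mult_right_mono) auto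
  then have 2: "exp a - 1 \<le> a * exp a" by (simp add: algebra_simps flip: exp_add)
  then have "exp a - 1 - a \<le> a * (exp a - 1)" by (simp add: algebra_simps)
  also have "\<dots> \<le> a * (a * exp \<bar>a\<bar>)"
  proof (cases "0 \<le> a")
    case True then show ?thesis using 2 by (intro mult_left_mono) auto
  next
    case False
    then have "a * exp \<bar>a\<bar> \<le> a * 1" by (intro mult_left_mono_neg) auto
    then have "a * exp \<bar>a\<bar> \<le> exp a - 1" using 1 by linarith
    then show ?thesis using False by (intro mult_left_mono_neg) auto
  qed
  finally have "exp a - 1 - a \<le> a\<^sup>2 * exp \<bar>a\<bar>" by (simp add: power2_eq_square mult.assoc)
  then show ?thesis using 1 by linarith
qed

lemma one_plus_le_exp: "1 + norm y \<le> exp (norm y)"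
  by simp

lemma gauss_shift: "gauss (y + e) = gauss y * exp (- (y \<bullet> e) - (norm e)\<^sup>2 / 2)"
  unfolding gauss_eq norm_add_sq mult.assoc exp_add[symmetric] by (simp add: field_simps)

text \<open>By \<open>gauss_shift\<close> the increment is \<open>gauss y\<close> times
  \<open>exp a - 1\<close> with \<open>\<bar>a\<bar> \<le> norm e * (1 + norm y)\<close>, so the
  remainder is quadratic relative to \<open>gauss y\<close> itself. The rate 3 collects two factors
  \<open>1 + norm y\<close> and one \<open>exp \<bar>a\<bar>\<close>.\<close>

lemma gauss_kernel_bound:
  fixes e y :: "real ^ 'n"
  assumes e: "norm e \<le> 1"
  shows "\<bar>gauss (y + e) - gauss y - (- gauss y *\<^sub>R y) \<bullet> e\<bar> \<le> (norm e)\<^sup>2 * (gauss y * (2 * exp 1 * exp (3 * norm y)))"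
    and "gauss (y + e) \<le> gauss y * exp (norm y)"
proof -
  define a where "a = - (y \<bullet> e) - (norm e)\<^sup>2 / 2"
  define r where "r = norm y"
  have r: "0 \<le> r" by (simp add: r_def)
  have ye: "\<bar>y \<bullet> e\<bar> \<le> r * norm e" using Cauchy_Schwarz_ineq2[of y e] by (simp add: r_def)
  have "(norm e)\<^sup>2 \<le> norm e" using e by (simp add: power2_eq_square mult_left_le)
  moreover have "\<bar>a\<bar> \<le> \<bar>y \<bullet> e\<bar> + (norm e)\<^sup>2"
    unfolding a_def using zero_le_power2[of "norm e"] by linarith
  ultimately have a1: "\<bar>a\<bar> \<le> norm e * (1 + r)" using ye by (simp add: algebra_simps)
  also have "\<dots> \<le> 1 * (1 + r)" using e r by (intro mult_right_mono) auto
  finally have a2: "\<bar>a\<bar> \<le> 1 + r" by simp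
  have "\<bar>exp a - 1 + y \<bullet> e\<bar> \<le> \<bar>exp a - 1 - a\<bar> + (norm e)\<^sup>2 / 2" 
    using zero_le_power2[of "norm e"] by (simp only: a_def)
  also have "\<bar>exp a - 1 - a\<bar> \<le> a\<^sup>2 * exp \<bar>a\<bar>" by (rule exp_minus_linear_le)
  also have "\<dots> \<le> (norm e * (1 + r))\<^sup>2 * exp (1 + r)"
    using a1 a2 r by (intro mult_mono) (auto simp: abs_le_square_iff[symmetric])
  also have "\<dots> \<le> (norm e * exp r)\<^sup>2 * exp (1 + r)"
    using r by (intro mult_right_mono power_mono mult_left_mono) auto
  also have "\<dots> = (norm e)\<^sup>2 * (exp 1 * exp (3 * r))"
    by (simp add: power_mult_distrib power2_eq_square flip: exp_add)
  also have "\<dots> + (norm e)\<^sup>2 / 2 \<le> (norm e)\<^sup>2 * (2 * exp 1 * exp (3 * r))"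
  proof -
    have "1 / 2 \<le> exp (1::real) * exp (3 * r)" using r unfolding exp_add[symmetric]
      by (intro order_trans[OF _ exp_ge_add_one_self]) simp
    from mult_left_mono[OF this, of "(norm e)\<^sup>2"] show ?thesis by (simp add: algebra_simps)
  qed
  finally have "\<bar>exp a - 1 + y \<bullet> e\<bar> \<le> (norm e)\<^sup>2 * (2 * exp 1 * exp (3 * r))" by simp
  from mult_left_mono[OF this less_imp_le[OF gauss_pos[of y]]]
  show "\<bar>gauss (y + e) - gauss y - (- gauss y *\<^sub>R y) \<bullet> e\<bar> \<le> (norm e)\<^sup>2 * (gauss y * (2 * exp 1 * exp (3 * norm y)))"
    using gauss_pos[of y] unfolding gauss_shift a_def[symmetric] r_def
    by (simp add: abs_mult_pos' algebra_simps abs_mult[of "gauss y", symmetric, simplified])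
  have "a \<le> r" using ye e r mult_left_mono[OF e r] unfolding a_def using zero_le_power2[of "norm e"] by linarith
  then show "gauss (y + e) \<le> gauss y * exp (norm y)"
    using gauss_pos[of y] unfolding gauss_shift a_def[symmetric] r_def by simp
qed

lemma gauss_shift_has_derivative:
  fixes f :: "real ^ 'n \<Rightarrow> real"
  assumes [measurable]: "f \<in> borel_measurable borel" and b: "\<And>y. \<bar>f y\<bar> \<le> C * exp (norm y)"
  shows "((\<lambda>e. \<integral>y. f y * gauss (y + e) \<partial>lborel) has_derivative
     (\<lambda>e. (\<integral>y. gauss y *\<^sub>R (f y *\<^sub>R - y) \<partial>lborel) \<bullet> e)) (at 0)"
proof -
  have C: "0 \<le> C" using b[of 0] by simp
  have b4: "\<bar>f y\<bar> * exp (3 * norm y) \<le> C * exp (4 * norm y)" for y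
    using mult_right_mono[OF b[of y], of "exp (3 * norm y)"] by (simp add: mult.assoc flip: exp_add)
  have e13: "exp (norm y) \<le> exp (3 * norm y)" for y :: "real ^ 'n" by simp
  have "((\<lambda>e. \<integral>y. f y * gauss (y + e) \<partial>lborel) has_derivative
     (\<lambda>e. (\<integral>y. f y *\<^sub>R (- gauss y *\<^sub>R y) \<partial>lborel) \<bullet> e)) (at 0)"
  proof (rule kernel_has_derivative[OF gauss_kernel_bound(1)])
    fix e :: "real ^ 'n" assume e: "norm e \<le> 1"
    show "integrable lborel (\<lambda>y. f y * gauss (y + e))"
    proof (rule Bochner_Integration.integrable_bound)
      show "integrable lborel (\<lambda>y::real^'n. gauss y *\<^sub>R (C * exp (4 * norm y)))"
        by (rule gauss_integrable[of _ C]) (use C in auto)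
      have "norm (f y * gauss (y + e)) \<le> norm (gauss y *\<^sub>R (C * exp (4 * norm y)))" for y
      proof -
        have "\<bar>f y\<bar> * gauss (y + e) \<le> \<bar>f y\<bar> * (gauss y * exp (3 * norm y))"
          using gauss_kernel_bound(2)[OF e, of y] gauss_pos[of y] e13[of y]
          by (intro mult_left_mono) (auto intro: order_trans mult_left_mono)
        also have "\<dots> \<le> gauss y * (C * exp (4 * norm y))"
          using mult_left_mono[OF b4[of y] less_imp_le[OF gauss_pos[of y]]] by (simp add: mult_ac)
        finally show ?thesis using gauss_pos[of y] gauss_pos[of "y + e"] C by (simp add: abs_mult)
      qed
      then show "AE y in lborel. norm (f y * gauss (y + e)) \<le> norm (gauss y *\<^sub>R (C * exp (4 * norm y)))" by simp
    qed measurable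
  next
    have "integrable lborel (\<lambda>y. gauss y *\<^sub>R (f y *\<^sub>R - y))"
    proof (rule gauss_integrable[of _ C])
      fix y :: "real ^ 'n"
      have "norm y \<le> exp (3 * norm y)" using e13[of y] one_plus_le_exp[of y] by linarith
      then have "\<bar>f y\<bar> * norm y \<le> \<bar>f y\<bar> * exp (3 * norm y)" by (intro mult_left_mono) auto
      then show "norm (f y *\<^sub>R - y) \<le> C * exp (4 * norm y)" using b4[of y] by simp
    qed measurable
    then show "integrable lborel (\<lambda>y. f y *\<^sub>R (- gauss y *\<^sub>R y))" by (simp add: mult.commute)
    have "integrable lborel (\<lambda>y. gauss y *\<^sub>R (2 * exp 1 * (\<bar>f y\<bar> * exp (3 * norm y))))"
      by (rule gauss_integrable[of _ "2 * exp 1 * C"]) (use b4 in \<open>auto simp: abs_mult mult.assoc\<close>)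
    then show "integrable lborel (\<lambda>y. \<bar>f y\<bar> * (gauss y * (2 * exp 1 * exp (3 * norm y))))"
      by (simp add: mult_ac)
  qed
  then show ?thesis by (simp add: mult.commute)
qed

section \<open>Heat flow of a function with Lipschitz gradient\<close>

text \<open>Taylor's formula when the gradient is differentiable at the single point
  \<open>x\<close>. The function minus the paraboloid is nonincreasing along short rays, because the
  term with \<open>\<kappa>\<close> contributes twice the error allowed for the gradient.\<close>

lemma second_order_upper:
  fixes F :: "real ^ 'n \<Rightarrow> real"
  assumes F: "\<And>z. (F has_derivative (\<lambda>e. G z \<bullet> e)) (at z)"
    and G: "(G has_derivative (\<lambda>e. H *v e)) (at x)" and \<kappa>: "0 < \<kappa>"
  shows "\<exists>\<rho>>0. \<forall>k. norm k \<le> \<rho> \<longrightarrow> F (x + k) \<le> F x + G x \<bullet> k + 1 / 2 * (k \<bullet> (H *v k)) + \<kappa> * (norm k)\<^sup>2"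
proof -
  obtain \<rho> where \<rho>: "0 < \<rho>" "\<And>y. norm (y - x) < \<rho> \<Longrightarrow> norm (G y - G x - H *v (y - x)) \<le> \<kappa> * norm (y - x)"
    using G \<kappa> unfolding has_derivative_at_alt by meson
  show ?thesis
  proof (intro exI[of _ "\<rho> / 2"] conjI allI impI)
    fix k :: "real ^ 'n" assume k: "norm k \<le> \<rho> / 2"
    define \<phi> where "\<phi> s = F (x + s *\<^sub>R k) - s * (G x \<bullet> k) - s\<^sup>2 / 2 * (k \<bullet> (H *v k)) - s\<^sup>2 * (\<kappa> * (norm k)\<^sup>2)" for s
    have "\<phi> 1 \<le> \<phi> 0"
    proof (rule DERIV_nonpos_imp_nonincreasing[of 0 1 \<phi>])
      fix s :: real assume s: "0 \<le> s" "s \<le> 1"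
      have "((\<lambda>s. F (x + s *\<^sub>R k)) has_derivative (\<lambda>h. G (x + s *\<^sub>R k) \<bullet> (h *\<^sub>R k))) (at s)"
        by (rule has_derivative_compose[OF _ F]) (auto intro!: derivative_eq_intros)
      then have dF: "((\<lambda>s. F (x + s *\<^sub>R k)) has_real_derivative G (x + s *\<^sub>R k) \<bullet> k) (at s)"
        by (simp add: has_field_derivative_def mult_commute_abs)
      have d: "(\<phi> has_real_derivative G (x + s *\<^sub>R k) \<bullet> k - G x \<bullet> k - s * (k \<bullet> (H *v k)) - 2 * s * (\<kappa> * (norm k)\<^sup>2)) (at s)"
        unfolding \<phi>_def by (rule dF derivative_eq_intros refl | simp)+
      have "norm (s *\<^sub>R k) < \<rho>"
        using k s \<rho>(1) mult_left_le_one_le[of "norm k" s] by simp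
      then have "norm (G (x + s *\<^sub>R k) - G x - H *v (s *\<^sub>R k)) \<le> \<kappa> * (s * norm k)"
        using \<rho>(2)[of "x + s *\<^sub>R k"] s by simp
      from order_trans[OF norm_cauchy_schwarz mult_right_mono[OF this norm_ge_zero]]
      have "(G (x + s *\<^sub>R k) - G x - H *v (s *\<^sub>R k)) \<bullet> k \<le> \<kappa> * (s * norm k) * norm k" .
      then have "G (x + s *\<^sub>R k) \<bullet> k - G x \<bullet> k - s * (k \<bullet> (H *v k)) \<le> s * (\<kappa> * (norm k)\<^sup>2)"
        by (simp add: inner_diff_left matrix_vector_mult_scaleR inner_commute[of k] power2_eq_square mult_ac)
      moreover have "0 \<le> s * (\<kappa> * (norm k)\<^sup>2)" using s \<kappa> by simp
      ultimately have "G (x + s *\<^sub>R k) \<bullet> k - G x \<bullet> k - s * (k \<bullet> (H *v k)) - 2 * s * (\<kappa> * (norm k)\<^sup>2) \<le> 0" by linarith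
      then show "\<exists>y. (\<phi> has_real_derivative y) (at s) \<and> y \<le> 0" using d by blast
    qed simp
    then show "F (x + k) \<le> F x + G x \<bullet> k + 1 / 2 * (k \<bullet> (H *v k)) + \<kappa> * (norm k)\<^sup>2"
      by (simp add: \<phi>_def)
  qed (use \<rho> in simp)
qed

section \<open>Gaussian means and moments\<close>

definition gauss_mean :: "(real ^ 'n \<Rightarrow> 'b::{banach, second_countable_topology}) \<Rightarrow> 'b" where
  "gauss_mean f = (\<integral>y. gauss y *\<^sub>R f y \<partial>lborel)"

abbreviation gauss_integrable_fun :: "(real ^ 'n \<Rightarrow> 'b::{banach, second_countable_topology}) \<Rightarrow> bool" where
  "gauss_integrable_fun f \<equiv> integrable lborel (\<lambda>y. gauss y *\<^sub>R f y)"

lemma gauss_mean_add: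
  "gauss_integrable_fun f \<Longrightarrow> gauss_integrable_fun g \<Longrightarrow> gauss_mean (\<lambda>y. f y + g y) = gauss_mean f + gauss_mean g"
  by (simp add: gauss_mean_def scaleR_add_right)

lemma gauss_mean_diff:
  "gauss_integrable_fun f \<Longrightarrow> gauss_integrable_fun g \<Longrightarrow> gauss_mean (\<lambda>y. f y - g y) = gauss_mean f - gauss_mean g"
  by (simp add: gauss_mean_def scaleR_diff_right)

lemma gauss_integrable_const: "gauss_integrable_fun (\<lambda>_. c)"
  by (rule integrable_scaleR_left) (rule integrable_gauss)

lemma gauss_mean_const: "gauss_mean (\<lambda>_ :: real ^ 'n. c) = c"
  unfolding gauss_mean_def by (subst integral_scaleR_left) (simp_all add: integrable_gauss integral_gauss)

lemma gauss_mean_cmult: "gauss_mean (\<lambda>y. c * f y) = c * gauss_mean f" for c :: real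
  by (simp add: gauss_mean_def mult.left_commute)

lemma gauss_mean_inner_right:
  fixes f :: "real ^ 'n \<Rightarrow> 'b::euclidean_space"
  shows "gauss_integrable_fun f \<Longrightarrow> gauss_mean (\<lambda>y. f y \<bullet> d) = gauss_mean f \<bullet> d"
  unfolding gauss_mean_def by (subst integral_inner_left[symmetric]) auto

lemma gauss_integrable_inner:
  fixes f :: "real ^ 'n \<Rightarrow> 'b::euclidean_space"
  shows "gauss_integrable_fun f \<Longrightarrow> gauss_integrable_fun (\<lambda>y. f y \<bullet> d)"
  using integrable_inner_left[of d lborel "\<lambda>y. gauss y *\<^sub>R f y"] by simp

lemma gauss_mean_mono:
  fixes f g :: "real ^ 'n \<Rightarrow> real"
  assumes "gauss_integrable_fun f" "gauss_integrable_fun g" "\<And>y. f y \<le> g y"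
  shows "gauss_mean f \<le> gauss_mean g"
  unfolding gauss_mean_def
  by (rule integral_mono) (use assms in \<open>simp_all add: mult_left_mono less_imp_le[OF gauss_pos]\<close>)

lemma gauss_mean_abs_le:
  fixes f g :: "real ^ 'n \<Rightarrow> real"
  assumes "gauss_integrable_fun f" "gauss_integrable_fun g" "\<And>y. \<bar>f y\<bar> \<le> g y"
  shows "\<bar>gauss_mean f\<bar> \<le> gauss_mean g"
proof -
  have "gauss_mean f \<le> gauss_mean g"
    by (rule gauss_mean_mono) (use assms in \<open>auto intro: order_trans[OF abs_ge_self]\<close>)
  moreover have "gauss_mean (\<lambda>y. - 1 * f y) \<le> gauss_mean g"
    by (rule gauss_mean_mono) (use assms in \<open>auto intro: order_trans[OF abs_ge_minus_self]\<close>)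
  ultimately show ?thesis unfolding gauss_mean_cmult by simp
qed

lemma norm_le_exp: "norm y \<le> exp (norm y)"
  using one_plus_le_exp[of y] by linarith

lemma norm_sq_le_exp: "(norm y)\<^sup>2 \<le> exp (4 * norm y)"
proof -
  have "(norm y)\<^sup>2 \<le> (exp (norm y))\<^sup>2" by (intro power_mono norm_le_exp) auto
  also have "\<dots> \<le> exp (4 * norm y)" by (simp add: power2_eq_square flip: exp_add)
  finally show ?thesis .
qed

lemma exp_le_exp4: "exp (norm y) \<le> exp (4 * norm y)"
  by simp

lemma gauss_integrable_id: "gauss_integrable_fun (\<lambda>y::real^'n. y)"
  by (rule gauss_integrable[of _ 1]) (auto intro: order_trans[OF norm_le_exp])

lemma gauss_integrable_norm_sq: "gauss_integrable_fun (\<lambda>y::real^'n. (norm y)\<^sup>2)"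
  by (rule gauss_integrable[of _ 1]) (auto intro: norm_sq_le_exp)

lemma gauss_integrable_outer: "gauss_integrable_fun (\<lambda>y::real^'n. (a \<bullet> y) *\<^sub>R y)"
proof (rule gauss_integrable[of _ "norm a"])
  fix y :: "real ^ 'n"
  have "norm ((a \<bullet> y) *\<^sub>R y) \<le> (norm a * norm y) * norm y"
    using Cauchy_Schwarz_ineq2[of a y] by (simp add: mult_right_mono)
  also have "\<dots> \<le> norm a * exp (4 * norm y)"
    using norm_sq_le_exp[of y] by (simp add: power2_eq_square mult.assoc mult_left_mono)
  finally show "norm ((a \<bullet> y) *\<^sub>R y) \<le> norm a * exp (4 * norm y)" .
qed simp

text \<open>The mass of a translated Gaussian is constant, and its derivative in the translation is
  minus the first moment.\<close>

lemma gauss_mean_id: "gauss_mean (\<lambda>y::real^'n. y) = 0"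
proof -
  have d: "((\<lambda>e. \<integral>y. 1 * gauss (y + e) \<partial>lborel) has_derivative
     (\<lambda>e. (\<integral>y. gauss y *\<^sub>R (1 *\<^sub>R - y) \<partial>lborel) \<bullet> e)) (at (0::real^'n))"
    by (rule gauss_shift_has_derivative[of _ 1]) auto
  have "(\<lambda>e::real^'n. \<integral>y. 1 * gauss (y + e) \<partial>lborel) = (\<lambda>e. 1)"
    using lborel_translate(2)[of "gauss :: real ^ 'n \<Rightarrow> real"] integral_gauss by (simp add: add.commute fun_eq_iff)
  then have "((\<lambda>e::real^'n. \<integral>y. 1 * gauss (y + e) \<partial>lborel) has_derivative (\<lambda>e. 0 \<bullet> e)) (at 0)"
    by (simp only: has_derivative_const inner_zero_left)
  from has_derivative_unique[OF d this]
  have eq: "(\<integral>y. gauss y *\<^sub>R (1 *\<^sub>R - y) \<partial>lborel) \<bullet> e = 0 \<bullet> e" for e :: "real ^ 'n"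
    by (rule fun_cong)
  have "(\<integral>y. gauss y *\<^sub>R (1 *\<^sub>R - y) \<partial>lborel) = (0::real^'n)"
    by (rule iffD1[OF vector_eq_rdot], rule allI, rule eq)
  then show ?thesis by (simp add: gauss_mean_def)
qed

text \<open>The covariance is the identity. As for the first moment, an integral against the
  translated density is differentiated, now with the weight \<open>a \<bullet> y\<close>; its value
  is \<open>- a \<bullet> e\<close>.\<close>

lemma gauss_mean_outer: "gauss_mean (\<lambda>y::real^'n. (a \<bullet> y) *\<^sub>R y) = a"
proof -
  have b: "\<bar>a \<bullet> y\<bar> \<le> norm a * exp (norm y)" for y
    using order_trans[OF Cauchy_Schwarz_ineq2[of a y] mult_left_mono[OF norm_le_exp[of y]]] by simp
  have d: "((\<lambda>e. \<integral>y. (a \<bullet> y) * gauss (y + e) \<partial>lborel) has_derivative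
     (\<lambda>e. (\<integral>y. gauss y *\<^sub>R ((a \<bullet> y) *\<^sub>R - y) \<partial>lborel) \<bullet> e)) (at (0::real^'n))"
    by (rule gauss_shift_has_derivative[of _ "norm a"]) (use b in auto)
  have "(\<integral>y. (a \<bullet> y) * gauss (y + e) \<partial>lborel) = - a \<bullet> e" for e
  proof -
    have "(\<integral>y. (a \<bullet> y) * gauss (y + e) \<partial>lborel) = (\<integral>y. (a \<bullet> (y - e)) * gauss y \<partial>lborel)"
      using lborel_translate(2)[of "\<lambda>y. (a \<bullet> (y - e)) * gauss y" e] by (simp add: add.commute)
    also have "\<dots> = gauss_mean (\<lambda>y. y \<bullet> a - a \<bullet> e)"
      by (simp add: gauss_mean_def inner_diff_right inner_commute mult.commute)
    also have "\<dots> = gauss_mean (\<lambda>y. y \<bullet> a) - a \<bullet> e"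
      by (subst gauss_mean_diff[OF gauss_integrable_inner[OF gauss_integrable_id] gauss_integrable_const])
         (simp add: gauss_mean_const)
    also have "\<dots> = - a \<bullet> e"
      by (simp add: gauss_mean_inner_right[OF gauss_integrable_id] gauss_mean_id)
    finally show ?thesis .
  qed
  then have "(\<lambda>e. \<integral>y. (a \<bullet> y) * gauss (y + e) \<partial>lborel) = (\<lambda>e. - a \<bullet> e)" by auto
  then have "((\<lambda>e. \<integral>y. (a \<bullet> y) * gauss (y + e) \<partial>lborel) has_derivative (\<lambda>e. - a \<bullet> e)) (at 0)"
    by (simp only:) (rule bounded_linear_imp_has_derivative[OF bounded_linear_inner_right])
  from has_derivative_unique[OF d this]
  have eq: "(\<integral>y. gauss y *\<^sub>R ((a \<bullet> y) *\<^sub>R - y) \<partial>lborel) \<bullet> e = - a \<bullet> e" for e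
    by (rule fun_cong)
  have "(\<integral>y. gauss y *\<^sub>R ((a \<bullet> y) *\<^sub>R - y) \<partial>lborel) = - a"
    by (rule iffD1[OF vector_eq_rdot], rule allI, rule eq)
  then show ?thesis by (simp add: gauss_mean_def)
qed

lemma gauss_mean_norm_sq: "gauss_mean (\<lambda>y::real^'n. (norm y)\<^sup>2) = CARD('n)"
proof -
  have "gauss_mean (\<lambda>y::real^'n. (norm y)\<^sup>2) = gauss_mean (\<lambda>y::real^'n. \<Sum>b\<in>Basis. ((b \<bullet> y) *\<^sub>R y) \<bullet> b)"
    unfolding power2_norm_eq_inner by (subst euclidean_inner) (simp add: inner_commute)
  also have "\<dots> = (\<Sum>b\<in>Basis. gauss_mean (\<lambda>y::real^'n. ((b \<bullet> y) *\<^sub>R y) \<bullet> b))"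
    unfolding gauss_mean_def scaleR_sum_right
    by (rule Bochner_Integration.integral_sum) (rule gauss_integrable_inner[OF gauss_integrable_outer])
  also have "\<dots> = (\<Sum>b\<in>(Basis::(real^'n) set). b \<bullet> b)"
    by (simp only: gauss_mean_inner_right[OF gauss_integrable_outer] gauss_mean_outer)
  finally show ?thesis by simp
qed

text \<open>The class C^{1,1} without second derivatives: \<open>q\<close> is then the gradient of
  \<open>W\<close> and Lipschitz with constant \<open>6 * C\<close>.\<close>

definition quadratic_remainder :: "real \<Rightarrow> ('a::real_inner \<Rightarrow> real) \<Rightarrow> ('a \<Rightarrow> 'a) \<Rightarrow> bool" where
  "quadratic_remainder C W q \<longleftrightarrow> 0 \<le> C \<and> (\<forall>x h. \<bar>W (x + h) - W x - q x \<bullet> h\<bar> \<le> C * (norm h)\<^sup>2)"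

lemma quadratic_remainder_has_derivative:
  "quadratic_remainder C W q \<Longrightarrow> (W has_derivative (\<lambda>e. q x \<bullet> e)) (at x)" for W :: "'a::euclidean_space \<Rightarrow> real"
  by (rule has_derivative_quadratic_bound[of 1 _ _ _ C]) (auto simp: quadratic_remainder_def)

text \<open>The value \<open>W (x' + e)\<close> is expanded from \<open>x'\<close> and from
  \<open>x\<close>, with \<open>e\<close> along \<open>q x' - q x\<close> and as long as
  \<open>x' - x\<close>. The three remainders contribute 1, 4 and 1 times
  \<open>C * (norm d)\<^sup>2\<close>.\<close>

lemma quadratic_remainder_Lipschitz:
  assumes "quadratic_remainder C W q"
  shows "norm (q x' - q x) \<le> 6 * C * norm (x' - x)"
proof (cases "q x' = q x \<or> x' = x")
  case True
  then show ?thesis using assms by (auto simp: quadratic_remainder_def)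
next
  case False
  have A: "\<bar>W (x + h) - W x - q x \<bullet> h\<bar> \<le> C * (norm h)\<^sup>2" for x h
    using assms by (simp add: quadratic_remainder_def)
  have C: "0 \<le> C" using assms by (simp add: quadratic_remainder_def)
  define d where "d = x' - x"
  define e where "e = (norm d / norm (q x' - q x)) *\<^sub>R (q x' - q x)"
  have ne: "norm e = norm d" using False by (simp add: e_def)
  have "(norm (d + e))\<^sup>2 \<le> (norm d + norm e)\<^sup>2" by (intro power_mono norm_triangle_ineq) auto
  then have de: "(norm (d + e))\<^sup>2 \<le> 4 * (norm d)\<^sup>2" by (simp add: ne power2_eq_square)
  have x': "x + d = x'" "x + (d + e) = x' + e" by (simp_all add: d_def)
  have "(q x' - q x) \<bullet> e \<le> C * (norm e)\<^sup>2 + C * (norm (d + e))\<^sup>2 + C * (norm d)\<^sup>2"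
    using A[of x' e] A[of x "d + e"] A[of x d] unfolding x' inner_diff_left inner_add_right by linarith
  also have "\<dots> \<le> 6 * C * (norm d)\<^sup>2"
    using mult_left_mono[OF de C] by (simp add: ne)
  finally have "norm d * norm (q x' - q x) \<le> norm d * (6 * C * norm d)"
    using False by (simp add: e_def dot_square_norm power2_eq_square mult_ac)
  then show ?thesis using False by (simp add: d_def)
qed

lemma quadratic_remainder_continuous:
  fixes W :: "'a::euclidean_space \<Rightarrow> real"
  assumes "quadratic_remainder C W q"
  shows "continuous_on S W" and "continuous_on S q"
proof -
  show "continuous_on S W"
    using quadratic_remainder_has_derivative[OF assms]
    by (meson continuous_at_imp_continuous_on has_derivative_continuous)
  have "(6 * C)-lipschitz_on S q"
    using quadratic_remainder_Lipschitz[OF assms] assms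
    by (intro lipschitz_onI) (auto simp: dist_norm quadratic_remainder_def)
  then show "continuous_on S q" by (rule lipschitz_on_continuous_on)
qed

text \<open>The heat equation holds in the time variable \<open>t\<^sup>2/2\<close>; \<open>q\<close> stands for the gradient of \<open>W\<close>.\<close>

definition heat :: "(real ^ 'n \<Rightarrow> real) \<Rightarrow> real ^ 'n \<Rightarrow> real \<Rightarrow> real" where
  "heat W x t = gauss_mean (\<lambda>y. W (x + t *\<^sub>R y))"

definition heat_grad :: "(real ^ 'n \<Rightarrow> real ^ 'n) \<Rightarrow> real ^ 'n \<Rightarrow> real \<Rightarrow> real ^ 'n" where
  "heat_grad q x t = gauss_mean (\<lambda>y. q (x + t *\<^sub>R y))"

definition heat_time :: "(real ^ 'n \<Rightarrow> real ^ 'n) \<Rightarrow> real ^ 'n \<Rightarrow> real \<Rightarrow> real" where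
  "heat_time q x t = gauss_mean (\<lambda>y. q (x + t *\<^sub>R y) \<bullet> y)"

text \<open>The Hessian of the flow with one derivative moved to the Gaussian: only \<open>q\<close>
  occurs, at the price of the factor \<open>1 / t\<close>.\<close>

definition heat_hess :: "(real ^ 'n \<Rightarrow> real ^ 'n) \<Rightarrow> real ^ 'n \<Rightarrow> real \<Rightarrow> real ^ 'n ^ 'n" where
  "heat_hess q x t = (\<chi> i j. (1 / t) * gauss_mean (\<lambda>y. q (x + t *\<^sub>R y) $ i * y $ j))"

context
  fixes W :: "real ^ 'n \<Rightarrow> real" and q :: "real ^ 'n \<Rightarrow> real ^ 'n" and C :: real
  assumes W: "quadratic_remainder C W q"
begin

lemma quadratic_remainder_bound: "\<bar>W (x + h) - W x - q x \<bullet> h\<bar> \<le> C * (norm h)\<^sup>2"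
  using W by (simp add: quadratic_remainder_def)

lemma quadratic_remainder_nonneg: "0 \<le> C"
  using W by (simp add: quadratic_remainder_def)

lemma quadratic_remainder_measurable [measurable]: "W \<in> borel_measurable borel" and quadratic_remainder_gradient_measurable [measurable]: "q \<in> borel_measurable borel"
  using quadratic_remainder_continuous[OF W] by (auto intro: borel_measurable_continuous_onI)

lemma quadratic_remainder_gradient_growth: "norm (q (x + t *\<^sub>R y)) \<le> (norm (q x) + 6 * C * \<bar>t\<bar>) * exp (norm y)"
proof -
  have "norm (q (x + t *\<^sub>R y)) \<le> norm (q x) + 6 * C * (\<bar>t\<bar> * norm y)"
    using quadratic_remainder_Lipschitz[OF W, of "x + t *\<^sub>R y" x] norm_triangle_ineq2[of "q (x + t *\<^sub>R y)" "q x"] by simp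
  also have "\<dots> \<le> norm (q x) * exp (norm y) + 6 * C * (\<bar>t\<bar> * exp (norm y))"
    using quadratic_remainder_nonneg by (intro add_mono mult_left_mono norm_le_exp mult_left_le[THEN order_trans, OF _ _ order_refl] ) (auto simp: mult_le_cancel_left1)
  finally show ?thesis by (simp add: algebra_simps)
qed

lemma quadratic_remainder_gradient_growth_mult:
  "norm (q (x + t *\<^sub>R y)) * norm y \<le> (norm (q x) + 6 * C * \<bar>t\<bar>) * exp (4 * norm y)"
proof -
  have "norm (q (x + t *\<^sub>R y)) * norm y \<le> ((norm (q x) + 6 * C * \<bar>t\<bar>) * exp (norm y)) * exp (norm y)"
    by (intro mult_mono quadratic_remainder_gradient_growth norm_le_exp) (use quadratic_remainder_nonneg in auto)
  also have "\<dots> = (norm (q x) + 6 * C * \<bar>t\<bar>) * exp (2 * norm y)"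
    by (simp add: mult.assoc flip: exp_add)
  also have "\<dots> \<le> (norm (q x) + 6 * C * \<bar>t\<bar>) * exp (4 * norm y)"
    using quadratic_remainder_nonneg by (intro mult_left_mono) auto
  finally show ?thesis .
qed

lemma gauss_integrable_quadratic_remainder: "gauss_integrable_fun (\<lambda>y. W (x + t *\<^sub>R y))"
proof (rule gauss_integrable[of _ "\<bar>W x\<bar> + norm (q x) * \<bar>t\<bar> + C * t\<^sup>2"])
  fix y :: "real ^ 'n"
  have "\<bar>W (x + t *\<^sub>R y)\<bar> \<le> \<bar>W x\<bar> + \<bar>q x \<bullet> (t *\<^sub>R y)\<bar> + C * (norm (t *\<^sub>R y))\<^sup>2"
    using quadratic_remainder_bound[of x "t *\<^sub>R y"] by linarith
  also have "\<dots> \<le> \<bar>W x\<bar> * exp (4 * norm y) + norm (q x) * \<bar>t\<bar> * exp (4 * norm y) + C * t\<^sup>2 * exp (4 * norm y)"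
  proof (intro add_mono)
    show "\<bar>W x\<bar> \<le> \<bar>W x\<bar> * exp (4 * norm y)" by (simp add: mult_le_cancel_left1)
    have "\<bar>q x \<bullet> (t *\<^sub>R y)\<bar> \<le> norm (q x) * \<bar>t\<bar> * norm y"
      using Cauchy_Schwarz_ineq2[of "q x" "t *\<^sub>R y"] by (simp add: mult.assoc)
    also have "\<dots> \<le> norm (q x) * \<bar>t\<bar> * exp (4 * norm y)"
      by (intro mult_left_mono order_trans[OF norm_le_exp exp_le_exp4]) auto
    finally show "\<bar>q x \<bullet> (t *\<^sub>R y)\<bar> \<le> norm (q x) * \<bar>t\<bar> * exp (4 * norm y)" .
    show "C * (norm (t *\<^sub>R y))\<^sup>2 \<le> C * t\<^sup>2 * exp (4 * norm y)"
      using quadratic_remainder_nonneg norm_sq_le_exp[of y] by (simp add: power_mult_distrib mult.assoc mult_left_mono)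
  qed
  finally show "norm (W (x + t *\<^sub>R y)) \<le> (\<bar>W x\<bar> + norm (q x) * \<bar>t\<bar> + C * t\<^sup>2) * exp (4 * norm y)"
    by (simp add: algebra_simps)
qed measurable

lemma gauss_integrable_gradient: "gauss_integrable_fun (\<lambda>y. q (x + t *\<^sub>R y))"
proof (rule gauss_integrable[of _ "norm (q x) + 6 * C * \<bar>t\<bar>"])
  fix y :: "real ^ 'n"
  show "norm (q (x + t *\<^sub>R y)) \<le> (norm (q x) + 6 * C * \<bar>t\<bar>) * exp (4 * norm y)"
    using quadratic_remainder_nonneg by (intro order_trans[OF quadratic_remainder_gradient_growth] mult_left_mono exp_le_exp4) auto
qed measurable

lemma gauss_integrable_radial_derivative: "gauss_integrable_fun (\<lambda>y. q (x + t *\<^sub>R y) \<bullet> y)"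
proof (rule gauss_integrable[of _ "norm (q x) + 6 * C * \<bar>t\<bar>"])
  fix y :: "real ^ 'n"
  have "norm (q (x + t *\<^sub>R y) \<bullet> y) \<le> norm (q (x + t *\<^sub>R y)) * norm y"
    using Cauchy_Schwarz_ineq2 by simp
  also note quadratic_remainder_gradient_growth_mult
  finally show "norm (q (x + t *\<^sub>R y) \<bullet> y) \<le> (norm (q x) + 6 * C * \<bar>t\<bar>) * exp (4 * norm y)" .
qed measurable

text \<open>The quadratic remainder of \<open>W\<close>, taken at the increment
  \<open>d + s *\<^sub>R y\<close>, is averaged. One expansion thus yields the spatial gradient, the
  derivative in \<open>t\<close> and joint continuity.\<close>

lemma heat_expansion:
  "\<bar>heat W (x + d) (t + s) - heat W x t - heat_grad q x t \<bullet> d - s * heat_time q x t\<bar>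
     \<le> 2 * C * ((norm d)\<^sup>2 + real CARD('n) * s\<^sup>2)"
proof -
  define f where "f y = W (x + d + (t + s) *\<^sub>R y) - W (x + t *\<^sub>R y) - q (x + t *\<^sub>R y) \<bullet> d - s * (q (x + t *\<^sub>R y) \<bullet> y)" for y
  define g where "g y = 2 * C * ((norm d)\<^sup>2 + s\<^sup>2 * (norm y)\<^sup>2)" for y :: "real ^ 'n"
  have s_int: "gauss_integrable_fun (\<lambda>y. s * (q (x + t *\<^sub>R y) \<bullet> y))"
    using integrable_mult_right[OF gauss_integrable_radial_derivative, of s x t] by (simp add: mult.left_commute)
  note ints = gauss_integrable_quadratic_remainder gauss_integrable_radial_derivative gauss_integrable_inner[OF gauss_integrable_gradient] s_int
  have i1: "gauss_integrable_fun (\<lambda>y. W (x + d + (t + s) *\<^sub>R y) - W (x + t *\<^sub>R y))"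
    unfolding scaleR_diff_right by (intro Bochner_Integration.integrable_diff ints)
  have i2: "gauss_integrable_fun (\<lambda>y. W (x + d + (t + s) *\<^sub>R y) - W (x + t *\<^sub>R y) - q (x + t *\<^sub>R y) \<bullet> d)"
    using Bochner_Integration.integrable_diff[OF i1 ints(3)] unfolding scaleR_diff_right .
  have fi: "gauss_integrable_fun f"
    using Bochner_Integration.integrable_diff[OF i2 s_int] unfolding f_def scaleR_diff_right .
  have s2: "gauss_integrable_fun (\<lambda>y::real^'n. s\<^sup>2 * (norm y)\<^sup>2)"
    using integrable_mult_right[OF gauss_integrable_norm_sq, of "s\<^sup>2"] by (simp add: mult.left_commute)
  have g0: "gauss_integrable_fun (\<lambda>y::real^'n. (norm d)\<^sup>2 + s\<^sup>2 * (norm y)\<^sup>2)"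
    using Bochner_Integration.integrable_add[OF gauss_integrable_const s2] unfolding scaleR_add_right .
  then have gi: "gauss_integrable_fun g"
    unfolding g_def using integrable_mult_right[OF g0, of "2 * C"] by (simp add: mult.left_commute)
  have "gauss_mean f = heat W (x + d) (t + s) - heat W x t - heat_grad q x t \<bullet> d - s * heat_time q x t"
    unfolding f_def heat_def heat_grad_def heat_time_def
    by (simp add: gauss_mean_diff[OF i2 s_int] gauss_mean_diff[OF i1 ints(3)] gauss_mean_diff[OF ints(1) ints(1)]
        gauss_mean_cmult gauss_mean_inner_right[OF gauss_integrable_gradient])
  moreover have "gauss_mean g = 2 * C * ((norm d)\<^sup>2 + real CARD('n) * s\<^sup>2)"
    unfolding g_def gauss_mean_cmult
    by (simp add: gauss_mean_add[OF gauss_integrable_const s2] gauss_mean_const gauss_mean_cmult gauss_mean_norm_sq mult.commute)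
  moreover have "\<bar>gauss_mean f\<bar> \<le> gauss_mean g"
  proof (rule gauss_mean_abs_le[OF fi gi])
    fix y :: "real ^ 'n"
    have eq: "f y = W (x + t *\<^sub>R y + (d + s *\<^sub>R y)) - W (x + t *\<^sub>R y) - q (x + t *\<^sub>R y) \<bullet> (d + s *\<^sub>R y)"
      by (simp add: f_def algebra_simps)
    have "0 \<le> (norm (d - s *\<^sub>R y))\<^sup>2" by simp
    then have "(norm (d + s *\<^sub>R y))\<^sup>2 \<le> 2 * ((norm d)\<^sup>2 + s\<^sup>2 * (norm y)\<^sup>2)"
      unfolding norm_add_sq norm_diff_sq by (simp add: power_mult_distrib)
    from mult_left_mono[OF this quadratic_remainder_nonneg] have "C * (norm (d + s *\<^sub>R y))\<^sup>2 \<le> g y"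
      by (simp add: g_def mult_ac)
    then show "\<bar>f y\<bar> \<le> g y" unfolding eq using quadratic_remainder_bound[of "x + t *\<^sub>R y" "d + s *\<^sub>R y"] by linarith
  qed
  ultimately show ?thesis by simp
qed

lemma heat_0: "heat W x 0 = W x" "heat_grad q x 0 = q x" "heat_time q x 0 = 0"
proof -
  have "gauss_mean (\<lambda>y. y \<bullet> q x) = 0"
    by (simp add: gauss_mean_inner_right[OF gauss_integrable_id] gauss_mean_id)
  then show "heat_time q x 0 = 0" by (simp add: heat_time_def inner_commute)
qed (simp_all add: heat_def heat_grad_def gauss_mean_const)

lemma heat_has_derivative: "((\<lambda>x. heat W x t) has_derivative (\<lambda>e. heat_grad q x t \<bullet> e)) (at x)"
  by (rule has_derivative_quadratic_bound[of 1 _ _ _ "2 * C"]) (use heat_expansion[of x _ t 0] in auto)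

lemma heat_time_has_derivative: "(heat W x has_real_derivative heat_time q x t) (at t)"
proof -
  have "(heat W x has_derivative (\<lambda>e. heat_time q x t \<bullet> e)) (at t)"
    by (rule has_derivative_quadratic_bound[of 1 _ _ _ "2 * C * real CARD('n)"])
       (use heat_expansion[of x 0 t] in \<open>auto simp: mult_ac\<close>)
  then show ?thesis by (simp add: has_field_derivative_def)
qed

text \<open>The Gaussian is centred, so the term of first order in \<open>t\<close> vanishes at time
  0.\<close>

lemma heat_minus_le: "\<bar>heat W x t - W x\<bar> \<le> 2 * C * real CARD('n) * t\<^sup>2"
  using heat_expansion[of x 0 0 t] by (simp add: heat_0)

lemma heat_continuous: "continuous_on S (\<lambda>z. heat W (fst z) (snd z))"
proof (rule continuous_at_imp_continuous_on, rule ballI)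
  fix z :: "(real ^ 'n) \<times> real"
  obtain x t where z: "z = (x, t)" by force
  define g where "g z' = \<bar>heat_grad q x t \<bullet> (fst z' - x) + (snd z' - t) * heat_time q x t\<bar>
      + 2 * C * ((norm (fst z' - x))\<^sup>2 + real CARD('n) * (snd z' - t)\<^sup>2)" for z' :: "(real ^ 'n) \<times> real"
  have "continuous (at z) g" unfolding g_def by (intro continuous_intros)
  then have g0: "(g \<longlongrightarrow> 0) (at z)" by (simp add: continuous_at g_def z)
  have le: "norm (heat W (fst z') (snd z') - heat W x t) \<le> g z'" for z'
    using heat_expansion[of x "fst z' - x" t "snd z' - t"] by (simp add: g_def)
  have "((\<lambda>z'. heat W (fst z') (snd z') - heat W x t) \<longlongrightarrow> 0) (at z)"
    by (rule Lim_null_comparison[OF always_eventually g0]) (use le in blast)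
  then have "((\<lambda>z'. heat W (fst z') (snd z')) \<longlongrightarrow> heat W x t) (at z)"
    by (rule LIM_zero_cancel)
  then show "continuous (at z) (\<lambda>z. heat W (fst z) (snd z))"
    by (simp add: continuous_at z)
qed

text \<open>A substitution moves the variable \<open>x\<close> from \<open>q\<close> to the
  Gaussian, so that \<open>gauss_shift_has_derivative\<close> can differentiate there.\<close>

lemma heat_grad_has_derivative:
  assumes t: "0 < t"
  shows "((\<lambda>x. heat_grad q x t) has_derivative (\<lambda>e. heat_hess q x t *v e)) (at x)"
proof -
  have comp: "((\<lambda>x. heat_grad q x t $ i) has_derivative (\<lambda>e. (heat_hess q x t *v e) $ i)) (at x)" for i
  proof -
    define f where "f y = q (x + t *\<^sub>R y) $ i" for y
    have f_m [measurable]: "f \<in> borel_measurable borel"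
      unfolding f_def cart_eq_inner_axis by measurable
    have "\<bar>f y\<bar> \<le> (norm (q x) + 6 * C * \<bar>t\<bar>) * exp (norm y)" for y
      unfolding f_def by (rule order_trans[OF component_le_norm_cart quadratic_remainder_gradient_growth])
    from gauss_shift_has_derivative[OF f_m this]
    have 1: "((\<lambda>e. \<integral>y. f y * gauss (y + e) \<partial>lborel) has_derivative
       (\<lambda>e. (\<integral>y. gauss y *\<^sub>R (f y *\<^sub>R - y) \<partial>lborel) \<bullet> e)) (at 0)" .
    have 2: "heat_grad q z t $ i = (\<integral>y. f y * gauss (y + (- (1/t)) *\<^sub>R (z - x)) \<partial>lborel)" for z
    proof -
      have "heat_grad q z t $ i = gauss_mean (\<lambda>y. q (z + t *\<^sub>R y) $ i)"
        unfolding heat_grad_def using gauss_mean_inner_right[OF gauss_integrable_gradient[of z t], of "axis i 1"]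
        by (simp add: cart_eq_inner_axis)
      also have "\<dots> = (\<integral>y. gauss y * f (y + (1/t) *\<^sub>R (z - x)) \<partial>lborel)"
        using t by (simp add: gauss_mean_def f_def algebra_simps)
      also have "\<dots> = (\<integral>y. f y * gauss (y + (- (1/t)) *\<^sub>R (z - x)) \<partial>lborel)"
        using lborel_translate(2)[of "\<lambda>y. f y * gauss (y + (- (1/t)) *\<^sub>R (z - x))" "(1/t) *\<^sub>R (z - x)"]
        by (simp add: algebra_simps)
      finally show ?thesis .
    qed
    have g: "((\<lambda>z. (- (1/t)) *\<^sub>R (z - x)) has_derivative (\<lambda>e. (- (1/t)) *\<^sub>R e)) (at x)"
      by (auto intro!: derivative_eq_intros)
    have "((\<lambda>z. heat_grad q z t $ i) has_derivative
       (\<lambda>e. (\<integral>y. gauss y *\<^sub>R (f y *\<^sub>R - y) \<partial>lborel) \<bullet> ((- (1/t)) *\<^sub>R e))) (at x)"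
      unfolding 2 by (rule has_derivative_compose[OF g]) (use 1 in simp)
    moreover have "(\<integral>y. gauss y *\<^sub>R (f y *\<^sub>R - y) \<partial>lborel) \<bullet> ((- (1/t)) *\<^sub>R e) = (heat_hess q x t *v e) $ i" for e
    proof -
      have int: "gauss_integrable_fun (\<lambda>y. f y *\<^sub>R y)"
      proof (rule gauss_integrable[of _ "norm (q x) + 6 * C * \<bar>t\<bar>"])
        fix y :: "real ^ 'n"
        have "norm (f y *\<^sub>R y) \<le> norm (q (x + t *\<^sub>R y)) * norm y"
          unfolding f_def by (simp add: mult_right_mono component_le_norm_cart)
        also note quadratic_remainder_gradient_growth_mult
        finally show "norm (f y *\<^sub>R y) \<le> (norm (q x) + 6 * C * \<bar>t\<bar>) * exp (4 * norm y)" .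
      qed measurable
      have "(heat_hess q x t *v e) $ i = (1/t) * (\<Sum>j\<in>UNIV. gauss_mean (\<lambda>y. f y * y $ j) * e $ j)"
        by (simp add: heat_hess_def matrix_vector_mult_def f_def sum_distrib_left mult.assoc sum_divide_distrib)
      also have "(\<lambda>j. gauss_mean (\<lambda>y. f y * y $ j)) = (\<lambda>j. gauss_mean (\<lambda>y. f y *\<^sub>R y) $ j)"
      proof
        fix j
        show "gauss_mean (\<lambda>y. f y * y $ j) = gauss_mean (\<lambda>y. f y *\<^sub>R y) $ j"
          using gauss_mean_inner_right[OF int, of "axis j 1"] by (simp add: cart_eq_inner_axis)
      qed
      then have "(\<Sum>j\<in>UNIV. gauss_mean (\<lambda>y. f y * y $ j) * e $ j) = gauss_mean (\<lambda>y. f y *\<^sub>R y) \<bullet> e"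
        by (simp add: inner_vec_def fun_eq_iff)
      finally show ?thesis by (simp add: gauss_mean_def)
    qed
    ultimately show ?thesis by simp
  qed
  show ?thesis
    unfolding has_derivative_componentwise_within[of "\<lambda>x. heat_grad q x t"]
    using comp by (auto simp: Basis_vec_def inner_axis)
qed

text \<open>Both sides are the mean of \<open>q (x + t *\<^sub>R y) \<bullet> y\<close>, one of them
  summed by coordinates. This is the heat equation, since the derivative of
  \<open>t\<^sup>2 / 2\<close> is \<open>t\<close>.\<close>

lemma trace_heat_hess: "0 < t \<Longrightarrow> t * trace (heat_hess q x t) = heat_time q x t"
proof -
  assume t: "0 < t"
  have int: "gauss_integrable_fun (\<lambda>y. q (x + t *\<^sub>R y) $ i * y $ i)" for i
  proof (rule gauss_integrable[of _ "norm (q x) + 6 * C * \<bar>t\<bar>"])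
    fix y :: "real ^ 'n"
    have "norm (q (x + t *\<^sub>R y) $ i * y $ i) \<le> norm (q (x + t *\<^sub>R y)) * norm y"
      unfolding real_norm_def abs_mult by (intro mult_mono component_le_norm_cart) auto
    also note quadratic_remainder_gradient_growth_mult
    finally show "norm (q (x + t *\<^sub>R y) $ i * y $ i) \<le> (norm (q x) + 6 * C * \<bar>t\<bar>) * exp (4 * norm y)" .
  qed (unfold cart_eq_inner_axis, measurable)
  have "heat_time q x t = (\<Sum>i\<in>UNIV. gauss_mean (\<lambda>y. q (x + t *\<^sub>R y) $ i * y $ i))"
    unfolding heat_time_def gauss_mean_def inner_vec_def inner_real_def scaleR_sum_right
    by (rule Bochner_Integration.integral_sum) (rule int)
  then show ?thesis using t by (simp add: heat_hess_def trace_def sum_distrib_left)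
qed

end

section \<open>The maximum principle\<close>

text \<open>Subtracting the paraboloid leaves a local maximum at \<open>x\<close>, where the
  derivative vanishes.\<close>

lemma gradient_unique_if_touched:
  fixes f :: "real ^ 'n \<Rightarrow> real"
  assumes f: "(f has_derivative (\<lambda>e. D \<bullet> e)) (at x)" and \<rho>: "0 < \<rho>"
    and le: "\<And>k. norm k < \<rho> \<Longrightarrow> f (x + k) \<le> f x + P \<bullet> k + M * (norm k)\<^sup>2"
  shows "P = D"
proof -
  define g where "g z = f z - P \<bullet> (z - x) - M * ((z - x) \<bullet> (z - x))" for z
  have "(g has_derivative (\<lambda>e. D \<bullet> e - P \<bullet> e - M * ((x - x) \<bullet> e + e \<bullet> (x - x)))) (at x)"
    unfolding g_def by (rule derivative_eq_intros f refl | simp)+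
  then have g: "(g has_derivative (\<lambda>e. (D - P) \<bullet> e)) (at x)" by (simp add: inner_diff_left)
  have "(\<lambda>e. (D - P) \<bullet> e) = (\<lambda>e. 0)"
  proof (rule differential_zero_maxmin[OF _ open_ball g])
    show "x \<in> ball x \<rho>" using \<rho> by simp
    have "g y \<le> g x" if "y \<in> ball x \<rho>" for y
    proof -
      have "norm (y - x) < \<rho>" using that by (simp add: dist_norm norm_minus_commute)
      then show ?thesis using le[of "y - x"] by (simp add: g_def power2_norm_eq_inner)
    qed
    then show "(\<forall>y\<in>ball x \<rho>. g y \<le> g x) \<or> (\<forall>y\<in>ball x \<rho>. g x \<le> g y)" by blast
  qed
  from fun_cong[OF this, of "D - P"] show ?thesis by simp
qed

text \<open>Maximum principle: \<open>W\<close> is compared with its heat flow plus a barrier which is a supersolution of the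
  heat equation, dominates \<open>\<bar>W - heat\<bar>\<close> on the lateral boundary and is of higher order at the centre.\<close>

lemma heat_lower_bound:
  fixes W :: "real ^ 'n \<Rightarrow> real"
  assumes W: "quadratic_remainder C W q" and r: "0 < r" and c: "0 \<le> c" and t: "0 \<le> t"
    and sub: "\<And>x X. norm (x - x0) < r \<Longrightarrow> transpose X = X \<Longrightarrow> touches_above W x (q x) X \<Longrightarrow> - c \<le> trace X"
  shows "W x0 - c / 2 * t\<^sup>2 - (2 * C * real CARD('n) + 1) * real CARD('n) / (2 * r\<^sup>2) * t ^ 4 \<le> heat W x0 t"
proof -
  define n where "n = real CARD('n)"
  have n: "0 < n" by (simp add: n_def)
  define B where "B = 2 * C * n + 1"
  have C: "0 \<le> C" by (rule quadratic_remainder_nonneg[OF W])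
  have B: "0 < B" using C n by (simp add: B_def add_nonneg_pos)
  \<comment> \<open>The parameter \<open>e\<close> makes the differential inequality strict and is
    removed at the end.\<close>
  have main: "W x0 - B * n / (2 * r\<^sup>2) * t ^ 4 - c / 2 * t\<^sup>2 \<le> heat W x0 t + e * (t\<^sup>2 / 2)" if e: "0 < e" for e
  proof (rule ccontr)
    \<comment> \<open>The first term dominates \<open>W - heat\<close> on the lateral boundary. The
      quartic term pays, through its derivative in \<open>s\<close>, for the Laplacian of the first;
      the last one pays for \<open>c\<close> and, through \<open>e\<close>, for strictness.\<close>
    define b where "b x s = B * (s\<^sup>2 * (norm (x - x0))\<^sup>2 / r\<^sup>2 + n * s ^ 4 / (2 * r\<^sup>2)) + (c + e) / 2 * s\<^sup>2" for x :: "real ^ 'n" and s :: real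
    define G where "G x s = W x - heat W x s - b x s" for x s
    assume "\<not> ?thesis"
    then have pos: "0 < G x0 t" by (simp add: G_def b_def algebra_simps add_divide_distrib)
    define D where "D = cball x0 r \<times> {0..t}"
    have "continuous_on D (\<lambda>z. W (fst z))"
      by (rule continuous_on_compose2[OF quadratic_remainder_continuous(1)[OF W, of UNIV]]) (auto intro: continuous_intros)
    then have "continuous_on D (\<lambda>z. G (fst z) (snd z))"
      unfolding G_def b_def by (intro continuous_intros heat_continuous[OF W]) (use r in auto)
    moreover have "compact D" "(x0, t) \<in> D" using r t by (auto simp: D_def compact_Times)
    ultimately obtain z where z: "z \<in> D" "\<And>z'. z' \<in> D \<Longrightarrow> G (fst z') (snd z') \<le> G (fst z) (snd z)"
      using continuous_attains_sup[of D "\<lambda>z. G (fst z) (snd z)"] by blast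
    obtain x s where xs: "z = (x, s)" by force
    have max: "G x' s' \<le> G x s" if "norm (x' - x0) \<le> r" "0 \<le> s'" "s' \<le> t" for x' s'
      using z(2)[of "(x', s')"] that by (simp add: D_def xs dist_norm norm_minus_commute)
    have x: "norm (x - x0) \<le> r" and s0: "0 \<le> s" and st: "s \<le> t"
      using z(1) by (auto simp: D_def xs dist_norm norm_minus_commute)
    have Gpos: "0 < G x s" using max[of x0 t] pos r t by simp
    \<comment> \<open>At time 0 the flow is \<open>W\<close> itself and the barrier vanishes, so
      \<open>G\<close> is zero there.\<close>
    have s: "0 < s"
      using Gpos s0 heat_0(1)[OF W, of x] by (cases "s = 0") (auto simp: G_def b_def)
    have inside: "norm (x - x0) < r"
    proof (rule ccontr)
      assume "\<not> ?thesis"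
      then have "norm (x - x0) = r" using x by simp
      then have "b x s = B * s\<^sup>2 + B * (n * s ^ 4 / (2 * r\<^sup>2)) + (c + e) / 2 * s\<^sup>2"
        using r by (simp add: b_def distrib_left)
      moreover have "0 \<le> B * (n * s ^ 4 / (2 * r\<^sup>2))" "0 \<le> (c + e) / 2 * s\<^sup>2"
        using B n c e by auto
      moreover have "W x - heat W x s \<le> 2 * C * n * s\<^sup>2"
        using heat_minus_le[OF W, of x s] by (simp add: n_def)
      moreover have "2 * C * n * s\<^sup>2 \<le> B * s\<^sup>2" by (intro mult_right_mono) (auto simp: B_def)
      ultimately show False using Gpos by (simp add: G_def)
    qed
    define H where "H = heat_hess q x s"
    \<comment> \<open>The Taylor error then adds \<open>e / 2\<close> to the trace, half of what
      strictness provides.\<close>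
    define \<kappa> where "\<kappa> = e / (4 * n)"
    have \<kappa>: "0 < \<kappa>" using e n by (simp add: \<kappa>_def)
    define d where "d = B * s\<^sup>2 / r\<^sup>2"
    \<comment> \<open>The symmetric part of \<open>H\<close> keeps its quadratic form and trace and
      gives the symmetric matrix that \<open>sub\<close> asks for; \<open>2 * d\<close> is the
      curvature of the barrier.\<close>
    define X where "X = (1/2) *\<^sub>R (H + transpose H) + (2 * \<kappa> + 2 * d) *\<^sub>R mat 1"
    have qf: "k \<bullet> (X *v k) = k \<bullet> (H *v k) + (2 * \<kappa> + 2 * d) * (norm k)\<^sup>2" for k
    proof -
      have "k \<bullet> (transpose H *v k) = k \<bullet> (H *v k)"
        by (metis dot_lmul_matrix inner_commute transpose_matrix_vector)
      then show ?thesis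
        unfolding X_def quadratic_add_mat
        by (simp add: scaleR_matrix_vector_assoc[symmetric] matrix_vector_mult_add_rdistrib inner_add_right)
    qed
    have Xs: "transpose X = X"
      unfolding X_def by (rule transpose_add_mat) (simp add: transpose_def vec_eq_iff)
    have Xt: "trace X = trace H + e / 2 + 2 * d * n"
    proof -
      have "trace (transpose H) = trace H" by (simp add: trace_def transpose_def)
      then show ?thesis
        using n by (simp add: X_def trace_add trace_scaleR trace_mat \<kappa>_def n_def field_simps)
    qed
    obtain \<rho> where \<rho>: "0 < \<rho>" "\<And>k. norm k \<le> \<rho> \<Longrightarrow>
        heat W (x + k) s \<le> heat W x s + heat_grad q x s \<bullet> k + 1 / 2 * (k \<bullet> (H *v k)) + \<kappa> * (norm k)\<^sup>2"
      using second_order_upper[OF heat_has_derivative[OF W] heat_grad_has_derivative[OF W s, of x] \<kappa>]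
      unfolding H_def by blast
    define P where "P = heat_grad q x s + (2 * d) *\<^sub>R (x - x0)"
    define \<rho>' where "\<rho>' = min \<rho> (r - norm (x - x0))"
    have \<rho>': "0 < \<rho>'" using \<rho>(1) inside by (simp add: \<rho>'_def)
    have touch: "W (x + k) \<le> W x + P \<bullet> k + 1 / 2 * (k \<bullet> (X *v k))" if "norm k \<le> \<rho>'" for k
    proof -
      have k: "norm k \<le> \<rho>" "norm (x + k - x0) \<le> r"
        using that norm_triangle_ineq[of "x - x0" k] by (auto simp: \<rho>'_def algebra_simps)
      have "W (x + k) \<le> W x + (heat W (x + k) s - heat W x s) + (b (x + k) s - b x s)"
        using max[OF k(2) s0 st] by (simp add: G_def)
      moreover have "b (x + k) s - b x s = d * (2 * ((x - x0) \<bullet> k) + (norm k)\<^sup>2)"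
      proof -
        have "(norm (x + k - x0))\<^sup>2 = (norm (x - x0))\<^sup>2 + 2 * ((x - x0) \<bullet> k) + (norm k)\<^sup>2"
          using norm_add_sq[of "x - x0" k] by (simp add: algebra_simps)
        then show ?thesis unfolding b_def d_def by (simp add: distrib_left add_divide_distrib)
      qed
      moreover note \<rho>(2)[OF k(1)]
      ultimately show ?thesis
        unfolding qf P_def inner_add_left inner_scaleR_left by (simp add: distrib_left distrib_right)
    qed
    have "P = q x"
    proof (rule gradient_unique_if_touched[OF quadratic_remainder_has_derivative[OF W] \<rho>'])
      fix k :: "real ^ 'n" assume k: "norm k < \<rho>'"
      show "W (x + k) \<le> W x + P \<bullet> k + (onorm ((*v) X) / 2) * (norm k)\<^sup>2"
        using touch[of k] k quadratic_le_onorm[of k X] by simp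
    qed
    then have "touches_above W x (q x) X"
      using touch \<rho>' unfolding touches_above_def by blast
    from sub[OF inside Xs this] have trH: "- c - e / 2 - 2 * d * n \<le> trace H" by (simp add: Xt)
    define a1 a2 where "a1 = B * (norm (x - x0))\<^sup>2 / r\<^sup>2 + (c + e) / 2" and "a2 = B * n / (2 * r\<^sup>2)"
    \<comment> \<open>The derivative of the flow plus the barrier. It is positive, so
      \<open>G\<close> is larger at slightly earlier times; later times are avoided because
      \<open>s\<close> may be the final one.\<close>
    define l where "l = heat_time q x s + (a1 * (2 * s) + a2 * (4 * s ^ 3))"
    have "b x = (\<lambda>s. a1 * s\<^sup>2 + a2 * s ^ 4)"
      by (simp add: b_def a1_def a2_def fun_eq_iff algebra_simps)
    moreover have "((\<lambda>s. a1 * s\<^sup>2 + a2 * s ^ 4) has_real_derivative a1 * (2 * s) + a2 * (4 * s ^ 3)) (at s)"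
      by (auto intro!: derivative_eq_intros)
    ultimately have "((\<lambda>s. heat W x s + b x s) has_real_derivative l) (at s)"
      unfolding l_def by (intro DERIV_add heat_time_has_derivative[OF W]) simp
    moreover have "0 < l"
    proof -
      have "l = s * trace H + s * (2 * B * (norm (x - x0))\<^sup>2 / r\<^sup>2) + s * (2 * d * n) + s * (c + e)"
        unfolding l_def trace_heat_hess[OF W s, of x, symmetric] H_def[symmetric] d_def a1_def a2_def
        using r by (simp add: field_simps power2_eq_square power3_eq_cube)
      moreover have "s * (- c - e / 2 - 2 * d * n) \<le> s * trace H" using trH s by (intro mult_left_mono) auto
      moreover have "0 \<le> s * (2 * B * (norm (x - x0))\<^sup>2 / r\<^sup>2)" using s B by simp
      moreover have "0 < s * e" using s e by simp
      ultimately show ?thesis by (simp add: algebra_simps)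
    qed
    ultimately obtain \<delta> where \<delta>: "0 < \<delta>" "\<And>h. 0 < h \<Longrightarrow> h < \<delta> \<Longrightarrow> heat W x (s - h) + b x (s - h) < heat W x s + b x s"
      using DERIV_pos_inc_left by blast
    define h where "h = min (\<delta> / 2) s"
    have h: "0 < h" "h < \<delta>" "h \<le> s" using \<delta>(1) s by (auto simp: h_def)
    then show False using \<delta>(2)[OF h(1,2)] max[OF x, of "s - h"] st by (simp add: G_def)
  qed
  have "W x0 - B * n / (2 * r\<^sup>2) * t ^ 4 - c / 2 * t\<^sup>2 \<le> heat W x0 t"
    by (rule le_if_le_add_small[of _ _ "t\<^sup>2 / 2"]) (rule main)
  then show ?thesis unfolding B_def n_def by linarith
qed

text \<open>The positive square root of the coefficient matrix: its eigenvalue is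
  \<open>norm P\<close> orthogonally to \<open>P\<close> and \<open>sqrt (p - 1) * norm P\<close>
  along \<open>P\<close>. As a change of variables it turns the operator with frozen gradient into
  the Laplacian.\<close>

definition pLaplace_root :: "real \<Rightarrow> real ^ 'n \<Rightarrow> real ^ 'n ^ 'n" where
  "pLaplace_root p P = norm P *\<^sub>R mat 1 + ((sqrt (p - 1) - 1) / norm P) *\<^sub>R tensor P P"

definition pLaplace_root_inv :: "real \<Rightarrow> real ^ 'n \<Rightarrow> real ^ 'n ^ 'n" where
  "pLaplace_root_inv p P = (1 / norm P) *\<^sub>R mat 1 + ((1 / sqrt (p - 1) - 1) / norm P ^ 3) *\<^sub>R tensor P P"

lemma tensor_mult: "tensor a b *v v = (b \<bullet> v) *\<^sub>R a"
  by (simp add: tensor_def matrix_vector_mult_def vec_eq_iff inner_vec_def sum_distrib_left mult_ac)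

lemma rank_one_mult: "(a *\<^sub>R mat 1 + b *\<^sub>R tensor P P) *v v = a *\<^sub>R v + (b * (P \<bullet> v)) *\<^sub>R P"
  for P :: "real ^ 'n"
  by (simp add: matrix_vector_mult_add_rdistrib scaleR_matrix_vector_assoc[symmetric] tensor_mult)

lemma rank_one_mult_mult:
  "(a *\<^sub>R mat 1 + b *\<^sub>R tensor P P) ** (c *\<^sub>R mat 1 + d *\<^sub>R tensor P P)
     = (a * c) *\<^sub>R mat 1 + (a * d + b * c + b * d * (norm P)\<^sup>2) *\<^sub>R tensor P P"
  for P :: "real ^ 'n"
  unfolding matrix_eq matrix_vector_mul_assoc[symmetric] rank_one_mult
  by (simp add: inner_add_right dot_square_norm algebra_simps power2_eq_square)

lemma transpose_rank_one: "transpose (a *\<^sub>R mat 1 + b *\<^sub>R tensor P P) = a *\<^sub>R mat 1 + b *\<^sub>R tensor P P"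
  for P :: "real ^ 'n"
  by (auto simp: transpose_def tensor_def mat_def vec_eq_iff)

lemma pLaplace_root_inverse:
  assumes "1 < p" "P \<noteq> 0"
  shows "pLaplace_root p P ** pLaplace_root_inv p P = mat 1" "pLaplace_root_inv p P ** pLaplace_root p P = mat 1"
proof -
  define s where "s = sqrt (p - 1)"
  have s: "0 < s" using assms(1) by (simp add: s_def)
  have N: "0 < norm P" using assms(2) by simp
  have "norm P * ((1 / s - 1) / norm P ^ 3) + (s - 1) / norm P * (1 / norm P)
      + (s - 1) / norm P * ((1 / s - 1) / norm P ^ 3) * (norm P)\<^sup>2 = 0"
    using s N by (simp add: field_simps power2_eq_square power3_eq_cube)
  then show 1: "pLaplace_root p P ** pLaplace_root_inv p P = mat 1"
    unfolding pLaplace_root_def pLaplace_root_inv_def rank_one_mult_mult s_def[symmetric] using N by simp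
  then show "pLaplace_root_inv p P ** pLaplace_root p P = mat 1"
    by (simp add: matrix_left_right_inverse)
qed

lemma trace_mult_scaleR: "trace (X ** (c *\<^sub>R A)) = c * trace (X ** A)" for X :: "real ^ 'n ^ 'n"
  by (simp add: trace_def matrix_matrix_mult_def sum_distrib_left mult_ac)

lemma trace_mult_tensor: "trace (X ** tensor P P) = P \<bullet> (X *v P)" for X :: "real ^ 'n ^ 'n"
  by (simp add: trace_def matrix_matrix_mult_def tensor_def inner_vec_def matrix_vector_mult_def
      sum_distrib_left mult_ac)

text \<open>Cyclicity of the trace, since the square of the root is the coefficient matrix.\<close>

lemma pLaplace_op_trace:
  fixes X :: "real ^ 'n ^ 'n"
  assumes "1 < p"
  shows "trace (pLaplace_root p P ** X ** pLaplace_root p P) = pLaplace_op p P X"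
proof (cases "P = 0")
  case True
  then show ?thesis by (simp add: pLaplace_root_def pLaplace_op_eq tensor_def trace_def zero_vec_def[symmetric] matrix_matrix_mult_def)
next
  case False
  define s where "s = sqrt (p - 1)"
  have s: "s * s = p - 1" using assms by (simp add: s_def)
  have N: "0 < norm P" using False by simp
  have sq: "pLaplace_root p P ** pLaplace_root p P = (norm P)\<^sup>2 *\<^sub>R mat 1 + (p - 2) *\<^sub>R tensor P P"
  proof -
    have "norm P * ((s - 1) / norm P) + (s - 1) / norm P * norm P
        + (s - 1) / norm P * ((s - 1) / norm P) * (norm P)\<^sup>2 = s * s - 1"
      using N by (simp add: field_simps power2_eq_square)
    then show ?thesis
      unfolding pLaplace_root_def rank_one_mult_mult s_def[symmetric] s by (simp add: power2_eq_square)
  qed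
  have "trace (pLaplace_root p P ** X ** pLaplace_root p P) = trace (X ** (pLaplace_root p P ** pLaplace_root p P))"
    by (metis matrix_mul_assoc trace_mul_sym)
  also have "\<dots> = (norm P)\<^sup>2 * trace X + (p - 2) * trace (X ** tensor P P)"
    unfolding sq by (simp add: matrix_add_ldistrib trace_add trace_mult_scaleR)
  finally show ?thesis by (simp add: trace_mult_tensor pLaplace_op_eq)
qed

lemma symmetric_matrix_inner:
  fixes A :: "real ^ 'n ^ 'n"
  assumes "transpose A = A"
  shows "(A *v a) \<bullet> b = a \<bullet> (A *v b)"
  using symmetric_inner[OF assms, of b a] by (simp add: inner_commute)

lemma quadratic_remainder_compose:
  fixes w :: "real ^ 'n \<Rightarrow> real" and A :: "real ^ 'n ^ 'n"
  assumes w: "quadratic_remainder C w q" and A: "transpose A = A" and L: "\<And>v. norm (A *v v) \<le> L * norm v"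
  shows "quadratic_remainder (C * L\<^sup>2) (\<lambda>x. w (z + A *v x)) (\<lambda>x. A *v q (z + A *v x))"
  unfolding quadratic_remainder_def
proof (intro conjI allI)
  have C: "0 \<le> C" using w by (simp add: quadratic_remainder_def)
  then show "0 \<le> C * L\<^sup>2" by simp
  fix x h :: "real ^ 'n"
  have "w (z + A *v (x + h)) - w (z + A *v x) - (A *v q (z + A *v x)) \<bullet> h
      = w (z + A *v x + A *v h) - w (z + A *v x) - q (z + A *v x) \<bullet> (A *v h)"
    unfolding symmetric_matrix_inner[OF A] by (simp add: matrix_vector_right_distrib add.assoc)
  also have "\<bar>\<dots>\<bar> \<le> C * (norm (A *v h))\<^sup>2" using w unfolding quadratic_remainder_def by blast
  also have "\<dots> \<le> C * (L * norm h)\<^sup>2" using C by (intro mult_left_mono power_mono L) auto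
  finally show "\<bar>w (z + A *v (x + h)) - w (z + A *v x) - (A *v q (z + A *v x)) \<bullet> h\<bar> \<le> C * L\<^sup>2 * (norm h)\<^sup>2"
    by (simp add: power_mult_distrib)
qed

text \<open>In the variable \<open>x\<close> of \<open>x1 + A *v x\<close> a touching matrix
  \<open>X\<close> corresponds to \<open>A' ** X ** A'\<close> for \<open>w\<close>, and the
  operator at \<open>P\<close> becomes the trace of \<open>X\<close>. The ball of radius
  \<open>r / L\<close> is mapped into the given one, so \<open>heat_lower_bound\<close>
  applies.\<close>

lemma anisotropic_lower_bound:
  fixes w :: "real ^ 'n \<Rightarrow> real"
  assumes p: "1 < p" and P: "P \<noteq> 0" and w: "quadratic_remainder C w q"
    and r: "0 < r" and c: "0 \<le> c" and t: "0 \<le> t"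
    and L: "0 < L" "\<And>v. norm (pLaplace_root p P *v v) \<le> L * norm v"
    and sub: "\<And>x X. norm (x - x1) < r \<Longrightarrow> transpose X = X \<Longrightarrow> touches_above w x (q x) X \<Longrightarrow> - c \<le> pLaplace_op p P X"
  shows "w x1 - c / 2 * t\<^sup>2 - (2 * (C * L\<^sup>2) * real CARD('n) + 1) * real CARD('n) / (2 * (r / L)\<^sup>2) * t ^ 4
      \<le> heat (\<lambda>x. w (x1 + pLaplace_root p P *v x)) 0 t"
proof -
  define A where "A = pLaplace_root p P"
  define A' where "A' = pLaplace_root_inv p P"
  have AA': "A *v (A' *v v) = v" "A' *v (A *v v) = v" for v
    using pLaplace_root_inverse[OF p P] by (auto simp: A_def A'_def matrix_vector_mul_assoc)
  have As: "transpose A = A" "transpose A' = A'"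
    unfolding A_def A'_def pLaplace_root_def pLaplace_root_inv_def by (rule transpose_rank_one)+
  define W where "W x = w (x1 + A *v x)" for x
  define Q where "Q x = A *v q (x1 + A *v x)" for x
  have L': "norm (A *v v) \<le> L * norm v" for v unfolding A_def by (rule L)
  have "quadratic_remainder (C * L\<^sup>2) W Q"
    unfolding W_def Q_def by (rule quadratic_remainder_compose[OF w As(1) L'])
  then have "W 0 - c / 2 * t\<^sup>2 - (2 * (C * L\<^sup>2) * real CARD('n) + 1) * real CARD('n) / (2 * (r / L)\<^sup>2) * t ^ 4
      \<le> heat W 0 t"
  proof (rule heat_lower_bound)
    show "0 < r / L" using r L by simp
    fix x :: "real ^ 'n" and X :: "real ^ 'n ^ 'n"
    assume x: "norm (x - 0) < r / L" and X: "transpose X = X" and touch: "touches_above W x (Q x) X"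
    define Y where "Y = A' ** X ** A'"
    define z where "z = x1 + A *v x"
    have Ys: "transpose Y = Y" by (simp add: Y_def matrix_transpose_mul As X matrix_mul_assoc)
    have "norm (z - x1) < r"
      using L'[of x] x L(1) by (simp add: z_def field_simps)
    moreover have "touches_above w z (q z) Y"
    proof -
      obtain \<rho> where \<rho>: "0 < \<rho>" "\<And>h. norm h \<le> \<rho> \<Longrightarrow> W (x + h) \<le> W x + Q x \<bullet> h + 1 / 2 * (h \<bullet> (X *v h))"
        using touch by (auto simp: touches_above_def)
      define M where "M = onorm ((*v) A') + 1"
      have M: "0 < M" "norm (A' *v h) \<le> M * norm h" for h
      proof -
        have bl: "bounded_linear ((*v) A')" by simp
        show "0 < M" using onorm_pos_le[OF bl] by (simp add: M_def)
        show "norm (A' *v h) \<le> M * norm h"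
          using onorm[OF bl, of h] by (simp add: M_def distrib_right add_increasing2)
      qed
      show ?thesis unfolding touches_above_def
      proof (intro exI[of _ "\<rho> / M"] conjI allI impI)
        show "0 < \<rho> / M" using \<rho> M by simp
        fix h :: "real ^ 'n" assume "norm h \<le> \<rho> / M"
        then have "M * norm h \<le> \<rho>" using M by (simp add: field_simps)
        then have "norm (A' *v h) \<le> \<rho>" using M(2)[of h] by linarith
        from \<rho>(2)[OF this]
        show "w (z + h) \<le> w z + q z \<bullet> h + 1 / 2 * (h \<bullet> (Y *v h))"
          unfolding W_def Q_def symmetric_matrix_inner[OF As(1)]
          by (simp add: matrix_vector_right_distrib AA' z_def add.assoc Y_def matrix_vector_mul_assoc[symmetric]
              symmetric_matrix_inner[OF As(2)])
      qed
    qed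
    ultimately have "- c \<le> pLaplace_op p P Y" using sub Ys by blast
    also have "\<dots> = trace (A ** Y ** A)" by (simp add: A_def pLaplace_op_trace[OF p])
    also have "A ** Y ** A = X"
      by (simp add: matrix_eq Y_def matrix_vector_mul_assoc[symmetric] AA')
    finally show "- c \<le> trace X" .
  qed (use c t in auto)
  then show ?thesis by (simp add: W_def[abs_def] A_def)
qed

section \<open>Smooth test functions and mollification\<close>

text \<open>The family of functions \<open>inverse t ^ m * exp (- inverse t)\<close>, extended by
  zero. Its derivatives are linear combinations of members, so smoothness of the bump follows by one
  induction over all \<open>m\<close>.\<close>

definition flat :: "nat \<Rightarrow> real \<Rightarrow> real" where
  "flat m t = (if 0 < t then inverse t ^ m / exp (inverse t) else 0)"

lemma flat_tendsto_0: "(flat m \<longlongrightarrow> 0) (at_right 0)"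
proof -
  have "((\<lambda>t. inverse t ^ m / exp (inverse t)) \<longlongrightarrow> 0) (at_right (0::real))"
    by (rule filterlim_compose[OF tendsto_power_div_exp_0 filterlim_inverse_at_top_right])
  moreover have "\<forall>\<^sub>F t in at_right 0. inverse t ^ m / exp (inverse t) = flat m t"
    by (auto simp: eventually_at_right_field flat_def intro: exI[of _ 1])
  ultimately show ?thesis by (rule Lim_transform_eventually)
qed

lemma flat_has_derivative: "(flat m has_real_derivative flat (m + 2) t - real m * flat (m + 1) t) (at t)"
proof (cases t "0::real" rule: linorder_cases)
  case greater
  have "((\<lambda>t. inverse t ^ m / exp (inverse t)) has_real_derivative
      (real m * inverse t ^ (m - 1) * (- (inverse t * inverse t)) * exp (inverse t)
        - inverse t ^ m * (exp (inverse t) * (- (inverse t * inverse t)))) / (exp (inverse t) * exp (inverse t))) (at t)"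
    using greater by (auto intro!: derivative_eq_intros simp: power2_eq_square)
  also have "(real m * inverse t ^ (m - 1) * (- (inverse t * inverse t)) * exp (inverse t)
        - inverse t ^ m * (exp (inverse t) * (- (inverse t * inverse t)))) / (exp (inverse t) * exp (inverse t))
      = flat (m + 2) t - real m * flat (m + 1) t"
    using greater by (cases m) (simp_all add: flat_def field_simps)
  finally show ?thesis
  proof (rule DERIV_cong_ev[THEN iffD1, rotated -1, OF _ refl])
    show "\<forall>\<^sub>F x in nhds t. inverse x ^ m / exp (inverse x) = flat m x"
      using eventually_nhds_in_open[of "{0<..}" t] greater by (auto simp: flat_def elim: eventually_mono)
  qed simp
next
  case less
  have "((\<lambda>t. 0) has_real_derivative 0) (at t)" by simp
  then show ?thesis
  proof (rule DERIV_cong_ev[THEN iffD1, rotated -1, OF _ refl])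
    show "\<forall>\<^sub>F x in nhds t. 0 = flat m x"
      using eventually_nhds_in_open[of "{..<0}" t] less by (auto simp: flat_def elim: eventually_mono)
  qed (use less in \<open>simp add: flat_def\<close>)
next
  case equal
  have "((\<lambda>h. (flat m (0 + h) - flat m 0) / h) \<longlongrightarrow> 0) (at 0)"
  proof (rule filterlim_split_at)
    have "\<forall>\<^sub>F h in at_left (0::real). 0 = (flat m (0 + h) - flat m 0) / h"
      by (auto simp: eventually_at_left_field flat_def intro: exI[of _ "-1"])
    then show "((\<lambda>h. (flat m (0 + h) - flat m 0) / h) \<longlongrightarrow> 0) (at_left 0)"
      by (rule Lim_transform_eventually[OF tendsto_const])
    \<comment> \<open>The difference quotient at 0 is the next member of the family, which tends to
      0.\<close>
    have "\<forall>\<^sub>F h in at_right (0::real). flat (m + 1) h = (flat m (0 + h) - flat m 0) / h"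
      by (auto simp: eventually_at_right_field flat_def field_simps intro: exI[of _ 1])
    then show "((\<lambda>h. (flat m (0 + h) - flat m 0) / h) \<longlongrightarrow> 0) (at_right 0)"
      by (rule Lim_transform_eventually[OF flat_tendsto_0])
  qed
  then show ?thesis using equal by (simp add: DERIV_def flat_def)
qed

section \<open>Calculus of smooth functions on the whole space\<close>

lemma Ck_on_SucI:
  assumes "\<And>x. GDERIV f x :> g x" "\<And>i. Ck_on k UNIV (\<lambda>x. g x $ i)"
  shows "Ck_on (Suc k) UNIV f"
proof -
  have "grad f = g" using assms(1) grad_eqI by blast
  moreover have "f differentiable (at x)" for x
    using assms(1)[of x] unfolding gderiv_def differentiable_def by blast
  ultimately show ?thesis using assms(2) by simp
qed

lemma Ck_on_gderiv: "Ck_on (Suc k) UNIV f \<Longrightarrow> GDERIV f x :> grad f x"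
  by (simp add: gderiv_grad)

lemma Ck_on_SucD: "Ck_on (Suc k) UNIV f \<Longrightarrow> Ck_on k UNIV f"
proof (induction k arbitrary: f)
  case 0
  then show ?case by (auto intro!: continuous_at_imp_continuous_on differentiable_imp_continuous_within)
next
  case (Suc k)
  then show ?case by (metis Ck_on.simps(2))
qed

lemma Ck_on_const: "Ck_on k UNIV (\<lambda>_. c)"
proof (induction k arbitrary: c)
  case (Suc k)
  show ?case by (rule Ck_on_SucI[where g = "\<lambda>_. 0"]) (use Suc in \<open>simp_all add: gderiv_def\<close>)
qed simp

lemma Ck_on_component: "Ck_on k UNIV (\<lambda>x :: real ^ 'n. x $ i)"
proof (cases k)
  case (Suc m)
  have "((\<lambda>x. x \<bullet> axis i 1) has_derivative (\<lambda>h. h \<bullet> axis i 1)) (at x)" for x :: "real ^ 'n"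
    by (rule bounded_linear_imp_has_derivative[OF bounded_linear_inner_left])
  then show ?thesis unfolding Suc
    by (intro Ck_on_SucI[where g = "\<lambda>_. axis i 1"]) (simp_all add: gderiv_def cart_eq_inner_axis Ck_on_const)
qed (auto intro: continuous_intros)

lemma Ck_on_add: "Ck_on k UNIV f \<Longrightarrow> Ck_on k UNIV g \<Longrightarrow> Ck_on k UNIV (\<lambda>x. f x + g x)"
proof (induction k arbitrary: f g)
  case (Suc k)
  have "GDERIV (\<lambda>x. f x + g x) x :> grad f x + grad g x" for x
    using Ck_on_gderiv[OF Suc.prems(1), of x] Ck_on_gderiv[OF Suc.prems(2), of x]
    unfolding gderiv_def inner_add_right by (rule has_derivative_add)
  then show ?case
    by (rule Ck_on_SucI) (use Suc in auto)
qed (auto intro: continuous_on_add)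

lemma Ck_on_mult: "Ck_on k UNIV f \<Longrightarrow> Ck_on k UNIV g \<Longrightarrow> Ck_on k UNIV (\<lambda>x. f x * g x)"
proof (induction k arbitrary: f g)
  case (Suc k)
  have "GDERIV (\<lambda>x. f x * g x) x :> f x *\<^sub>R grad g x + g x *\<^sub>R grad f x" for x
    using has_derivative_mult[OF Ck_on_gderiv[OF Suc.prems(1), of x, unfolded gderiv_def] Ck_on_gderiv[OF Suc.prems(2), of x, unfolded gderiv_def]]
    unfolding gderiv_def by (simp add: inner_add_right mult.commute)
  then show ?case
  proof (rule Ck_on_SucI)
    fix i
    have "Ck_on k UNIV (\<lambda>x. f x * grad g x $ i + g x * grad f x $ i)"
      by (intro Ck_on_add Suc.IH Ck_on_SucD[OF Suc.prems(1)] Ck_on_SucD[OF Suc.prems(2)]) (use Suc.prems in simp_all)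
    then show "Ck_on k UNIV (\<lambda>x. (f x *\<^sub>R grad g x + g x *\<^sub>R grad f x) $ i)" by simp
  qed
qed (auto intro: continuous_on_mult)

lemma Ck_on_flat: "Ck_on k UNIV (\<lambda>x :: real ^ 'n. flat m (c - x \<bullet> x))"
proof (induction k arbitrary: m)
  case 0
  have "continuous_on UNIV (flat m)"
    using flat_has_derivative DERIV_isCont by (blast intro: continuous_at_imp_continuous_on)
  then show ?case
    by (auto intro!: continuous_on_compose2[of UNIV "flat m"] continuous_intros)
next
  case (Suc k)
  define d where "d t = flat (m + 2) t - real m * flat (m + 1) t" for t
  have "GDERIV (\<lambda>x :: real ^ 'n. flat m (c - x \<bullet> x)) x :> (d (c - x \<bullet> x) * - 2) *\<^sub>R x" for x
  proof -
    have "((\<lambda>x :: real ^ 'n. c - x \<bullet> x) has_derivative (\<lambda>h. 0 - (x \<bullet> h + h \<bullet> x))) (at x)"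
      by (intro has_derivative_diff has_derivative_const has_derivative_inner has_derivative_ident)
    moreover have "(flat m has_derivative (*) (d (c - x \<bullet> x))) (at (c - x \<bullet> x))"
      using flat_has_derivative[of m "c - x \<bullet> x"] by (simp only: has_field_derivative_def d_def)
    ultimately have "((\<lambda>x :: real ^ 'n. flat m (c - x \<bullet> x)) has_derivative (\<lambda>h. d (c - x \<bullet> x) * (0 - (x \<bullet> h + h \<bullet> x)))) (at x)"
      by (rule has_derivative_compose)
    then show ?thesis unfolding gderiv_def by (simp add: inner_commute mult_ac)
  qed
  then show ?case
  proof (rule Ck_on_SucI)
    fix i
    have "Ck_on k UNIV (\<lambda>x :: real ^ 'n. (flat (m + 2) (c - x \<bullet> x) + - real m * flat (m + 1) (c - x \<bullet> x)) * - 2 * x $ i)"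
      by (intro Ck_on_mult Ck_on_add Suc Ck_on_const Ck_on_component)
    then show "Ck_on k UNIV (\<lambda>x :: real ^ 'n. ((d (c - x \<bullet> x) * - 2) *\<^sub>R x) $ i)" by (simp add: d_def)
  qed
qed

text \<open>The set \<open>K\<close> only has to contain the support, so all partial derivatives
  share the same \<open>K\<close>.\<close>

definition smooth_supported :: "(real ^ 'n) set \<Rightarrow> (real ^ 'n \<Rightarrow> real) \<Rightarrow> bool" where
  "smooth_supported K \<phi> \<longleftrightarrow> (\<forall>k. Ck_on k UNIV \<phi>) \<and> compact K \<and> (\<forall>x. x \<notin> K \<longrightarrow> \<phi> x = 0)"

lemma smooth_supported_gderiv: "smooth_supported K \<phi> \<Longrightarrow> GDERIV \<phi> x :> grad \<phi> x"
  unfolding smooth_supported_def using Ck_on_gderiv by blast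

lemma smooth_supported_continuous: "smooth_supported K \<phi> \<Longrightarrow> continuous_on S \<phi>"
  unfolding smooth_supported_def by (metis Ck_on.simps(1) continuous_on_subset subset_UNIV)

lemma smooth_supported_outside: "smooth_supported K \<phi> \<Longrightarrow> x \<notin> K \<Longrightarrow> \<phi> x = 0"
  by (simp add: smooth_supported_def)

lemma grad_zero_outside:
  assumes "closed K" "\<And>x. x \<notin> K \<Longrightarrow> f x = 0" "x \<notin> K"
  shows "grad f x = 0"
proof (rule grad_eqI)
  have "((\<lambda>x. 0) has_derivative (\<lambda>h. 0)) (at x)" by simp
  then have "(f has_derivative (\<lambda>h. 0)) (at x)"
    by (rule has_derivative_transform_within_open[of _ _ _ _ "- K"]) (use assms in auto)
  then show "GDERIV f x :> 0" by (simp add: gderiv_def)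
qed

lemma smooth_supported_grad:
  assumes "smooth_supported K \<phi>"
  shows "smooth_supported K (\<lambda>x. grad \<phi> x $ i)"
proof -
  have "Ck_on k UNIV (\<lambda>x. grad \<phi> x $ i)" for k
  proof -
    have "Ck_on (Suc k) UNIV \<phi>" using assms unfolding smooth_supported_def by blast
    then show ?thesis by simp
  qed
  moreover have "grad \<phi> x = 0" if "x \<notin> K" for x
    using assms that by (intro grad_zero_outside[of K]) (auto simp: smooth_supported_def compact_imp_closed)
  ultimately show ?thesis using assms by (simp add: smooth_supported_def)
qed

lemma smooth_supported_cmult: "smooth_supported K \<phi> \<Longrightarrow> smooth_supported K (\<lambda>x. c * \<phi> x)"
  unfolding smooth_supported_def by (simp add: Ck_on_mult Ck_on_const)

lemma smooth_supported_bounded: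
  assumes "smooth_supported K \<phi>"
  shows "\<exists>M>0. \<forall>x. \<bar>\<phi> x\<bar> \<le> M"
proof -
  have "bounded (\<phi> ` K)"
    using assms smooth_supported_continuous[OF assms]
    by (intro compact_imp_bounded compact_continuous_image) (auto simp: smooth_supported_def)
  then obtain M where "0 < M" "\<forall>x\<in>K. \<bar>\<phi> x\<bar> \<le> M" by (auto simp: bounded_pos)
  then show ?thesis using smooth_supported_outside[OF assms] by (metis abs_zero less_imp_le)
qed

lemma smooth_supported_grad_bounded:
  assumes "smooth_supported K \<phi>"
  shows "\<exists>M>0. \<forall>x. norm (grad \<phi> x) \<le> M"
proof -
  have "\<forall>i. \<exists>M>0. \<forall>x. \<bar>grad \<phi> x $ i\<bar> \<le> M"
    using smooth_supported_bounded[OF smooth_supported_grad[OF assms]] by blast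
  then obtain M where M: "\<And>i. 0 < M i" "\<And>i x. \<bar>grad \<phi> x $ i\<bar> \<le> M i" by metis
  have "norm (grad \<phi> x) \<le> sum M UNIV" for x
    by (rule order_trans[OF norm_le_l1_cart sum_mono]) (rule M)
  moreover have "0 < sum M UNIV" using M(1) by (intro sum_pos) auto
  ultimately show ?thesis by blast
qed

lemma smooth_supported_Lipschitz:
  assumes "smooth_supported K \<phi>"
  shows "\<exists>M>0. \<forall>x y. \<bar>\<phi> x - \<phi> y\<bar> \<le> M * norm (x - y)"
proof -
  obtain M where M: "0 < M" "\<And>x. norm (grad \<phi> x) \<le> M" using smooth_supported_grad_bounded[OF assms] by blast
  have "\<phi> x - \<phi> y \<le> M * norm (x - y)" for x y
    using gradient_almost_constant[of UNIV \<phi> "grad \<phi>" 0 M x y] smooth_supported_gderiv[OF assms] M(2) by simp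
  then have "\<bar>\<phi> x - \<phi> y\<bar> \<le> M * norm (x - y)" for x y
    by (smt (verit) norm_minus_commute)
  then show ?thesis using M(1) by blast
qed

text \<open>The gradient is Lipschitz because its components are again smooth with compact support.
  The ball is one unit larger than \<open>K\<close> since \<open>norm e \<le> 1\<close>. This is the
  domination demanded by \<open>kernel_has_derivative\<close>.\<close>

lemma smooth_supported_kernel_bound:
  assumes \<phi>: "smooth_supported K \<phi>"
  shows "\<exists>M R. 0 < M \<and> (\<forall>e y. norm e \<le> 1 \<longrightarrow>
     \<bar>\<phi> (y + e) - \<phi> y - grad \<phi> y \<bullet> e\<bar> \<le> (norm e)\<^sup>2 * (M * indicator (cball 0 R) y))"
proof -
  have "\<forall>i. \<exists>M>0. \<forall>x y. \<bar>grad \<phi> x $ i - grad \<phi> y $ i\<bar> \<le> M * norm (x - y)"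
    using smooth_supported_Lipschitz[OF smooth_supported_grad[OF \<phi>]] by blast
  then obtain M where M: "\<And>i. 0 < M i" "\<And>i x y. \<bar>grad \<phi> x $ i - grad \<phi> y $ i\<bar> \<le> M i * norm (x - y)" by metis
  define N where "N = sum M UNIV"
  have N: "0 < N" unfolding N_def using M(1) by (intro sum_pos) auto
  have lip: "norm (grad \<phi> x - grad \<phi> y) \<le> N * norm (x - y)" for x y
  proof -
    have "norm (grad \<phi> x - grad \<phi> y) \<le> (\<Sum>i\<in>UNIV. \<bar>(grad \<phi> x - grad \<phi> y) $ i\<bar>)" by (rule norm_le_l1_cart)
    also have "\<dots> \<le> (\<Sum>i\<in>UNIV. M i * norm (x - y))" using M(2) by (intro sum_mono) simp
    finally show ?thesis by (simp add: N_def sum_distrib_right)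
  qed
  have "compact K" using \<phi> by (simp add: smooth_supported_def)
  then obtain R0 where R0: "\<And>x. x \<in> K \<Longrightarrow> norm x \<le> R0"
    using compact_imp_bounded bounded_iff by metis
  have "\<bar>\<phi> (y + e) - \<phi> y - grad \<phi> y \<bullet> e\<bar> \<le> (norm e)\<^sup>2 * (N * indicator (cball 0 (R0 + 1)) y)"
    if e: "norm e \<le> 1" for e y
  proof (cases "norm y \<le> R0 + 1")
    case True
    have g: "norm (grad \<phi> z - grad \<phi> y) \<le> N * norm e" if "z \<in> cball y (norm e)" for z
      using order_trans[OF lip[of z y] mult_left_mono[of "norm (z - y)" "norm e" N]] that N
      by (simp add: dist_norm norm_minus_commute)
    have in_ball: "y + e \<in> cball y (norm e)" "y \<in> cball y (norm e)" by (simp_all add: dist_norm)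
    note gac = gradient_almost_constant[of "cball y (norm e)" \<phi> "grad \<phi>" "grad \<phi> y" "N * norm e",
        OF smooth_supported_gderiv[OF \<phi>] convex_cball g]
    have "\<phi> (y + e) - \<phi> y \<le> grad \<phi> y \<bullet> e + N * norm e * norm e"
      using gac[OF _ in_ball] by simp
    moreover have "\<phi> y - \<phi> (y + e) \<le> - (grad \<phi> y \<bullet> e) + N * norm e * norm e"
      using gac[OF _ in_ball(2,1)] by simp
    ultimately show ?thesis using True by (simp add: power2_eq_square abs_le_iff mult_ac)
  next
    case False
    have "y \<notin> K" "y + e \<notin> K"
      using R0[of y] R0[of "y + e"] False e norm_triangle_ineq2[of y "- e"] by force+
    moreover from this have "grad \<phi> y = 0"
      using smooth_supported_outside[OF smooth_supported_grad[OF \<phi>]] by (simp add: vec_eq_iff)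
    ultimately show ?thesis using smooth_supported_outside[OF \<phi>] N by (simp add: indicator_def)
  qed
  then show ?thesis using N by blast
qed

section \<open>Convolution and mollifiers\<close>

lemma integrable_compact_support:
  fixes f :: "'a::euclidean_space \<Rightarrow> 'b::euclidean_space"
  assumes "continuous_on UNIV f" "compact K" "\<And>x. x \<notin> K \<Longrightarrow> f x = 0"
  shows "integrable lborel f"
proof -
  have "integrable lborel (\<lambda>x. indicator K x *\<^sub>R f x)"
    by (rule borel_integrable_compact[OF assms(2)]) (rule continuous_on_subset[OF assms(1) subset_UNIV])
  also have "(\<lambda>x. indicator K x *\<^sub>R f x) = f" using assms(3) by (auto simp: indicator_def)
  finally show ?thesis .
qed

lemma smooth_supported_integrable: "smooth_supported K \<phi> \<Longrightarrow> integrable lborel \<phi>"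
  by (rule integrable_compact_support[OF smooth_supported_continuous, of K \<phi> K])
     (auto simp: smooth_supported_def)

text \<open>The argument is \<open>x + y\<close> instead of \<open>x - y\<close>, so a mollification
  is a mean of translates of \<open>f\<close>; derivatives reach the kernel with a minus
  sign.\<close>

definition conv :: "(real ^ 'n \<Rightarrow> 'b) \<Rightarrow> (real ^ 'n \<Rightarrow> real) \<Rightarrow> real ^ 'n \<Rightarrow> 'b::euclidean_space" where
  "conv f \<phi> x = (\<integral>y. \<phi> y *\<^sub>R f (x + y) \<partial>lborel)"

lemma conv_integrable:
  fixes f :: "real ^ 'n \<Rightarrow> 'b::euclidean_space"
  assumes "continuous_on UNIV f" "smooth_supported K \<phi>"
  shows "integrable lborel (\<lambda>y. \<phi> y *\<^sub>R f (x + y))"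
proof (rule integrable_compact_support[of _ K])
  show "continuous_on UNIV (\<lambda>y. \<phi> y *\<^sub>R f (x + y))"
    by (intro continuous_on_scaleR smooth_supported_continuous[OF assms(2)]
        continuous_on_compose2[OF assms(1)] continuous_intros) auto
qed (use assms(2) in \<open>auto simp: smooth_supported_def\<close>)

lemma conv_component:
  fixes f :: "real ^ 'n \<Rightarrow> real ^ 'm"
  assumes "continuous_on UNIV f" "smooth_supported K \<phi>"
  shows "conv f \<phi> x $ i = conv (\<lambda>y. f y $ i) \<phi> x"
  unfolding conv_def cart_eq_inner_axis
  by (subst integral_inner_left[symmetric]) (use conv_integrable[OF assms, of x] in simp_all)

text \<open>A change of \<open>x\<close> is moved to the kernel, where
  \<open>kernel_has_derivative\<close> differentiates; of \<open>f\<close> only continuity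
  enters.\<close>

lemma conv_has_derivative:
  fixes f :: "real ^ 'n \<Rightarrow> real"
  assumes f: "continuous_on UNIV f" and \<phi>: "smooth_supported K \<phi>"
  shows "GDERIV (conv f \<phi>) x :> (\<chi> i. conv f (\<lambda>y. - grad \<phi> y $ i) x)"
proof -
  have [measurable]: "f \<in> borel_measurable borel" by (rule borel_measurable_continuous_onI[OF f])
  have fx: "continuous_on UNIV (\<lambda>y. f (x + y))"
    by (intro continuous_on_compose2[OF f] continuous_intros) auto
  obtain M R where MR: "0 < M" "\<And>e y. norm e \<le> 1 \<Longrightarrow>
     \<bar>\<phi> (y + e) - \<phi> y - grad \<phi> y \<bullet> e\<bar> \<le> (norm e)\<^sup>2 * (M * indicator (cball 0 R) y)"
    using smooth_supported_kernel_bound[OF \<phi>] by metis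
  have gc: "continuous_on UNIV (grad \<phi>)"
    using smooth_supported_continuous[OF smooth_supported_grad[OF \<phi>]]
      continuous_on_vec_lambda[of UNIV "\<lambda>i x. grad \<phi> x $ i"] by simp
  have K: "compact K" using \<phi> by (simp add: smooth_supported_def)
  have g0: "grad \<phi> y = 0" if "y \<notin> K" for y
    using smooth_supported_outside[OF smooth_supported_grad[OF \<phi>] that] by (simp add: vec_eq_iff)
  have ig: "integrable lborel (\<lambda>y. f (x + y) *\<^sub>R grad \<phi> y)"
    by (rule integrable_compact_support[OF continuous_on_scaleR[OF fx gc] K]) (simp add: g0)
  have 1: "((\<lambda>e. \<integral>y. f (x + y) * \<phi> (y + e) \<partial>lborel) has_derivative
      (\<lambda>e. (\<integral>y. f (x + y) *\<^sub>R grad \<phi> y \<partial>lborel) \<bullet> e)) (at 0)"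
  proof (rule kernel_has_derivative[OF MR(2) _ ig])
    fix e :: "real ^ 'n"
    show "integrable lborel (\<lambda>y. f (x + y) * \<phi> (y + e))"
    proof (rule integrable_compact_support[of _ "(\<lambda>z. - e + z) ` K"])
      show "continuous_on UNIV (\<lambda>y. f (x + y) * \<phi> (y + e))"
        by (intro continuous_on_mult fx continuous_on_compose2[OF smooth_supported_continuous[OF \<phi>, of UNIV]] continuous_intros) auto
      show "compact ((\<lambda>z. - e + z) ` K)" using K by (rule compact_translation)
      show "f (x + y) * \<phi> (y + e) = 0" if "y \<notin> (\<lambda>z. - e + z) ` K" for y
      proof -
        have "y + e \<notin> K" using that by (force simp: image_iff)
        then show ?thesis using smooth_supported_outside[OF \<phi>] by simp
      qed
    qed
  next
    have "integrable lborel (\<lambda>y. indicator (cball 0 R) y *\<^sub>R (M * \<bar>f (x + y)\<bar>))"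
      by (rule borel_integrable_compact)
         (auto intro!: continuous_intros continuous_on_subset[OF fx])
    then show "integrable lborel (\<lambda>y. \<bar>f (x + y)\<bar> * (M * indicator (cball 0 R) y))"
      by (simp add: mult_ac)
  qed
  have 2: "conv f \<phi> z = (\<integral>y. f (x + y) * \<phi> (y + - 1 *\<^sub>R (z - x)) \<partial>lborel)" for z
  proof -
    have [measurable]: "\<phi> \<in> borel_measurable borel"
      by (rule borel_measurable_continuous_onI[OF smooth_supported_continuous[OF \<phi>]])
    have "(\<integral>y. f (x + (z - x + y)) * \<phi> (z - x + y + - 1 *\<^sub>R (z - x)) \<partial>lborel)
       = (\<integral>y. f (x + y) * \<phi> (y + - 1 *\<^sub>R (z - x)) \<partial>lborel)"
      by (rule lborel_translate(2)) measurable
    then show ?thesis by (simp add: conv_def algebra_simps)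
  qed
  have g: "((\<lambda>z. - 1 *\<^sub>R (z - x)) has_derivative (\<lambda>e. - 1 *\<^sub>R e)) (at x)"
    by (auto intro!: derivative_eq_intros)
  have "(conv f \<phi> has_derivative (\<lambda>e. (\<integral>y. f (x + y) *\<^sub>R grad \<phi> y \<partial>lborel) \<bullet> (- 1 *\<^sub>R e))) (at x)"
    unfolding 2[abs_def] by (rule has_derivative_compose[OF g]) (use 1 in simp)
  moreover have "(\<chi> i. conv f (\<lambda>y. - grad \<phi> y $ i) x) = - (\<integral>y. f (x + y) *\<^sub>R grad \<phi> y \<partial>lborel)"
  proof -
    have "(\<integral>y. f (x + y) *\<^sub>R grad \<phi> y \<partial>lborel) $ i = (\<integral>y. f (x + y) * grad \<phi> y $ i \<partial>lborel)" for i
      unfolding cart_eq_inner_axis by (subst integral_inner_left[symmetric]) (use ig in simp_all)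
    then show ?thesis by (simp add: vec_eq_iff conv_def mult.commute)
  qed
  ultimately show ?thesis by (simp add: gderiv_def inner_commute)
qed

lemma conv_Ck:
  assumes "continuous_on UNIV f" "smooth_supported K \<phi>"
  shows "Ck_on k UNIV (conv f \<phi>)"
  using assms(2)
proof (induction k arbitrary: \<phi>)
  case 0
  have "isCont (conv f \<phi>) x" for x
    using conv_has_derivative[OF assms(1) 0, of x] unfolding gderiv_def by (rule has_derivative_continuous)
  then show ?case by (simp add: continuous_at_imp_continuous_on)
next
  case (Suc k)
  have "smooth_supported K (\<lambda>y. - grad \<phi> y $ i)" for i
    using smooth_supported_cmult[OF smooth_supported_grad[OF Suc.prems], of "- 1"] by simp
  then show ?case
    by (intro Ck_on_SucI[OF conv_has_derivative[OF assms(1) Suc.prems]]) (simp add: Suc.IH)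
qed

lemma integral_pos_if_pos_on_ball:
  fixes f :: "real ^ 'n \<Rightarrow> real"
  assumes f: "integrable lborel f" "\<And>x. 0 \<le> f x" and t: "0 < t" and c: "0 < c" "\<And>x. norm (x - z) \<le> t \<Longrightarrow> c \<le> f x"
  shows "0 < (\<integral>x. f x \<partial>lborel)"
proof -
  have "0 < c * measure lborel (cball z t)" using t c(1) content_cball_pos[of t z] by simp
  also have "\<dots> = (\<integral>y. c * indicator (cball z t) y \<partial>lborel)" by simp
  also have "\<dots> \<le> (\<integral>x. f x \<partial>lborel)"
  proof (rule integral_mono[OF _ f(1)])
    show "integrable lborel (\<lambda>y. c * indicator (cball z t) y)"
      by (intro integrable_mult_right integrable_real_indicator) (use emeasure_bounded_finite[of "cball z t"] in auto)
    show "c * indicator (cball z t) y \<le> f y" for y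
      using f(2)[of y] c(2)[of y] by (auto simp: indicator_def dist_norm norm_minus_commute)
  qed
  finally show ?thesis .
qed

definition mollifier :: "real \<Rightarrow> (real ^ 'n \<Rightarrow> real) \<Rightarrow> bool" where
  "mollifier r \<phi> \<longleftrightarrow> smooth_supported (cball 0 r) \<phi> \<and> (\<forall>x. 0 \<le> \<phi> x) \<and> (\<integral>y. \<phi> y \<partial>lborel) = 1"

lemma mollifier_exists:
  assumes r: "0 < r"
  obtains \<phi> :: "real ^ 'n \<Rightarrow> real" where "mollifier r \<phi>"
proof -
  define b where "b x = flat 0 (r\<^sup>2 - x \<bullet> x)" for x :: "real ^ 'n"
  have b: "smooth_supported (cball 0 r) b"
  proof -
    have "b x = 0" if "x \<notin> cball 0 r" for x
    proof -
      have "r\<^sup>2 \<le> (norm x)\<^sup>2" using that r by (intro power_mono) auto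
      then show ?thesis by (simp add: b_def flat_def power2_norm_eq_inner)
    qed
    then show ?thesis unfolding smooth_supported_def b_def by (auto intro: Ck_on_flat)
  qed
  have b0: "0 \<le> b x" for x by (simp add: b_def flat_def)
  have ib: "integrable lborel b"
    by (rule smooth_supported_integrable[OF b])
  \<comment> \<open>On the ball of radius \<open>r / 2\<close> the argument of \<open>flat 0\<close>
    is at least \<open>3 * r\<^sup>2 / 4\<close>.\<close>
  define c where "c = exp (- inverse (3 * r\<^sup>2 / 4))"
  have c: "c \<le> b x" if "x \<in> cball 0 (r / 2)" for x
  proof -
    have "(norm x)\<^sup>2 \<le> (r / 2)\<^sup>2" using that by (intro power_mono) auto
    then have t: "3 * r\<^sup>2 / 4 \<le> r\<^sup>2 - x \<bullet> x" by (simp add: power2_norm_eq_inner power_divide)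
    moreover have "0 < 3 * r\<^sup>2 / 4" using r by simp
    ultimately have "0 < r\<^sup>2 - x \<bullet> x" "inverse (r\<^sup>2 - x \<bullet> x) \<le> inverse (3 * r\<^sup>2 / 4)"
      by (linarith, intro le_imp_inverse_le) auto
    then show ?thesis by (simp add: b_def flat_def c_def exp_minus inverse_eq_divide[of "exp _"] frac_le)
  qed
  define I where "I = (\<integral>y. b y \<partial>lborel)"
  have I: "0 < I"
    unfolding I_def
    by (rule integral_pos_if_pos_on_ball[OF ib b0, of "r / 2" c 0]) (use r c in \<open>auto simp: c_def\<close>)
  have "mollifier r (\<lambda>x. (1 / I) * b x)"
    unfolding mollifier_def using smooth_supported_cmult[OF b, of "1 / I"] I b0
    by (simp add: I_def[symmetric])
  then show thesis by (rule that)
qed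

lemma mollifier_integrable: "mollifier r \<phi> \<Longrightarrow> integrable lborel \<phi>"
  unfolding mollifier_def using smooth_supported_integrable by blast

lemma conv_bound:
  fixes f :: "real ^ 'n \<Rightarrow> 'b::euclidean_space"
  assumes \<phi>: "mollifier r \<phi>" and f: "continuous_on UNIV f"
    and b: "\<And>y. norm y \<le> r \<Longrightarrow> norm (f (x + y) - a) \<le> \<eta>"
  shows "norm (conv f \<phi> x - a) \<le> \<eta>"
proof -
  have s: "smooth_supported (cball 0 r) \<phi>" "\<And>x. 0 \<le> \<phi> x" "(\<integral>y. \<phi> y \<partial>lborel) = 1"
    using \<phi> by (auto simp: mollifier_def)
  note i = conv_integrable[OF f s(1), of x] mollifier_integrable[OF \<phi>]
  have ia: "integrable lborel (\<lambda>y. \<phi> y *\<^sub>R a)" by (rule integrable_scaleR_left) (rule i)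
  have eq: "\<phi> y *\<^sub>R (f (x + y) - a) = \<phi> y *\<^sub>R f (x + y) - \<phi> y *\<^sub>R a" for y by (simp add: scaleR_diff_right)
  have "(\<integral>y. \<phi> y *\<^sub>R a \<partial>lborel) = a"
    using i(2) s(3) by simp
  then have "conv f \<phi> x - a = (\<integral>y. \<phi> y *\<^sub>R (f (x + y) - a) \<partial>lborel)"
    unfolding conv_def eq using i(1) ia by simp
  also have "norm \<dots> \<le> (\<integral>y. norm (\<phi> y *\<^sub>R (f (x + y) - a)) \<partial>lborel)"
    by (rule integral_norm_bound)
  also have "\<dots> \<le> (\<integral>y. \<phi> y * \<eta> \<partial>lborel)"
  proof (rule integral_mono)
    show "integrable lborel (\<lambda>y. norm (\<phi> y *\<^sub>R (f (x + y) - a)))"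
      unfolding eq using i(1) ia by (intro integrable_norm Bochner_Integration.integrable_diff)
    show "integrable lborel (\<lambda>y. \<phi> y * \<eta>)" using i(2) by simp
    show "norm (\<phi> y *\<^sub>R (f (x + y) - a)) \<le> \<phi> y * \<eta>" for y
      using b[of y] s(2)[of y] smooth_supported_outside[OF s(1), of y]
      by (cases "norm y \<le> r") (auto intro: mult_left_mono)
  qed
  also have "\<dots> = \<eta>" using s(3) i(2) by simp
  finally show ?thesis .
qed

section \<open>Smooth approximate subsolutions\<close>

lemma gauss_mean_quadratic:
  fixes M :: "real ^ 'n ^ 'n"
  shows "gauss_integrable_fun (\<lambda>y. y \<bullet> (M *v y))" "gauss_mean (\<lambda>y. y \<bullet> (M *v y)) = trace M"
proof -
  have eq: "y \<bullet> (M *v y) = (\<Sum>i\<in>UNIV. ((M $ i \<bullet> y) *\<^sub>R y) \<bullet> axis i 1)" for y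
    unfolding cart_eq_inner_axis[symmetric]
    by (simp add: inner_vec_def matrix_vector_mult_def mult.commute)
  note i = gauss_integrable_inner[OF gauss_integrable_outer]
  show "gauss_integrable_fun (\<lambda>y. y \<bullet> (M *v y))"
    unfolding eq scaleR_sum_right by (rule Bochner_Integration.integrable_sum) (rule i)
  have "gauss_mean (\<lambda>y. y \<bullet> (M *v y)) = (\<Sum>i\<in>UNIV. gauss_mean (\<lambda>y. ((M $ i \<bullet> y) *\<^sub>R y) \<bullet> axis i 1))"
    unfolding eq gauss_mean_def scaleR_sum_right by (rule Bochner_Integration.integral_sum) (rule i)
  also have "\<dots> = trace M"
    by (simp only: gauss_mean_inner_right[OF gauss_integrable_outer] gauss_mean_outer)
       (simp add: trace_def inner_axis)
  finally show "gauss_mean (\<lambda>y. y \<bullet> (M *v y)) = trace M" .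
qed

lemma gauss_integrable_norm_4: "gauss_integrable_fun (\<lambda>y::real^'n. norm y ^ 4)"
proof (rule gauss_integrable[of _ 1])
  fix y :: "real ^ 'n"
  have "norm y ^ 4 \<le> exp (norm y) ^ 4" by (intro power_mono norm_le_exp) auto
  also have "\<dots> = exp (4 * norm y)" by (simp add: exp_of_nat_mult[symmetric])
  finally show "norm (norm y ^ 4) \<le> 1 * exp (4 * norm y)" by simp
qed measurable

text \<open>The Gaussian mean of the second order expansion of \<open>W\<close> at 0 bounds the flow
  above by \<open>W 0 + t\<^sup>2 / 2 * trace H\<close> up to small terms. Division of both bounds
  by \<open>t\<^sup>2\<close> compares the coefficients.\<close>

lemma trace_ge_if_heat_ge:
  fixes W :: "real ^ 'n \<Rightarrow> real"
  assumes W: "quadratic_remainder C W q" and q: "(q has_derivative (\<lambda>e. H *v e)) (at 0)"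
    and heat: "\<And>t. 0 < t \<Longrightarrow> t \<le> 1 \<Longrightarrow> W 0 - a * t\<^sup>2 - K * t ^ 4 \<le> heat W 0 t"
  shows "- 2 * a \<le> trace H"
proof -
  define n where "n = real CARD('n)"
  have C: "0 \<le> C" by (rule quadratic_remainder_nonneg[OF W])
  have main: "- a \<le> trace H / 2 + \<kappa> * n" if \<kappa>: "0 < \<kappa>" for \<kappa>
  proof -
    obtain \<rho> where \<rho>: "0 < \<rho>" "\<And>k. norm k \<le> \<rho> \<Longrightarrow> W (0 + k) \<le> W 0 + q 0 \<bullet> k + 1 / 2 * (k \<bullet> (H *v k)) + \<kappa> * (norm k)\<^sup>2"
      using second_order_upper[OF quadratic_remainder_has_derivative[OF W] q \<kappa>] by blast
    define N where "N = onorm ((*v) H)"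
    have N: "0 \<le> N" "norm (H *v k) \<le> N * norm k" for k
      unfolding N_def by (auto intro: onorm_pos_le onorm)
    \<comment> \<open>Beyond the radius \<open>\<rho>\<close> of the expansion, quadratic growth is
      majorised by a quartic, whose mean is only of order \<open>t ^ 4\<close>.\<close>
    define M where "M = (C + N / 2) / \<rho>\<^sup>2"
    have M: "0 \<le> M" using C N by (simp add: M_def)
    have taylor: "W k \<le> W 0 + q 0 \<bullet> k + 1 / 2 * (k \<bullet> (H *v k)) + \<kappa> * (norm k)\<^sup>2 + M * norm k ^ 4" for k
    proof (cases "norm k \<le> \<rho>")
      case True
      then show ?thesis using \<rho>(2)[of k] M by (simp add: add_increasing2)
    next
      case False
      have "W k \<le> W 0 + q 0 \<bullet> k + C * (norm k)\<^sup>2" using quadratic_remainder_bound[OF W, of 0 k] by simp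
      moreover have "- (N * (norm k)\<^sup>2) \<le> k \<bullet> (H *v k)"
        using Cauchy_Schwarz_ineq2[of k "H *v k"] mult_left_mono[OF N(2)[of k] norm_ge_zero[of k]]
        by (simp add: power2_eq_square mult_ac)
      moreover have "(C + N / 2) * (norm k)\<^sup>2 \<le> M * norm k ^ 4"
      proof -
        have "\<rho>\<^sup>2 \<le> (norm k)\<^sup>2" using False \<rho>(1) by (intro power_mono) auto
        from mult_left_mono[OF this, of "M * (norm k)\<^sup>2"] M
        have "M * (norm k)\<^sup>2 * \<rho>\<^sup>2 \<le> M * (norm k)\<^sup>2 * (norm k)\<^sup>2" by simp
        then show ?thesis using \<rho>(1) by (simp add: M_def power2_eq_square power4_eq_xxxx mult_ac)
      qed
      moreover have "0 \<le> \<kappa> * (norm k)\<^sup>2" using \<kappa> by simp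
      ultimately show ?thesis by (simp add: distrib_right)
    qed
    define m4 where "m4 = gauss_mean (\<lambda>y::real^'n. norm y ^ 4)"
    define g where "g t y = W 0 + (t *\<^sub>R q 0) \<bullet> y + (t\<^sup>2 / 2) * (y \<bullet> (H *v y)) + (\<kappa> * t\<^sup>2) * (norm y)\<^sup>2 + (M * t ^ 4) * norm y ^ 4" for t y
    have g: "heat W 0 t \<le> W 0 + t\<^sup>2 / 2 * trace H + \<kappa> * t\<^sup>2 * n + M * t ^ 4 * m4" if t: "0 < t" for t
    proof -
      have cm: "gauss_integrable_fun (\<lambda>y. c * f y)" if "gauss_integrable_fun f" for c and f :: "real ^ 'n \<Rightarrow> real"
        using integrable_mult_right[OF that, of c] by (simp add: mult.left_commute)
      have ca: "gauss_integrable_fun (\<lambda>y. f y + h y)" if "gauss_integrable_fun f" "gauss_integrable_fun h" for f h :: "real ^ 'n \<Rightarrow> real"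
        using Bochner_Integration.integrable_add[OF that] by (simp add: distrib_left)
      have i0: "gauss_integrable_fun (\<lambda>y. (t *\<^sub>R q 0) \<bullet> y)"
        using gauss_integrable_inner[OF gauss_integrable_id, of "t *\<^sub>R q 0"] by (simp only: inner_commute)
      note i1 = ca[OF gauss_integrable_const[of "W 0"] i0]
      note i2 = ca[OF i1 cm[OF gauss_mean_quadratic(1)[of H], of "t\<^sup>2 / 2"]]
      note i3 = ca[OF i2 cm[OF gauss_integrable_norm_sq, of "\<kappa> * t\<^sup>2"]]
      note i4 = ca[OF i3 cm[OF gauss_integrable_norm_4, of "M * t ^ 4"]]
      have "gauss_mean (\<lambda>y. (t *\<^sub>R q 0) \<bullet> y) = 0"
        by (simp only: inner_commute[of "t *\<^sub>R q 0"] gauss_mean_inner_right[OF gauss_integrable_id]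
            gauss_mean_id inner_zero_left)
      then have "gauss_mean (g t) = W 0 + t\<^sup>2 / 2 * trace H + \<kappa> * t\<^sup>2 * n + M * t ^ 4 * m4"
        unfolding g_def
        by (simp only: gauss_mean_add[OF i3 cm[OF gauss_integrable_norm_4]]
          gauss_mean_add[OF i2 cm[OF gauss_integrable_norm_sq]] gauss_mean_add[OF i1 cm[OF gauss_mean_quadratic(1)]]
          gauss_mean_add[OF gauss_integrable_const i0] gauss_mean_cmult gauss_mean_quadratic(2) gauss_mean_const
          gauss_mean_norm_sq m4_def n_def)
      moreover have "heat W 0 t \<le> gauss_mean (g t)"
        unfolding heat_def
      proof (rule gauss_mean_mono[OF gauss_integrable_quadratic_remainder[OF W]])
        show "gauss_integrable_fun (g t)" unfolding g_def by (rule i4)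
        show "W (0 + t *\<^sub>R y) \<le> g t y" for y
          using taylor[of "t *\<^sub>R y"] t
          by (simp add: g_def matrix_vector_mult_scaleR power_mult_distrib power2_eq_square[of t] mult_ac)
      qed
      ultimately show ?thesis by simp
    qed
    show ?thesis
    proof (rule le_if_le_add_small)
      fix s :: real assume s: "0 < s" "s \<le> 1"
      \<comment> \<open>In terms of \<open>s = t\<^sup>2\<close> the error left after division is
        linear.\<close>
      define t where "t = sqrt s"
      have t: "0 < t" "t \<le> 1" "t\<^sup>2 = s" using s by (auto simp: t_def)
      have t4: "t ^ 4 = s * s" unfolding t(3)[symmetric] by (simp add: power2_eq_square power4_eq_xxxx)
      have "s * (- a) \<le> s * (trace H / 2 + \<kappa> * n + s * (M * m4 + K))"
        using heat[OF t(1,2)] g[OF t(1)] unfolding t4 t(3) by (simp add: algebra_simps)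
      then show "- a \<le> trace H / 2 + \<kappa> * n + s * (M * m4 + K)"
        by (rule mult_left_le_imp_le) (rule s(1))
    qed
  qed
  have "- a \<le> trace H / 2"
    by (rule le_if_le_add_small[of "- a" "trace H / 2" n]) (rule main)
  then show ?thesis by simp
qed

text \<open>A mean of translates keeps the constant \<open>C\<close>, so the Lipschitz bound for the
  mollified gradient does not depend on the kernel.\<close>

lemma conv_quadratic_remainder:
  fixes w :: "real ^ 'n \<Rightarrow> real"
  assumes w: "quadratic_remainder C w q" and \<phi>: "mollifier r \<phi>"
  shows "quadratic_remainder C (conv w \<phi>) (conv q \<phi>)"
  unfolding quadratic_remainder_def
proof (intro conjI allI)
  show C: "0 \<le> C" using w by (simp add: quadratic_remainder_def)
  have s: "smooth_supported (cball 0 r) \<phi>" "\<And>x. 0 \<le> \<phi> x" "(\<integral>y. \<phi> y \<partial>lborel) = 1"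
    using \<phi> by (auto simp: mollifier_def)
  fix x h
  note iw = conv_integrable[OF quadratic_remainder_continuous(1)[OF w] s(1)]
  note iq = conv_integrable[OF quadratic_remainder_continuous(2)[OF w] s(1), of x]
  have iqh: "integrable lborel (\<lambda>y. (\<phi> y *\<^sub>R q (x + y)) \<bullet> h)" by (rule integrable_inner_left) (rule iq)
  have "conv q \<phi> x \<bullet> h = (\<integral>y. (\<phi> y *\<^sub>R q (x + y)) \<bullet> h \<partial>lborel)"
    unfolding conv_def by (rule integral_inner_left[symmetric]) (rule iq)
  then have "conv w \<phi> (x + h) - conv w \<phi> x - conv q \<phi> x \<bullet> h
      = (\<integral>y. \<phi> y *\<^sub>R w (x + h + y) - \<phi> y *\<^sub>R w (x + y) - (\<phi> y *\<^sub>R q (x + y)) \<bullet> h \<partial>lborel)"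
    unfolding conv_def using iw[of "x + h"] iw[of x] iqh by simp
  also have "\<dots> = (\<integral>y. \<phi> y * (w (x + y + h) - w (x + y) - q (x + y) \<bullet> h) \<partial>lborel)"
    by (rule Bochner_Integration.integral_cong) (simp_all add: algebra_simps)
  also have "\<bar>\<dots>\<bar> \<le> (\<integral>y. \<phi> y * (C * (norm h)\<^sup>2) \<partial>lborel)"
  proof (rule order_trans[OF integral_abs_bound integral_mono])
    have "integrable lborel (\<lambda>y. \<phi> y *\<^sub>R w (x + h + y) - \<phi> y *\<^sub>R w (x + y) - (\<phi> y *\<^sub>R q (x + y)) \<bullet> h)"
      using iw[of "x + h"] iw[of x] iqh by (intro Bochner_Integration.integrable_diff)
    also have "(\<lambda>y. \<phi> y *\<^sub>R w (x + h + y) - \<phi> y *\<^sub>R w (x + y) - (\<phi> y *\<^sub>R q (x + y)) \<bullet> h)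
        = (\<lambda>y. \<phi> y * (w (x + y + h) - w (x + y) - q (x + y) \<bullet> h))"
      by (simp add: fun_eq_iff algebra_simps)
    finally show "integrable lborel (\<lambda>y. \<bar>\<phi> y * (w (x + y + h) - w (x + y) - q (x + y) \<bullet> h)\<bar>)"
      by (rule integrable_abs)
    show "integrable lborel (\<lambda>y. \<phi> y * (C * (norm h)\<^sup>2))" using mollifier_integrable[OF \<phi>] by simp
    show "\<bar>\<phi> y * (w (x + y + h) - w (x + y) - q (x + y) \<bullet> h)\<bar> \<le> \<phi> y * (C * (norm h)\<^sup>2)" for y
      unfolding abs_mult using s(2)[of y] quadratic_remainder_bound[OF w, of "x + y" h] by (simp add: mult_left_mono)
  qed
  also have "\<dots> = C * (norm h)\<^sup>2" using s(3) mollifier_integrable[OF \<phi>] by simp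
  finally show "\<bar>conv w \<phi> (x + h) - conv w \<phi> x - conv q \<phi> x \<bullet> h\<bar> \<le> C * (norm h)\<^sup>2" .
qed

text \<open>All derivatives are placed on the kernel, so the matrix is defined and continuous for a
  continuous \<open>q\<close>.\<close>

definition conv_jacobian :: "(real ^ 'n \<Rightarrow> real ^ 'n) \<Rightarrow> (real ^ 'n \<Rightarrow> real) \<Rightarrow> real ^ 'n \<Rightarrow> real ^ 'n ^ 'n" where
  "conv_jacobian q \<phi> x = (\<chi> i j. conv (\<lambda>y. q y $ i) (\<lambda>y. - grad \<phi> y $ j) x)"

lemma conv_jacobian_has_derivative:
  assumes q: "continuous_on UNIV q" and \<phi>: "smooth_supported K \<phi>"
  shows "(conv q \<phi> has_derivative (\<lambda>e. conv_jacobian q \<phi> x *v e)) (at x)"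
proof -
  have qi: "continuous_on UNIV (\<lambda>y. q y $ i)" for i using q by (rule continuous_on_component)
  have "((\<lambda>x. conv q \<phi> x $ i) has_derivative (\<lambda>e. (conv_jacobian q \<phi> x *v e) $ i)) (at x)" for i
    using conv_has_derivative[OF qi \<phi>, of i x] unfolding gderiv_def
    by (simp add: conv_component[OF q \<phi>] conv_jacobian_def matrix_vector_mult_def inner_vec_def mult.commute)
  then show ?thesis
    unfolding has_derivative_componentwise_within[of "conv q \<phi>"]
    by (auto simp: Basis_vec_def inner_axis)
qed

lemma conv_jacobian_continuous:
  assumes q: "continuous_on UNIV q" and \<phi>: "smooth_supported K \<phi>"
  shows "continuous_on S (conv_jacobian q \<phi>)"
proof -
  have "continuous_on UNIV (\<lambda>x. conv (\<lambda>y. q y $ i) (\<lambda>y. - grad \<phi> y $ j) x)" for i j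
  proof -
    have "smooth_supported K (\<lambda>y. - grad \<phi> y $ j)"
      using smooth_supported_cmult[OF smooth_supported_grad[OF \<phi>], of "- 1"] by simp
    from conv_Ck[OF continuous_on_component[OF q] this, of 0] show ?thesis by simp
  qed
  then have "continuous_on UNIV (conv_jacobian q \<phi>)"
    unfolding conv_jacobian_def[abs_def] by (intro continuous_on_vec_lambda)
  then show ?thesis by (rule continuous_on_subset) simp
qed

text \<open>Flow and mollification are both means over translates and commute by Fubini. The
  quadratic remainder of \<open>w\<close> at \<open>z + k\<close> provides the dominating product of
  a function of \<open>k\<close> and a function of \<open>y\<close>.\<close>

lemma heat_conv:
  fixes w :: "real ^ 'n \<Rightarrow> real" and A :: "real ^ 'n ^ 'n"
  assumes w: "quadratic_remainder C w q" and \<phi>: "mollifier r \<phi>" and A: "transpose A = A"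
    and L: "\<And>v. norm (A *v v) \<le> L * norm v"
  shows "heat (\<lambda>x. conv w \<phi> (z + A *v x)) 0 t = (\<integral>k. \<phi> k * heat (\<lambda>x. w (z + k + A *v x)) 0 t \<partial>lborel)"
    and "integrable lborel (\<lambda>k. \<phi> k * heat (\<lambda>x. w (z + k + A *v x)) 0 t)"
proof -
  have s: "smooth_supported (cball 0 r) \<phi>" "\<And>x. 0 \<le> \<phi> x" using \<phi> by (auto simp: mollifier_def)
  have [measurable]: "\<phi> \<in> borel_measurable borel" "w \<in> borel_measurable borel"
    by (auto intro!: borel_measurable_continuous_onI smooth_supported_continuous[OF s(1)] quadratic_remainder_continuous[OF w])
  have [measurable]: "(\<lambda>y. A *v (t *\<^sub>R y)) \<in> borel_measurable borel"
    by (intro borel_measurable_continuous_onI continuous_intros linear_continuous_on bounded_linear_compose[OF matrix_vector_mul_bounded_linear bounded_linear_scaleR_right])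
  have C: "0 \<le> C" by (rule quadratic_remainder_nonneg[OF w])
  have L0: "0 \<le> L" using order_trans[OF norm_ge_zero L[of "axis undefined 1"]] by simp
  define a where "a k = \<phi> k * (\<bar>w (z + k)\<bar> + norm (q (z + k)) * (L * \<bar>t\<bar>) + C * (L * \<bar>t\<bar>)\<^sup>2)" for k
  define b where "b y = gauss y *\<^sub>R exp (4 * norm y)" for y :: "real ^ 'n"
  define g where "g k y = \<phi> k * (gauss y * w (z + k + A *v (t *\<^sub>R y)))" for k y
  have ia: "integrable lborel a"
  proof -
    have "continuous_on UNIV (\<lambda>k. \<bar>w k\<bar> + norm (q k) * (L * \<bar>t\<bar>) + C * (L * \<bar>t\<bar>)\<^sup>2)"
      by (intro continuous_intros quadratic_remainder_continuous[OF w])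
    from conv_integrable[OF this s(1), of z] show ?thesis by (simp add: a_def[abs_def])
  qed
  have ib: "integrable lborel b" unfolding b_def by (rule gauss_integrable[of _ 1]) auto
  have a0: "0 \<le> a k" for k using s(2) C L0 by (auto simp: a_def intro!: mult_nonneg_nonneg add_nonneg_nonneg)
  have b0: "0 \<le> b y" for y using gauss_pos[of y] by (simp add: b_def)
  have [measurable]: "a \<in> borel_measurable borel" "b \<in> borel_measurable borel"
    using borel_measurable_integrable[OF ia] borel_measurable_integrable[OF ib] by simp_all
  have iab: "integrable (lborel \<Otimes>\<^sub>M lborel) (\<lambda>(k, y). a k * b y)"
  proof (rule lborel_pair.Fubini_integrable)
    show "integrable lborel (\<lambda>k. \<integral>y. norm (case (k, y) of (k, y) \<Rightarrow> a k * b y) \<partial>lborel)"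
      using ia a0 b0 by (simp add: abs_mult)
    show "AE k in lborel. integrable lborel (\<lambda>y. case (k, y) of (k, y) \<Rightarrow> a k * b y)"
      using ib by simp
  qed measurable
  have ig: "integrable (lborel \<Otimes>\<^sub>M lborel) (\<lambda>(k, y). g k y)"
  proof (rule Bochner_Integration.integrable_bound[OF iab])
    show "(\<lambda>(k, y). g k y) \<in> borel_measurable (lborel \<Otimes>\<^sub>M lborel)" unfolding g_def by measurable
    have "\<bar>g k y\<bar> \<le> a k * b y" for k y
    proof -
      define v where "v = A *v (t *\<^sub>R y)"
      have v: "norm v \<le> L * \<bar>t\<bar> * norm y" using L[of "t *\<^sub>R y"] by (simp add: v_def mult.assoc)
      have v2: "(norm v)\<^sup>2 \<le> (L * \<bar>t\<bar>)\<^sup>2 * exp (4 * norm y)"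
      proof -
        have "(norm v)\<^sup>2 \<le> (L * \<bar>t\<bar> * norm y)\<^sup>2" using v by (intro power_mono) auto
        also have "\<dots> \<le> (L * \<bar>t\<bar>)\<^sup>2 * exp (4 * norm y)"
          unfolding power_mult_distrib[of "L * \<bar>t\<bar>"] by (intro mult_left_mono norm_sq_le_exp) simp
        finally show ?thesis .
      qed
      have v1: "norm v \<le> L * \<bar>t\<bar> * exp (4 * norm y)"
        using L0 by (intro order_trans[OF v] mult_left_mono order_trans[OF norm_le_exp exp_le_exp4]) auto
      have "\<bar>w (z + k + v)\<bar> \<le> \<bar>w (z + k)\<bar> + norm (q (z + k)) * norm v + C * (norm v)\<^sup>2"
        using quadratic_remainder_bound[OF w, of "z + k" v] Cauchy_Schwarz_ineq2[of "q (z + k)" v] by linarith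
      also have "\<dots> \<le> \<bar>w (z + k)\<bar> * exp (4 * norm y) + norm (q (z + k)) * (L * \<bar>t\<bar> * exp (4 * norm y))
           + C * ((L * \<bar>t\<bar>)\<^sup>2 * exp (4 * norm y))"
        using C v1 v2 by (intro add_mono mult_left_mono) (auto simp: mult_le_cancel_left1)
      finally have "\<bar>w (z + k + v)\<bar> \<le> (\<bar>w (z + k)\<bar> + norm (q (z + k)) * (L * \<bar>t\<bar>) + C * (L * \<bar>t\<bar>)\<^sup>2) * exp (4 * norm y)"
        by (simp add: algebra_simps)
      from mult_left_mono[OF this, of "\<phi> k * gauss y"] show ?thesis
        using s(2)[of k] gauss_pos[of y] by (simp add: g_def a_def b_def abs_mult v_def mult_ac)
    qed
    then show "AE x in lborel \<Otimes>\<^sub>M lborel. norm (case x of (k, y) \<Rightarrow> g k y) \<le> norm (case x of (k, y) \<Rightarrow> a k * b y)"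
      using a0 b0 by (auto simp: abs_mult)
  qed
  have 1: "(\<integral>y. g k y \<partial>lborel) = \<phi> k * heat (\<lambda>x. w (z + k + A *v x)) 0 t" for k
    by (simp add: g_def heat_def gauss_mean_def)
  have 2: "(\<integral>k. g k y \<partial>lborel) = gauss y * conv w \<phi> (z + A *v (t *\<^sub>R y))" for y
  proof -
    have "g k y = gauss y * (\<phi> k *\<^sub>R w (z + A *v (t *\<^sub>R y) + k))" for k by (simp add: g_def algebra_simps)
    then show ?thesis unfolding conv_def by simp
  qed
  have "(\<integral>y. (\<integral>k. g k y \<partial>lborel) \<partial>lborel) = (\<integral>k. (\<integral>y. g k y \<partial>lborel) \<partial>lborel)"
    using lborel_pair.Fubini_integral[OF ig] .
  then show "heat (\<lambda>x. conv w \<phi> (z + A *v x)) 0 t = (\<integral>k. \<phi> k * heat (\<lambda>x. w (z + k + A *v x)) 0 t \<partial>lborel)"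
    unfolding 1 2 by (simp add: heat_def gauss_mean_def)
  show "integrable lborel (\<lambda>k. \<phi> k * heat (\<lambda>x. w (z + k + A *v x)) 0 t)"
    using lborel_pair.integrable_fst[OF ig] unfolding 1 .
qed

text \<open>Since \<open>P\<close> is the same throughout, the Gaussian lower bound holds at every
  \<open>z + k\<close> with \<open>norm k \<le> r\<close> with equal constants, and averaging over
  \<open>k\<close> preserves it; \<open>trace_ge_if_heat_ge\<close> then reads off the matrix. The
  radius \<open>2 * r\<close> consists of \<open>r\<close> for the shift and \<open>r\<close> for
  the comparison ball.\<close>

lemma mollified_pLaplace:
  fixes w :: "real ^ 'n \<Rightarrow> real"
  assumes p: "1 < p" and P: "P \<noteq> 0" and w: "quadratic_remainder C w q"
    and r: "0 < r" and c: "0 \<le> c" and \<phi>: "mollifier r \<phi>"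
    and sub: "\<And>x X. norm (x - z) < 2 * r \<Longrightarrow> transpose X = X \<Longrightarrow> touches_above w x (q x) X \<Longrightarrow> - c \<le> pLaplace_op p P X"
  shows "- c \<le> pLaplace_op p P (conv_jacobian q \<phi> z)"
proof -
  define A where "A = pLaplace_root p P"
  have A: "transpose A = A" unfolding A_def pLaplace_root_def by (rule transpose_rank_one)
  define L where "L = onorm ((*v) A) + 1"
  have L: "0 < L" "norm (A *v v) \<le> L * norm v" for v
  proof -
    have bl: "bounded_linear ((*v) A)" by simp
    show "0 < L" using onorm_pos_le[OF bl] by (simp add: L_def)
    show "norm (A *v v) \<le> L * norm v"
      using onorm[OF bl, of v] by (simp add: L_def distrib_right add_increasing2)
  qed
  define K where "K = (2 * (C * L\<^sup>2) * real CARD('n) + 1) * real CARD('n) / (2 * (r / L)\<^sup>2)"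
  have s: "smooth_supported (cball 0 r) \<phi>" "\<And>x. 0 \<le> \<phi> x" "(\<integral>y. \<phi> y \<partial>lborel) = 1"
    using \<phi> by (auto simp: mollifier_def)
  note qc = quadratic_remainder_continuous(2)[OF w, of UNIV]
  define H where "H = conv_jacobian q \<phi> z"
  have deriv: "((\<lambda>x. A *v conv q \<phi> (z + A *v x)) has_derivative (\<lambda>e. (A ** H ** A) *v e)) (at 0)"
  proof -
    have 1: "((\<lambda>x. z + A *v x) has_derivative (\<lambda>e. A *v e)) (at 0)"
      by (rule has_derivative_eq_rhs[OF has_derivative_add[OF has_derivative_const
            bounded_linear_imp_has_derivative[OF matrix_vector_mul_bounded_linear]]]) simp
    have "((\<lambda>x. conv q \<phi> (z + A *v x)) has_derivative (\<lambda>e. H *v (A *v e))) (at 0)"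
      by (rule has_derivative_compose[OF 1]) (use conv_jacobian_has_derivative[OF qc s(1), of z] in \<open>simp add: H_def\<close>)
    from bounded_linear.has_derivative[OF matrix_vector_mul_bounded_linear[of A] this]
    show ?thesis by (simp add: matrix_vector_mul_assoc matrix_mul_assoc)
  qed
  have "- 2 * (c / 2) \<le> trace (A ** H ** A)"
  proof (rule trace_ge_if_heat_ge[OF quadratic_remainder_compose[OF conv_quadratic_remainder[OF w \<phi>] A L(2)] deriv])
    fix t :: real assume t: "0 < t" "t \<le> 1"
    note iw = conv_integrable[OF quadratic_remainder_continuous(1)[OF w] s(1), of z]
    have "conv w \<phi> z - c / 2 * t\<^sup>2 - K * t ^ 4 = (\<integral>k. \<phi> k *\<^sub>R w (z + k) - \<phi> k * (c / 2 * t\<^sup>2 + K * t ^ 4) \<partial>lborel)"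
      using iw mollifier_integrable[OF \<phi>] s(3) by (simp add: conv_def)
    also have "\<dots> \<le> (\<integral>k. \<phi> k * heat (\<lambda>x. w (z + k + A *v x)) 0 t \<partial>lborel)"
    proof (rule integral_mono[OF _ heat_conv(2)[OF w \<phi> A L(2)]])
      show "integrable lborel (\<lambda>k. \<phi> k *\<^sub>R w (z + k) - \<phi> k * (c / 2 * t\<^sup>2 + K * t ^ 4))"
        using iw mollifier_integrable[OF \<phi>] by simp
      fix k
      show "\<phi> k *\<^sub>R w (z + k) - \<phi> k * (c / 2 * t\<^sup>2 + K * t ^ 4) \<le> \<phi> k * heat (\<lambda>x. w (z + k + A *v x)) 0 t"
      proof (cases "norm k \<le> r")
        case True
        have "w (z + k) - c / 2 * t\<^sup>2 - K * t ^ 4 \<le> heat (\<lambda>x. w (z + k + A *v x)) 0 t"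
          unfolding K_def A_def
        proof (rule anisotropic_lower_bound[OF p P w r c less_imp_le[OF t(1)] L[unfolded A_def]])
          fix x and X :: "real ^ 'n ^ 'n"
          assume "norm (x - (z + k)) < r" and X: "transpose X = X" "touches_above w x (q x) X"
          then have "norm (x - z) < 2 * r"
            using norm_triangle_ineq[of "x - (z + k)" k] True by simp
          then show "- c \<le> pLaplace_op p P X" using sub X by blast
        qed
        from mult_left_mono[OF this s(2)[of k]] show ?thesis by (simp add: algebra_simps)
      next
        case False
        then show ?thesis using smooth_supported_outside[OF s(1), of k] by simp
      qed
    qed
    also have "\<dots> = heat (\<lambda>x. conv w \<phi> (z + A *v x)) 0 t"
      by (rule heat_conv(1)[OF w \<phi> A L(2), symmetric])
    finally show "conv w \<phi> (z + A *v 0) - c / 2 * t\<^sup>2 - K * t ^ 4 \<le> heat (\<lambda>x. conv w \<phi> (z + A *v x)) 0 t"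
      by simp
  qed
  then show ?thesis unfolding A_def H_def pLaplace_op_trace[OF p] by simp
qed

lemma has_derivative_Lipschitz_bound:
  fixes f :: "'a::euclidean_space \<Rightarrow> 'b::euclidean_space"
  assumes f: "(f has_derivative f') (at x)" and L: "\<And>y. norm (f y - f x) \<le> L * norm (y - x)"
  shows "norm (f' v) \<le> L * norm v"
proof (cases "v = 0")
  case True
  then show ?thesis using has_derivative_bounded_linear[OF f] by (simp add: linear_simps)
next
  case False
  interpret bounded_linear f' by (rule has_derivative_bounded_linear[OF f])
  show ?thesis
  proof (rule le_if_le_add_small)
    fix e :: real assume e: "0 < e" "e \<le> 1"
    obtain d where d: "0 < d" "\<And>y. norm (y - x) < d \<Longrightarrow> norm (f y - f x - f' (y - x)) \<le> e * norm (y - x)"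
      using f e(1) unfolding has_derivative_at_alt by meson
    define s where "s = d / (2 * norm v)"
    have s: "0 < s" "norm (s *\<^sub>R v) < d" using d(1) False by (auto simp: s_def)
    have "norm (f' (s *\<^sub>R v)) \<le> norm (f (x + s *\<^sub>R v) - f x) + norm (f (x + s *\<^sub>R v) - f x - f' (s *\<^sub>R v))"
      using norm_triangle_ineq4[of "f (x + s *\<^sub>R v) - f x" "f (x + s *\<^sub>R v) - f x - f' (s *\<^sub>R v)"] by simp
    also have "\<dots> \<le> L * norm (s *\<^sub>R v) + e * norm (s *\<^sub>R v)"
      using L[of "x + s *\<^sub>R v"] d(2)[of "x + s *\<^sub>R v"] s by (intro add_mono) auto
    finally have "s * norm (f' v) \<le> s * (L * norm v + e * norm v)"
      using s(1) by (simp add: scaleR algebra_simps)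
    then show "norm (f' v) \<le> L * norm v + e * norm v" using s(1) by simp
  qed
qed

text \<open>The operator inequality for \<open>H x\<close> first holds with the gradient frozen at
  \<open>q x\<close>. Replacing \<open>q x\<close> by \<open>Q x\<close> costs little because
  \<open>H\<close> is bounded by \<open>l\<close>, the Lipschitz constant of \<open>q\<close>,
  whatever the mollification radius.\<close>

lemma smooth_approximation:
  fixes u :: "real ^ 'n \<Rightarrow> real"
  assumes p: "1 < p" and \<Omega>: "open \<Omega>" and u: "Ck_on 1 \<Omega> u"
    and nz: "\<And>x. x \<in> \<Omega> \<Longrightarrow> grad u x \<noteq> 0"
    and visc: "feeble_visc_ge0 (pLaplace_op p) \<Omega> u"
    and S: "compact S" "S \<noteq> {}" "S \<subseteq> \<Omega>" and \<eta>: "0 < \<eta>"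
  obtains Q H where "\<And>x. (Q has_derivative (\<lambda>e. H x *v e)) (at x)" "continuous_on UNIV H"
    "\<And>x. x \<in> S \<Longrightarrow> norm (Q x - grad u x) \<le> \<eta>" "\<And>x. x \<in> S \<Longrightarrow> Q x \<noteq> 0"
    "\<And>x. x \<in> S \<Longrightarrow> - \<eta> \<le> pLaplace_op p (Q x) (H x)"
proof -
  obtain w q C R \<kappa> where reg: "0 < C" "0 < R" "0 < \<kappa>"
    "\<And>x h. \<bar>w (x + h) - w x - q x \<bullet> h\<bar> \<le> C * (norm h)\<^sup>2"
    "\<And>x. x \<in> S \<Longrightarrow> norm (q x - grad u x) \<le> \<eta> / 2" "\<And>x. x \<in> S \<Longrightarrow> q x \<noteq> 0"
    "\<And>x x' X P. \<lbrakk>x \<in> S; norm (x' - x) \<le> R; transpose X = X; touches_above w x' (q x') X; norm (P - q x') \<le> \<kappa>\<rbrakk>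
        \<Longrightarrow> - (\<eta> / 2) \<le> pLaplace_op p P X"
    using sup_inf_regularisation[OF p \<Omega> u nz visc S, of "\<eta> / 2"] \<eta> by (metis half_gt_zero)
  have w: "quadratic_remainder C w q" using reg(1,4) by (simp add: quadratic_remainder_def)
  note qc = quadratic_remainder_continuous(2)[OF w]
  obtain xm where xm: "xm \<in> S" "\<And>x. x \<in> S \<Longrightarrow> norm (q xm) \<le> norm (q x)"
    using continuous_attains_inf[OF S(1,2) continuous_on_norm[OF qc]] by auto
  obtain B where B: "0 < B" "\<And>x. x \<in> S \<Longrightarrow> norm (q x) \<le> B"
    using compact_imp_bounded[OF compact_continuous_image[OF qc S(1)]] by (force simp: bounded_pos)
  define m where "m = norm (q xm)"
  have m: "0 < m" using reg(6)[OF xm(1)] by (simp add: m_def)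
  define l where "l = 6 * C"
  have l: "0 < l" using reg(1) by (simp add: l_def)
  define G where "G = (\<bar>p - 2\<bar> + real CARD('n)) * l * (2 * B + 1)"
  have G: "0 < G" using l B by (auto simp: G_def intro!: mult_pos_pos add_nonneg_pos)
  \<comment> \<open>These bounds keep \<open>Q\<close> away from zero, close to
    \<open>grad u\<close> and inside the range of admissible frozen gradients, and make the final
    change of gradient cost at most \<open>\<eta> / 2\<close>.\<close>
  define s where "s = min (min (m / 2) (\<eta> / 2)) (min (min \<kappa> 1) (\<eta> / (2 * G)))"
  have s: "0 < s" "s \<le> m / 2" "s \<le> \<eta> / 2" "s \<le> \<kappa>" "s \<le> 1" "s \<le> \<eta> / (2 * G)"
    using m \<eta> reg(3) G by (auto simp: s_def)
  have sG: "G * s \<le> \<eta> / 2" using s(6) G by (simp add: field_simps)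
  \<comment> \<open>On a ball of radius \<open>2 * r\<close> the field \<open>q\<close> varies by at
    most \<open>s\<close>, so one frozen gradient serves the whole ball.\<close>
  define r where "r = min (R / 2) (s / (2 * l))"
  have r: "0 < r" "2 * r \<le> R" "l * (2 * r) \<le> s"
  proof -
    show "0 < r" "2 * r \<le> R" using reg(2) s l by (auto simp: r_def)
    have "r \<le> s / (2 * l)" by (simp add: r_def)
    then show "l * (2 * r) \<le> s" using l by (simp add: field_simps)
  qed
  obtain \<phi> :: "real ^ 'n \<Rightarrow> real" where \<phi>: "mollifier r \<phi>" using mollifier_exists[OF r(1)] .
  have sm: "smooth_supported (cball 0 r) \<phi>" using \<phi> by (simp add: mollifier_def)
  define Q where "Q = conv q \<phi>"
  define H where "H = conv_jacobian q \<phi>"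
  have QH: "(Q has_derivative (\<lambda>e. H x *v e)) (at x)" for x
    unfolding Q_def H_def by (rule conv_jacobian_has_derivative[OF qc sm])
  have Qq: "norm (Q x - q x) \<le> s" for x
    unfolding Q_def
  proof (rule conv_bound[OF \<phi> qc])
    fix y :: "real ^ 'n" assume y: "norm y \<le> r"
    have "norm (q (x + y) - q x) \<le> l * norm y"
      using quadratic_remainder_Lipschitz[OF w, of "x + y" x] by (simp add: l_def)
    also have "\<dots> \<le> l * (2 * r)" using y l r by (intro mult_left_mono) auto
    finally show "norm (q (x + y) - q x) \<le> s" using r by linarith
  qed
  have Hb: "norm (H x *v v) \<le> l * norm v" for x v
    using has_derivative_Lipschitz_bound[OF QH[of x], of l v]
      quadratic_remainder_Lipschitz[OF conv_quadratic_remainder[OF w \<phi>]] by (simp add: Q_def l_def)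
  show thesis
  proof (rule that[of Q H, OF QH])
    show "continuous_on UNIV H" unfolding H_def by (rule conv_jacobian_continuous[OF qc sm])
    fix x assume x: "x \<in> S"
    show "norm (Q x - grad u x) \<le> \<eta>"
      using norm_triangle_ineq[of "Q x - q x" "q x - grad u x"] Qq[of x] reg(5)[OF x] s(3) by simp
    show "Q x \<noteq> 0"
      using norm_triangle_ineq2[of "q x" "Q x"] Qq[of x] xm(2)[OF x] s(2) m
      by (auto simp: m_def[symmetric] norm_minus_commute)
    have "- (\<eta> / 2) \<le> pLaplace_op p (q x) (H x)"
      unfolding H_def
    proof (rule mollified_pLaplace[OF p reg(6)[OF x] w r(1) _ \<phi>])
      fix x' and X :: "real ^ 'n ^ 'n"
      assume x': "norm (x' - x) < 2 * r" and X: "transpose X = X" "touches_above w x' (q x') X"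
      have "norm (q x - q x') \<le> l * norm (x' - x)"
        using quadratic_remainder_Lipschitz[OF w, of x x'] by (simp add: l_def norm_minus_commute)
      also have "\<dots> \<le> l * (2 * r)" using x' l by (intro mult_left_mono) auto
      finally have "norm (q x - q x') \<le> \<kappa>" using r(3) s(4) by linarith
      then show "- (\<eta> / 2) \<le> pLaplace_op p (q x) X"
        using reg(7)[OF x _ X] x' r(2) by simp
    qed (use \<eta> in simp)
    moreover have "\<bar>pLaplace_op p (Q x) (H x) - pLaplace_op p (q x) (H x)\<bar> \<le> \<eta> / 2"
    proof -
      have "\<bar>pLaplace_op p (Q x) (H x) - pLaplace_op p (q x) (H x)\<bar>
          \<le> (\<bar>p - 2\<bar> + CARD('n)) * l * norm (Q x - q x) * (norm (Q x) + norm (q x))"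
        by (rule pLaplace_op_diff_le) (rule Hb)
      also have "\<dots> \<le> (\<bar>p - 2\<bar> + CARD('n)) * l * s * (2 * B + 1)"
      proof -
        have "norm (Q x) \<le> B + 1" using B(2)[OF x] Qq[of x] s(5) norm_triangle_ineq2[of "Q x" "q x"] by linarith
        then show ?thesis using B(2)[OF x] l Qq[of x] s(1) by (intro mult_mono) auto
      qed
      also have "\<dots> = G * s" by (simp add: G_def)
      finally show ?thesis using sG by linarith
    qed
    ultimately show "- \<eta> \<le> pLaplace_op p (Q x) (H x)" by linarith
  qed
qed

section \<open>Viscosity subsolutions are weak subsolutions\<close>

definition pflux :: "real \<Rightarrow> real ^ 'n \<Rightarrow> real ^ 'n" where
  "pflux p P = norm P powr (p - 2) *\<^sub>R P"

lemma norm_pflux: "norm (pflux p P) = norm P powr (p - 1)"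
  by (cases "P = 0") (simp_all add: pflux_def powr_mult_base[symmetric] powr_diff power2_eq_square)

lemma pflux_has_derivative:
  assumes P: "P \<noteq> 0"
  shows "(pflux p has_derivative
    (\<lambda>h. norm P powr (p - 2) *\<^sub>R h + ((p - 2) * norm P powr (p - 4) * (P \<bullet> h)) *\<^sub>R P)) (at P)"
proof -
  have N: "0 < norm P" using P by simp
  have "((\<lambda>z. z powr (p - 2)) has_derivative (*) ((p - 2) * norm P powr (p - 2 - 1))) (at (norm P))"
    using has_real_derivative_powr[OF N, of "p - 2"] by (simp add: has_field_derivative_def)
  from has_derivative_compose[OF has_derivative_norm[OF P] this]
  have 1: "((\<lambda>P. norm P powr (p - 2)) has_derivative (\<lambda>h. (p - 2) * norm P powr (p - 2 - 1) * (sgn P \<bullet> h))) (at P)"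
    by (simp only: inner_commute[of "sgn P"])
  have "norm P powr (p - 2 - 1) / norm P = norm P powr (p - 4)"
    using N powr_diff[of "norm P" "p - 3" 1] by simp
  moreover have "norm P powr (p - 2 - 1) * (sgn P \<bullet> h) = norm P powr (p - 2 - 1) / norm P * (P \<bullet> h)" for h
    by (simp add: sgn_div_norm divide_inverse mult_ac)
  ultimately have 2: "(p - 2) * norm P powr (p - 2 - 1) * (sgn P \<bullet> h) = (p - 2) * norm P powr (p - 4) * (P \<bullet> h)" for h
    by (simp only: mult.assoc)
  show ?thesis
    using has_derivative_scaleR[OF 1 has_derivative_ident] unfolding 2 pflux_def[abs_def] by simp
qed

lemma isCont_pflux: "P \<noteq> 0 \<Longrightarrow> isCont (pflux p) P"
  using pflux_has_derivative has_derivative_continuous by blast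

lemma continuous_on_pflux:
  "continuous_on S Q \<Longrightarrow> (\<And>x. x \<in> S \<Longrightarrow> Q x \<noteq> 0) \<Longrightarrow> continuous_on S (\<lambda>x. pflux p (Q x))"
  unfolding pflux_def by (intro continuous_intros) auto

text \<open>Difference quotients integrate to zero by translation invariance, and dominated
  convergence passes to \<open>g'\<close>; the same limit shows that \<open>g'\<close> is
  measurable.\<close>

lemma integral_directional_derivative:
  fixes g g' :: "real ^ 'n \<Rightarrow> real"
  assumes d: "\<And>x. ((\<lambda>s. g (x + s *\<^sub>R e)) has_real_derivative g' x) (at 0)"
    and b: "\<And>x. \<bar>g' x\<bar> \<le> B" and K: "compact K" and g0: "\<And>x. x \<notin> K \<Longrightarrow> g x = 0"
    and c: "continuous_on UNIV g"
  shows "integrable lborel g'" "(\<integral>x. g' x \<partial>lborel) = 0"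
proof -
  have [measurable]: "g \<in> borel_measurable borel" by (rule borel_measurable_continuous_onI[OF c])
  have ig: "integrable lborel g" by (rule integrable_compact_support[OF c K g0])
  have B: "0 \<le> B" using b[of 0] by simp
  obtain R where R: "\<And>x. x \<in> K \<Longrightarrow> norm x \<le> R" using K compact_imp_bounded bounded_iff by metis
  define h where "h k = 1 / real (Suc k)" for k
  have h: "0 < h k" "h k \<le> 1" for k by (auto simp: h_def)
  define D where "D k x = (g (x + h k *\<^sub>R e) - g x) / h k" for k x
  have lip: "\<bar>g (x + s *\<^sub>R e) - g x\<bar> \<le> B * s" if "0 < s" for x s
  proof -
    have "((\<lambda>s. g (x + s *\<^sub>R e)) has_real_derivative g' (x + s0 *\<^sub>R e)) (at s0)" for s0
    proof -
      have "((\<lambda>s. g (x + (s + s0) *\<^sub>R e)) has_real_derivative g' (x + s0 *\<^sub>R e)) (at 0)"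
        using d[of "x + s0 *\<^sub>R e"] by (simp add: algebra_simps)
      then show ?thesis using DERIV_shift[of "\<lambda>s. g (x + s *\<^sub>R e)" "g' (x + s0 *\<^sub>R e)" 0 s0] by simp
    qed
    then have "norm (g (x + s *\<^sub>R e) - g (x + 0 *\<^sub>R e)) \<le> B * norm (s - 0)"
      using field_differentiable_bound[of UNIV "\<lambda>s. g (x + s *\<^sub>R e)" "\<lambda>s. g' (x + s *\<^sub>R e)" B s 0] b by simp
    then show ?thesis using that by simp
  qed
  have lim: "(\<lambda>k. D k x) \<longlonglongrightarrow> g' x" for x
  proof -
    have "((\<lambda>s. (g (x + (0 + s) *\<^sub>R e) - g (x + 0 *\<^sub>R e)) / s) \<longlongrightarrow> g' x) (at 0)"
      using d[of x] unfolding DERIV_def by simp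
    moreover have "filterlim h (at 0) sequentially"
      unfolding filterlim_at h_def using LIMSEQ_inverse_real_of_nat by (simp add: inverse_eq_divide)
    ultimately show ?thesis unfolding D_def by (auto dest: filterlim_compose)
  qed
  have Dm [measurable]: "D k \<in> borel_measurable borel" for k unfolding D_def by measurable
  have g'm: "g' \<in> borel_measurable borel" by (rule borel_measurable_LIMSEQ_real[OF lim Dm])
  define w where "w x = B * indicator (cball 0 (R + norm e)) x" for x :: "real ^ 'n"
  have iw: "integrable lborel w" unfolding w_def
    by (intro integrable_mult_right integrable_real_indicator) (use emeasure_bounded_finite[of "cball (0::real^'n) (R + norm e)"] in auto)
  have Dw: "norm (D k x) \<le> w x" for k x
  proof (cases "norm x \<le> R + norm e")
    case True
    then show ?thesis using lip[OF h(1), of x k] h(1)[of k] by (simp add: w_def D_def field_simps)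
  next
    case False
    have hk: "norm (h k *\<^sub>R e) \<le> norm e" using h[of k] by (simp add: mult_left_le_one_le)
    have "R < norm (x + h k *\<^sub>R e)" using norm_triangle_ineq2[of x "- (h k *\<^sub>R e)"] hk False by simp
    moreover have "R < norm x" using False norm_ge_zero[of e] by linarith
    ultimately have "x \<notin> K" "x + h k *\<^sub>R e \<notin> K" using R by force+
    then show ?thesis using g0 B by (simp add: D_def w_def)
  qed
  show "integrable lborel g'"
    by (rule integrable_dominated_convergence[where s = D and w = w]) (use lim Dw iw g'm Dm in auto)
  have "(\<lambda>k. \<integral>x. D k x \<partial>lborel) \<longlonglongrightarrow> (\<integral>x. g' x \<partial>lborel)"
    by (rule integral_dominated_convergence[where w = w]) (use lim Dw iw g'm Dm in auto)
  moreover have "(\<integral>x. D k x \<partial>lborel) = 0" for k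
    using lborel_translate[of g "h k *\<^sub>R e"] ig by (simp add: D_def add.commute)
  ultimately show "(\<integral>x. g' x \<partial>lborel) = 0" by (simp add: LIMSEQ_const_iff)
qed

lemma integrable_indicator_compact:
  fixes f :: "real ^ 'n \<Rightarrow> real"
  assumes "compact S" "continuous_on S f"
  shows "integrable lborel (\<lambda>x. indicator S x * f x)"
  using borel_integrable_compact[OF assms] by simp

text \<open>By \<open>pflux_has_derivative\<close> the divergence of the flux of \<open>Q\<close> is
  \<open>norm (Q x) powr (p - 4)\<close> times the operator. The coordinate derivatives of the
  components of \<open>v *\<^sub>R pflux p (Q x)\<close> integrate to zero.\<close>

lemma pflux_integration_by_parts:
  fixes v :: "real ^ 'n \<Rightarrow> real" and g Q :: "real ^ 'n \<Rightarrow> real ^ 'n" and H :: "real ^ 'n \<Rightarrow> real ^ 'n ^ 'n"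
  assumes S: "compact S" and v: "\<And>x. (v has_derivative (\<lambda>e. g x \<bullet> e)) (at x)" and g: "continuous_on UNIV g"
    and v0: "\<And>x. x \<notin> S \<Longrightarrow> v x = 0"
    and Q: "\<And>x. x \<in> S \<Longrightarrow> (Q has_derivative (\<lambda>e. H x *v e)) (at x)" and H: "continuous_on S H"
    and nz: "\<And>x. x \<in> S \<Longrightarrow> Q x \<noteq> 0"
  shows "(\<integral>x. indicator S x * (pflux p (Q x) \<bullet> g x) \<partial>lborel)
      = - (\<integral>x. indicator S x * (v x * (norm (Q x) powr (p - 4) * pLaplace_op p (Q x) (H x))) \<partial>lborel)"
proof -
  have cQ: "continuous_on S Q" using Q by (meson continuous_at_imp_continuous_on has_derivative_continuous)
  have cv: "continuous_on A v" for A using v by (meson continuous_at_imp_continuous_on has_derivative_continuous)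
  have cg: "continuous_on S g" using g by (rule continuous_on_subset) simp
  have cf: "continuous_on S (\<lambda>x. pflux p (Q x))" by (rule continuous_on_pflux[OF cQ nz])
  have g0: "g x = 0" if "x \<notin> S" for x
  proof -
    have "GDERIV v x :> g x" using v[of x] by (simp add: gderiv_def inner_commute)
    then have "g x = grad v x" by (rule grad_eqI[symmetric])
    also have "\<dots> = 0" by (rule grad_zero_outside[OF compact_imp_closed[OF S] v0 that])
    finally show ?thesis .
  qed
  define V where "V x = v x *\<^sub>R pflux p (Q x)" for x
  \<comment> \<open>Outside \<open>S\<close> the field \<open>Q\<close> may vanish or fail to be
    differentiable. There \<open>V\<close> is zero on an open set, so its derivative is
    zero.\<close>
  define V' where "V' x e = (if x \<in> S then v x *\<^sub>R (norm (Q x) powr (p - 2) *\<^sub>R (H x *v e)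
      + ((p - 2) * norm (Q x) powr (p - 4) * (Q x \<bullet> (H x *v e))) *\<^sub>R Q x) + (g x \<bullet> e) *\<^sub>R pflux p (Q x) else 0)" for x e
  have V: "(V has_derivative V' x) (at x)" for x
  proof (cases "x \<in> S")
    case True
    have "((\<lambda>x. pflux p (Q x)) has_derivative (\<lambda>e. norm (Q x) powr (p - 2) *\<^sub>R (H x *v e)
      + ((p - 2) * norm (Q x) powr (p - 4) * (Q x \<bullet> (H x *v e))) *\<^sub>R Q x)) (at x)"
      by (rule has_derivative_compose[OF Q[OF True] pflux_has_derivative[OF nz[OF True]]])
    from has_derivative_scaleR[OF v this] show ?thesis
      unfolding V_def[abs_def] V'_def using True by simp
  next
    case False
    have "((\<lambda>x. 0) has_derivative (\<lambda>h. 0)) (at x)" by simp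
    then have "(V has_derivative (\<lambda>h. 0)) (at x)"
      by (rule has_derivative_transform_within_open[of _ _ _ _ "- S"])
         (use False v0 compact_imp_closed[OF S] in \<open>auto simp: V_def\<close>)
    then show ?thesis using False by (simp add: V'_def[abs_def])
  qed
  have cV: "continuous_on UNIV V" using V by (meson continuous_at_imp_continuous_on has_derivative_continuous)
  define a where "a i x = V' x (axis i 1) $ i" for i x
  have comp: "integrable lborel (a i)" "(\<integral>x. a i x \<partial>lborel) = 0" for i
  proof -
    have cH: "continuous_on S (\<lambda>x. H x *v axis i 1)"
      unfolding matrix_vector_mult_basis column_def
      by (intro continuous_on_vec_lambda continuous_on_component H)
    have "continuous_on S (\<lambda>x. (v x *\<^sub>R (norm (Q x) powr (p - 2) *\<^sub>R (H x *v axis i 1)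
      + ((p - 2) * norm (Q x) powr (p - 4) * (Q x \<bullet> (H x *v axis i 1))) *\<^sub>R Q x) + (g x \<bullet> axis i 1) *\<^sub>R pflux p (Q x)) $ i)"
      by (intro continuous_on_component continuous_intros cv cQ cg cf cH) (use nz in auto)
    then have "continuous_on S (a i)" by (rule continuous_on_eq) (simp add: a_def V'_def)
    then have "bounded (a i ` S)" by (intro compact_imp_bounded compact_continuous_image S)
    then obtain B where "0 < B" "\<forall>x\<in>S. \<bar>a i x\<bar> \<le> B" by (auto simp: bounded_pos)
    then have B: "\<bar>a i x\<bar> \<le> B" for x by (cases "x \<in> S") (auto simp: a_def V'_def)
    have d: "((\<lambda>s. V (x + s *\<^sub>R axis i 1) $ i) has_real_derivative a i x) (at 0)" for x
    proof -
      have "((\<lambda>s. x + s *\<^sub>R axis i 1) has_derivative (\<lambda>s. s *\<^sub>R axis i 1)) (at (0::real))"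
        by (auto intro!: derivative_eq_intros)
      then have "((\<lambda>s. V (x + s *\<^sub>R axis i 1)) has_derivative (\<lambda>s. V' x (s *\<^sub>R axis i 1))) (at 0)"
        by (rule has_derivative_compose) (use V[of x] in simp)
      from bounded_linear.has_derivative[OF bounded_linear_vec_nth[of i] this]
      have "((\<lambda>s. V (x + s *\<^sub>R axis i 1) $ i) has_derivative (\<lambda>s. V' x (s *\<^sub>R axis i 1) $ i)) (at 0)" .
      moreover have "V' x (s *\<^sub>R axis i 1) = s *\<^sub>R V' x (axis i 1)" for s
        using has_derivative_bounded_linear[OF V[of x]] by (rule linear_cmul[OF bounded_linear.linear])
      ultimately show ?thesis by (simp add: has_field_derivative_def a_def mult_commute_abs)
    qed
    have "V x $ i = 0" if "x \<notin> S" for x using v0[OF that] by (simp add: V_def)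
    note * = integral_directional_derivative[OF d B S this continuous_on_component[OF cV]]
    show "integrable lborel (a i)" "(\<integral>x. a i x \<partial>lborel) = 0" using * by auto
  qed
  define f1 where "f1 x = pflux p (Q x) \<bullet> g x" for x
  define f2 where "f2 x = v x * (norm (Q x) powr (p - 4) * pLaplace_op p (Q x) (H x))" for x
  have sum: "(\<Sum>i\<in>UNIV. a i x) = indicator S x * f1 x + indicator S x * f2 x" for x
  proof (cases "x \<in> S")
    case True
    define N where "N = norm (Q x)"
    have N: "0 < N" using nz[OF True] by (simp add: N_def)
    have "(\<Sum>i\<in>UNIV. Q x \<bullet> (H x *v axis i 1) * Q x $ i) = Q x \<bullet> (H x *v Q x)"
    proof -
      have "H x *v Q x = H x *v (\<Sum>i\<in>UNIV. Q x $ i *\<^sub>R axis i 1)"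
        using basis_expansion[of "Q x"] by (simp add: scalar_mult_eq_scaleR)
      then show ?thesis
        by (simp add: linear_sum[OF matrix_vector_mul_linear] matrix_vector_mult_scaleR inner_sum_right mult.commute)
    qed
    moreover have "(\<Sum>i\<in>UNIV. (H x *v axis i 1) $ i) = trace (H x)"
      by (simp add: trace_def matrix_vector_mult_basis column_def)
    moreover have "(\<Sum>i\<in>UNIV. (g x \<bullet> axis i 1) * pflux p (Q x) $ i) = f1 x"
      unfolding cart_eq_inner_axis[symmetric] by (simp add: f1_def inner_vec_def mult.commute)
    moreover have "(\<Sum>i\<in>UNIV. a i x) = v x * (N powr (p - 2) * (\<Sum>i\<in>UNIV. (H x *v axis i 1) $ i)
        + (p - 2) * N powr (p - 4) * (\<Sum>i\<in>UNIV. Q x \<bullet> (H x *v axis i 1) * Q x $ i))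
        + (\<Sum>i\<in>UNIV. (g x \<bullet> axis i 1) * pflux p (Q x) $ i)"
      using True by (simp add: a_def V'_def N_def sum.distrib sum_distrib_left mult_ac distrib_left)
    moreover have "N powr (p - 2) = N powr (p - 4) * N\<^sup>2"
      using N powr_add[of N "p - 4" 2] by simp
    ultimately show ?thesis
      using True by (simp add: f2_def pLaplace_op_eq N_def algebra_simps)
  next
    case False
    then show ?thesis by (simp add: a_def V'_def)
  qed
  have i1: "integrable lborel (\<lambda>x. indicator S x * f1 x)"
    unfolding f1_def by (intro integrable_indicator_compact S continuous_on_inner cf cg)
  have "integrable lborel (\<lambda>x. \<Sum>i\<in>UNIV. a i x)" by (intro Bochner_Integration.integrable_sum comp)
  then have "integrable lborel (\<lambda>x. (\<Sum>i\<in>UNIV. a i x) - indicator S x * f1 x)"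
    by (rule Bochner_Integration.integrable_diff[OF _ i1])
  then have i2: "integrable lborel (\<lambda>x. indicator S x * f2 x)" unfolding sum by simp
  have "(\<integral>x. (\<Sum>i\<in>UNIV. a i x) \<partial>lborel) = 0"
    by (subst Bochner_Integration.integral_sum) (simp_all add: comp)
  then have "(\<integral>x. indicator S x * f1 x \<partial>lborel) + (\<integral>x. indicator S x * f2 x \<partial>lborel) = 0"
    unfolding sum using i1 i2 by simp
  then show ?thesis unfolding f1_def f2_def by linarith
qed

lemma weak_integral_eq:
  fixes G g :: "real ^ 'n \<Rightarrow> real ^ 'n"
  assumes S: "compact S" "S \<subseteq> \<Omega>" and G: "continuous_on S G" and g: "continuous_on S g"
    and g0: "\<And>x. x \<notin> S \<Longrightarrow> g x = 0"
  shows "(LINT x:\<Omega>|lebesgue. G x \<bullet> g x) = (\<integral>x. indicator S x * (G x \<bullet> g x) \<partial>lborel)"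
proof -
  have eq: "indicator \<Omega> x *\<^sub>R (G x \<bullet> g x) = indicator S x *\<^sub>R (G x \<bullet> g x)" for x
    using S(2) g0[of x] by (auto simp: indicator_def)
  have "(\<lambda>x. indicator S x *\<^sub>R (G x \<bullet> g x)) \<in> borel_measurable borel"
    by (intro borel_measurable_continuous_on_indicator continuous_on_inner G g borel_compact S)
  then have "(\<lambda>x. indicator S x *\<^sub>R (G x \<bullet> g x)) \<in> borel_measurable lborel" by simp
  from integral_completion[OF this] show ?thesis
    unfolding set_lebesgue_integral_def eq by simp
qed

text \<open>The sum covers both signs of the exponent.\<close>

lemma powr_le_between:
  fixes a t b r :: real
  assumes "0 < a" "a \<le> t" "t \<le> b"
  shows "t powr r \<le> a powr r + b powr r"
proof (cases "0 \<le> r")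
  case True
  then have "t powr r \<le> b powr r" using assms by (intro powr_mono2) auto
  then show ?thesis by (simp add: add_increasing)
next
  case False
  then have "t powr r \<le> a powr r" using assms by (intro powr_mono2') auto
  then show ?thesis by (simp add: add_increasing2)
qed

lemma weak_if_visc:
  fixes u :: "real ^ 'n \<Rightarrow> real"
  assumes p: "1 < p" and \<Omega>: "open \<Omega>" and u: "Ck_on 1 \<Omega> u"
    and nz: "\<And>x. x \<in> \<Omega> \<Longrightarrow> grad u x \<noteq> 0"
    and visc: "feeble_visc_ge0 (pLaplace_op p) \<Omega> u"
  shows "weak_pLaplace_ge0 p \<Omega> u"
  unfolding weak_pLaplace_ge0_def
proof (intro ballI impI)
  fix \<phi> assume \<phi>: "\<phi> \<in> test_functions \<Omega>" and pos: "\<forall>x. 0 \<le> \<phi> x"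
  define S where "S = closure {x. \<phi> x \<noteq> 0}"
  have S: "compact S" "S \<subseteq> \<Omega>" using \<phi> by (auto simp: S_def test_functions_def)
  have "\<phi> x = 0" if "x \<notin> S" for x using that closure_subset[of "{x. \<phi> x \<noteq> 0}"] by (auto simp: S_def)
  then have sm: "smooth_supported S \<phi>" using \<phi> S by (auto simp: smooth_supported_def test_functions_def)
  have gc: "continuous_on A (grad \<phi>)" for A
    using smooth_supported_continuous[OF smooth_supported_grad[OF sm]]
      continuous_on_vec_lambda[of A "\<lambda>i x. grad \<phi> x $ i"] by simp
  have g0: "grad \<phi> x = 0" if "x \<notin> S" for x
    using smooth_supported_outside[OF smooth_supported_grad[OF sm] that] by (simp add: vec_eq_iff)
  have gd: "(\<phi> has_derivative (\<lambda>e. grad \<phi> x \<bullet> e)) (at x)" for x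
    using smooth_supported_gderiv[OF sm, of x] by (simp add: gderiv_def inner_commute)
  have uc: "continuous_on S (grad u)" using u S(2) unfolding Ck_on_1_iff by (auto intro: continuous_on_subset)
  have unz: "\<And>x. x \<in> S \<Longrightarrow> grad u x \<noteq> 0" using nz S(2) by blast
  have "(LINT x:\<Omega>|lebesgue. pflux p (grad u x) \<bullet> grad \<phi> x) = (\<integral>x. indicator S x * (pflux p (grad u x) \<bullet> grad \<phi> x) \<partial>lborel)"
    by (rule weak_integral_eq[OF S continuous_on_pflux[OF uc unz] gc g0])
  also have "\<dots> \<le> 0"
  proof (cases "S = {}")
    case False
    obtain xm where xm: "xm \<in> S" "\<And>x. x \<in> S \<Longrightarrow> norm (grad u xm) \<le> norm (grad u x)"
      using continuous_attains_inf[OF S(1) False continuous_on_norm[OF uc]] by auto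
    obtain B where B: "0 < B" "\<And>x. x \<in> S \<Longrightarrow> norm (grad u x) \<le> B"
      using compact_imp_bounded[OF compact_continuous_image[OF uc S(1)]] by (force simp: bounded_pos)
    define m where "m = norm (grad u xm)"
    have m: "0 < m" using unz[OF xm(1)] by (simp add: m_def)
    \<comment> \<open>Staying below \<open>m / 2\<close> keeps all approximating gradients away from
      zero uniformly, so negative powers of their norms remain bounded.\<close>
    define \<eta> where "\<eta> k = min (min (m / 2) 1) (1 / real (Suc k))" for k
    have \<eta>: "0 < \<eta> k" "\<eta> k \<le> m / 2" "\<eta> k \<le> 1" for k using m by (auto simp: \<eta>_def)
    have \<eta>0: "\<eta> \<longlonglongrightarrow> 0"
    proof (rule tendsto_sandwich[OF _ _ tendsto_const])
      show "(\<lambda>k. 1 / real (Suc k)) \<longlonglongrightarrow> 0" using LIMSEQ_inverse_real_of_nat by (simp add: inverse_eq_divide)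
      show "\<forall>\<^sub>F k in sequentially. 0 \<le> \<eta> k" by (rule always_eventually) (use \<eta>(1) in \<open>auto intro: less_imp_le\<close>)
      show "\<forall>\<^sub>F k in sequentially. \<eta> k \<le> 1 / real (Suc k)" by (rule always_eventually) (simp add: \<eta>_def)
    qed
    have "\<forall>k. \<exists>Q H. (\<forall>x. (Q has_derivative (\<lambda>e. H x *v e)) (at x)) \<and> continuous_on UNIV H \<and>
        (\<forall>x\<in>S. norm (Q x - grad u x) \<le> \<eta> k) \<and> (\<forall>x\<in>S. Q x \<noteq> 0) \<and> (\<forall>x\<in>S. - \<eta> k \<le> pLaplace_op p (Q x) (H x))"
    proof
      fix k
      obtain Q H where "\<And>x. (Q has_derivative (\<lambda>e. H x *v e)) (at x)" "continuous_on UNIV H"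
        "\<And>x. x \<in> S \<Longrightarrow> norm (Q x - grad u x) \<le> \<eta> k" "\<And>x. x \<in> S \<Longrightarrow> Q x \<noteq> 0"
        "\<And>x. x \<in> S \<Longrightarrow> - \<eta> k \<le> pLaplace_op p (Q x) (H x)"
        using smooth_approximation[OF p \<Omega> u nz visc S(1) False S(2) \<eta>(1)] by metis
      then show "\<exists>Q H. (\<forall>x. (Q has_derivative (\<lambda>e. H x *v e)) (at x)) \<and> continuous_on UNIV H \<and>
        (\<forall>x\<in>S. norm (Q x - grad u x) \<le> \<eta> k) \<and> (\<forall>x\<in>S. Q x \<noteq> 0) \<and> (\<forall>x\<in>S. - \<eta> k \<le> pLaplace_op p (Q x) (H x))"
        by blast
    qed
    then obtain Q H where QH: "\<And>k x. (Q k has_derivative (\<lambda>e. H k x *v e)) (at x)" "\<And>k. continuous_on UNIV (H k)"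
        "\<And>k x. x \<in> S \<Longrightarrow> norm (Q k x - grad u x) \<le> \<eta> k" "\<And>k x. x \<in> S \<Longrightarrow> Q k x \<noteq> 0"
        "\<And>k x. x \<in> S \<Longrightarrow> - \<eta> k \<le> pLaplace_op p (Q k x) (H k x)"
      by metis
    have Qb: "m / 2 \<le> norm (Q k x)" "norm (Q k x) \<le> B + 1" if "x \<in> S" for k x
    proof -
      have "norm (grad u x) - norm (Q k x) \<le> \<eta> k"
        using norm_triangle_ineq2[of "grad u x" "Q k x"] QH(3)[OF that, of k] by (simp add: norm_minus_commute)
      then show "m / 2 \<le> norm (Q k x)" using xm(2)[OF that] \<eta>(2)[of k] by (simp add: m_def)
      show "norm (Q k x) \<le> B + 1"
        using norm_triangle_ineq2[of "Q k x" "grad u x"] QH(3)[OF that, of k] B(2)[OF that] \<eta>(3)[of k] by linarith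
    qed
    define c where "c = (m / 2) powr (p - 4) + (B + 1) powr (p - 4)"
    have c0: "0 \<le> c" by (simp add: c_def)
    have c: "norm (Q k x) powr (p - 4) \<le> c" if "x \<in> S" for k x
      unfolding c_def by (rule powr_le_between) (use Qb[OF that] m in auto)
    define I where "I = (\<integral>x. indicator S x * \<phi> x \<partial>lborel)"
    define J where "J k = (\<integral>x. indicator S x * (pflux p (Q k x) \<bullet> grad \<phi> x) \<partial>lborel)" for k
    have Qc: "continuous_on S (Q k)" for k
      using QH(1) by (meson continuous_at_imp_continuous_on has_derivative_continuous)
    have Hc: "continuous_on S (H k)" for k using QH(2) by (rule continuous_on_subset) simp
    have \<phi>c: "continuous_on S \<phi>" by (rule smooth_supported_continuous[OF sm])
    \<comment> \<open>Integration by parts passes to the nondivergence form, where the operator is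
      at least \<open>- \<eta> k\<close>; only the bounded weight and the integral of
      \<open>\<phi>\<close> remain.\<close>
    have J_le: "J k \<le> \<eta> k * c * I" for k
    proof -
      define f where "f x = \<phi> x * (norm (Q k x) powr (p - 4) * pLaplace_op p (Q k x) (H k x))" for x
      have "continuous_on S (\<lambda>x. trace (H k x))"
        unfolding trace_def by (intro continuous_on_sum continuous_on_component Hc)
      moreover have "continuous_on S (\<lambda>x. H k x *v Q k x)"
        unfolding matrix_vector_mult_def by (intro continuous_on_vec_lambda continuous_on_sum continuous_on_mult continuous_on_component Hc Qc)
      ultimately have fc: "continuous_on S f"
        unfolding f_def pLaplace_op_eq using QH(4) by (intro continuous_intros \<phi>c Qc) auto
      have "J k = - (\<integral>x. indicator S x * f x \<partial>lborel)"
        unfolding J_def f_def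
        by (rule pflux_integration_by_parts[OF S(1) gd gc]) (use smooth_supported_outside[OF sm] QH Hc in auto)
      also have "\<dots> = (\<integral>x. - (indicator S x * f x) \<partial>lborel)" by simp
      also have "\<dots> \<le> (\<integral>x. \<eta> k * c * (indicator S x * \<phi> x) \<partial>lborel)"
      proof (rule integral_mono)
        show "integrable lborel (\<lambda>x. - (indicator S x * f x))"
          using integrable_indicator_compact[OF S(1) fc] by simp
        show "integrable lborel (\<lambda>x. \<eta> k * c * (indicator S x * \<phi> x))"
          by (intro integrable_mult_right integrable_indicator_compact[OF S(1) \<phi>c])
        show "- (indicator S x * f x) \<le> \<eta> k * c * (indicator S x * \<phi> x)" for x
        proof (cases "x \<in> S")
          case True
          have "norm (Q k x) powr (p - 4) * - pLaplace_op p (Q k x) (H k x) \<le> norm (Q k x) powr (p - 4) * \<eta> k"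
            using QH(5)[OF True, of k] by (intro mult_left_mono) auto
          also have "\<dots> \<le> c * \<eta> k" using c[OF True] \<eta>(1)[of k] by (intro mult_right_mono) auto
          finally have "\<phi> x * (norm (Q k x) powr (p - 4) * - pLaplace_op p (Q k x) (H k x)) \<le> \<phi> x * (c * \<eta> k)"
            using pos by (intro mult_left_mono) auto
          then show ?thesis using True by (simp add: f_def mult_ac)
        qed simp
      qed
      also have "\<dots> = \<eta> k * c * I" unfolding I_def by simp
      finally show ?thesis .
    qed
    obtain M where M: "0 < M" "\<And>x. norm (grad \<phi> x) \<le> M" using smooth_supported_grad_bounded[OF sm] by blast
    define d where "d = (m / 2) powr (p - 1) + (B + 1) powr (p - 1)"
    have d0: "0 \<le> d" by (simp add: d_def)
    have "J \<longlonglongrightarrow> (\<integral>x. indicator S x * (pflux p (grad u x) \<bullet> grad \<phi> x) \<partial>lborel)"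
      unfolding J_def
    proof (rule integral_dominated_convergence[where w = "\<lambda>x. indicator S x * (d * M)"])
      show "integrable lborel (\<lambda>x. indicator S x * (d * M) :: real)"
        by (rule integrable_indicator_compact[OF S(1)]) simp
      have "integrable lborel (\<lambda>x. indicator S x * (pflux p (grad u x) \<bullet> grad \<phi> x))"
        by (intro integrable_indicator_compact[OF S(1)] continuous_on_inner continuous_on_pflux uc gc unz)
      then show "(\<lambda>x. indicator S x * (pflux p (grad u x) \<bullet> grad \<phi> x)) \<in> borel_measurable lborel" by simp
      have "integrable lborel (\<lambda>x. indicator S x * (pflux p (Q k x) \<bullet> grad \<phi> x))" for k
        by (intro integrable_indicator_compact[OF S(1)] continuous_on_inner continuous_on_pflux Qc gc QH(4))
      then show "(\<lambda>x. indicator S x * (pflux p (Q k x) \<bullet> grad \<phi> x)) \<in> borel_measurable lborel" for k by simp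
      have "(\<lambda>k. indicator S x * (pflux p (Q k x) \<bullet> grad \<phi> x)) \<longlonglongrightarrow> indicator S x * (pflux p (grad u x) \<bullet> grad \<phi> x)" for x
      proof (cases "x \<in> S")
        case True
        have "(\<lambda>k. Q k x - grad u x) \<longlonglongrightarrow> 0"
          by (rule Lim_null_comparison[OF always_eventually \<eta>0]) (use QH(3)[OF True] in blast)
        then have "(\<lambda>k. Q k x) \<longlonglongrightarrow> grad u x" by (rule LIM_zero_cancel)
        then have "(\<lambda>k. pflux p (Q k x)) \<longlonglongrightarrow> pflux p (grad u x)"
          by (rule isCont_tendsto_compose[OF isCont_pflux[OF unz[OF True]]])
        then show ?thesis by (intro tendsto_intros)
      qed simp
      then show "AE x in lborel. (\<lambda>k. indicator S x * (pflux p (Q k x) \<bullet> grad \<phi> x)) \<longlonglongrightarrow> indicator S x * (pflux p (grad u x) \<bullet> grad \<phi> x)"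
        by simp
      have "norm (indicator S x * (pflux p (Q k x) \<bullet> grad \<phi> x)) \<le> indicator S x * (d * M)" for k x
      proof (cases "x \<in> S")
        case True
        have "norm (pflux p (Q k x)) \<le> d"
          unfolding norm_pflux d_def by (rule powr_le_between) (use Qb[OF True] m in auto)
        then have "norm (pflux p (Q k x)) * norm (grad \<phi> x) \<le> d * M" using M d0 by (intro mult_mono) auto
        then show ?thesis
          using True Cauchy_Schwarz_ineq2[of "pflux p (Q k x)" "grad \<phi> x"] by simp
      qed simp
      then show "AE x in lborel. norm (indicator S x * (pflux p (Q k x) \<bullet> grad \<phi> x)) \<le> indicator S x * (d * M)" for k by simp
    qed
    moreover have "(\<lambda>k. \<eta> k * c * I) \<longlonglongrightarrow> 0 * c * I" by (intro tendsto_intros \<eta>0)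
    ultimately show ?thesis using J_le by (intro LIMSEQ_le[of J _ "\<lambda>k. \<eta> k * c * I"]) auto
  qed simp
  finally show "(LINT x:\<Omega>|lebesgue. (norm (grad u x) powr (p - 2) *\<^sub>R grad u x) \<bullet> grad \<phi> x) \<le> 0"
    by (simp add: pflux_def)
qed

section \<open>Weak subsolutions are viscosity subsolutions\<close>

text \<open>The added multiple of the identity absorbs the remainder of higher order on a small
  ball.\<close>

lemma superjet_touches_above:
  assumes "(P, X) \<in> feeble_superjet u x" and \<eta>: "0 < \<eta>"
  shows "touches_above u x P (X + \<eta> *\<^sub>R mat 1)"
proof -
  obtain r where r: "r \<in> o[at 0](\<lambda>z. (norm z)\<^sup>2)"
      "\<forall>\<^sub>F z in at 0. u (z + x) \<le> u x + P \<bullet> z + 1/2 * (X \<bullet> tensor z z) + r z"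
    using assms(1) by (auto simp: feeble_superjet_def)
  have "\<forall>\<^sub>F z in at 0. norm (r z) \<le> (\<eta> / 2) * norm ((norm z)\<^sup>2)"
    using landau_o.smallD[OF r(1), of "\<eta> / 2"] \<eta> by simp
  with r(2) have "\<forall>\<^sub>F z in at 0. u (z + x) \<le> u x + P \<bullet> z + 1/2 * (z \<bullet> ((X + \<eta> *\<^sub>R mat 1) *v z))"
  proof eventually_elim
    case (elim z)
    have "r z \<le> \<eta> / 2 * (norm z)\<^sup>2" using elim(2) by simp
    then show ?case using elim(1) unfolding quadratic_add_mat inner_tensor by argo
  qed
  then obtain d where d: "0 < d" "\<And>z. z \<noteq> 0 \<Longrightarrow> norm z < d \<Longrightarrow>
      u (z + x) \<le> u x + P \<bullet> z + 1/2 * (z \<bullet> ((X + \<eta> *\<^sub>R mat 1) *v z))"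
    unfolding eventually_at by auto
  show ?thesis unfolding touches_above_def
  proof (intro exI[of _ "d / 2"] conjI allI impI)
    fix h :: "real ^ 'a" assume "norm h \<le> d / 2"
    then show "u (x + h) \<le> u x + P \<bullet> h + 1 / 2 * (h \<bullet> ((X + \<eta> *\<^sub>R mat 1) *v h))"
      using d by (cases "h = 0") (auto simp: add.commute[of x])
  qed (use d in simp)
qed

text \<open>By Cauchy-Schwarz the worst case is that of parallel vectors, where monotonicity of
  \<open>t powr (p - 1)\<close> decides.\<close>

lemma pflux_monotone:
  fixes a b :: "real ^ 'n"
  assumes p: "1 < p"
  shows "0 \<le> (pflux p a - pflux p b) \<bullet> (a - b)"
proof -
  define s t where "s = norm a" and "t = norm b"
  have st: "0 \<le> s" "0 \<le> t" by (auto simp: s_def t_def)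
  have pw: "x powr (p - 2) * x = x powr (p - 1)" if "0 \<le> x" for x :: real
    using powr_mult_base[OF that, of "p - 2"] by (simp add: mult.commute)
  have "0 \<le> (s powr (p - 1) - t powr (p - 1)) * (s - t)"
  proof (cases "s \<le> t")
    case True
    then have "s powr (p - 1) \<le> t powr (p - 1)" using p st by (intro powr_mono2) auto
    then show ?thesis using True by (simp add: mult_nonpos_nonpos)
  next
    case False
    then have "t powr (p - 1) \<le> s powr (p - 1)" using p st by (intro powr_mono2) auto
    then show ?thesis using False by simp
  qed
  also have "\<dots> = s powr (p - 2) * s\<^sup>2 + t powr (p - 2) * t\<^sup>2 - (s powr (p - 2) + t powr (p - 2)) * (s * t)"
    using pw[OF st(1)] pw[OF st(2)] by (simp add: algebra_simps power2_eq_square flip: pw[OF st(1)] pw[OF st(2)])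
  also have "\<dots> \<le> s powr (p - 2) * s\<^sup>2 + t powr (p - 2) * t\<^sup>2 - (s powr (p - 2) + t powr (p - 2)) * (a \<bullet> b)"
    using mult_left_mono[OF norm_cauchy_schwarz[of a b], of "s powr (p - 2) + t powr (p - 2)"]
    by (simp add: s_def t_def)
  also have "\<dots> = (pflux p a - pflux p b) \<bullet> (a - b)"
    by (simp add: pflux_def s_def t_def inner_diff_left inner_diff_right dot_square_norm inner_commute algebra_simps)
  finally show ?thesis .
qed

text \<open>In contrast to \<open>conv_has_derivative\<close> the derivative stays on
  \<open>f\<close>. The gradient of the mollification is thus a mean of \<open>g\<close> and close
  to \<open>g\<close> on compact sets.\<close>

lemma conv_C1_has_derivative:
  fixes f :: "real ^ 'n \<Rightarrow> real"
  assumes f: "\<And>x. (f has_derivative (\<lambda>e. g x \<bullet> e)) (at x)" and g: "continuous_on UNIV g" and \<phi>: "mollifier r \<phi>"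
  shows "(conv f \<phi> has_derivative (\<lambda>e. conv g \<phi> x \<bullet> e)) (at x)"
  unfolding has_derivative_at_alt
proof (intro conjI allI impI bounded_linear_inner_right)
  fix \<epsilon> :: real assume \<epsilon>: "0 < \<epsilon>"
  have sm: "smooth_supported (cball 0 r) \<phi>" using \<phi> by (simp add: mollifier_def)
  have cf: "continuous_on UNIV f" using f by (meson continuous_at_imp_continuous_on has_derivative_continuous)
  have "uniformly_continuous_on (cball x (r + 1)) g"
    by (intro compact_uniformly_continuous continuous_on_subset[OF g]) auto
  then obtain d where d: "0 < d" "\<And>a b. a \<in> cball x (r + 1) \<Longrightarrow> b \<in> cball x (r + 1) \<Longrightarrow> dist b a < d \<Longrightarrow> dist (g b) (g a) < \<epsilon>"
    using \<epsilon> unfolding uniformly_continuous_on_def by meson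
  show "\<exists>d>0. \<forall>y. norm (y - x) < d \<longrightarrow> norm (conv f \<phi> y - conv f \<phi> x - conv g \<phi> x \<bullet> (y - x)) \<le> \<epsilon> * norm (y - x)"
  proof (intro exI[of _ "min d 1"] conjI allI impI)
    show "0 < min d 1" using d by simp
    fix y assume y: "norm (y - x) < min d 1"
    define h where "h = y - x"
    define F where "F z = f (z + h) - f z - g z \<bullet> h" for z
    have cF: "continuous_on UNIV F"
      unfolding F_def by (intro continuous_intros cf g continuous_on_compose2[OF cf]) auto
    note i1 = conv_integrable[OF cf sm, of "x + h"] conv_integrable[OF cf sm, of x]
    note ig = conv_integrable[OF g sm, of x]
    have igh: "integrable lborel (\<lambda>y. (\<phi> y *\<^sub>R g (x + y)) \<bullet> h)" by (rule integrable_inner_left) (rule ig)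
    have "conv g \<phi> x \<bullet> h = (\<integral>y. (\<phi> y *\<^sub>R g (x + y)) \<bullet> h \<partial>lborel)"
      unfolding conv_def by (rule integral_inner_left[symmetric]) (rule ig)
    then have "conv f \<phi> (x + h) - conv f \<phi> x - conv g \<phi> x \<bullet> h
        = (\<integral>y. \<phi> y *\<^sub>R f (x + h + y) - \<phi> y *\<^sub>R f (x + y) - (\<phi> y *\<^sub>R g (x + y)) \<bullet> h \<partial>lborel)"
      unfolding conv_def using i1 igh by simp
    also have "\<dots> = conv F \<phi> x - 0"
      unfolding conv_def diff_0_right
      by (rule Bochner_Integration.integral_cong) (simp_all add: F_def algebra_simps)
    also have "norm \<dots> \<le> \<epsilon> * norm h"
    proof (rule conv_bound[OF \<phi> cF])
      fix z :: "real ^ 'n" assume z: "norm z \<le> r"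
      have ball: "norm (g a - g (x + z)) \<le> \<epsilon>" if "a \<in> cball (x + z) (norm h)" for a
      proof -
        have a: "norm (a - (x + z)) \<le> norm h" using that by (simp add: dist_norm norm_minus_commute)
        have "norm (a - x) \<le> r + 1"
          using norm_triangle_ineq[of "a - (x + z)" z] a z y by (simp add: h_def)
        then have "a \<in> cball x (r + 1)" "x + z \<in> cball x (r + 1)" "dist a (x + z) < d"
          using z a y by (auto simp: dist_norm norm_minus_commute h_def)
        then show ?thesis using d(2)[of "x + z" a] by (simp add: dist_norm)
      qed
      have m: "x + z + h \<in> cball (x + z) (norm h)" "x + z \<in> cball (x + z) (norm h)" by (simp_all add: dist_norm)
      note gac = gradient_almost_constant[of "cball (x + z) (norm h)" f g "g (x + z)" \<epsilon>, OF _ convex_cball ball]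
      have gd: "GDERIV f a :> g a" for a using f[of a] by (simp add: gderiv_def inner_commute)
      show "norm (F (x + z) - 0) \<le> \<epsilon> * norm h"
        using gac[OF gd _ m] gac[OF gd _ m(2,1)] by (simp add: F_def abs_le_iff)
    qed
    finally show "norm (conv f \<phi> y - conv f \<phi> x - conv g \<phi> x \<bullet> (y - x)) \<le> \<epsilon> * norm (y - x)"
      by (simp add: h_def)
  qed
qed

text \<open>Mollifying \<open>v\<close> gives a smooth admissible test function whose gradient is
  within \<open>\<epsilon>\<close> of \<open>g\<close> on the ball; the error is
  \<open>\<epsilon>\<close> times the mass \<open>c\<close> of the flux. The support radius
  \<open>s / 2\<close> leaves room for a kernel of radius at most \<open>s / 2\<close>.\<close>

lemma weak_C1_test:
  fixes u v :: "real ^ 'n \<Rightarrow> real"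
  assumes weak: "weak_pLaplace_ge0 p \<Omega> u" and s: "0 < s" and B: "cball z s \<subseteq> \<Omega>"
    and G: "continuous_on (cball z s) (\<lambda>x. pflux p (grad u x))"
    and v: "\<And>x. (v has_derivative (\<lambda>e. g x \<bullet> e)) (at x)" and g: "continuous_on UNIV g"
    and v0: "\<And>x. s / 2 < norm (x - z) \<Longrightarrow> v x = 0" and pos: "\<And>x. 0 \<le> v x"
  shows "(\<integral>x. indicator (cball z s) x * (pflux p (grad u x) \<bullet> g x) \<partial>lborel) \<le> 0"
proof -
  define K where "K = cball z s"
  define c where "c = (\<integral>x. indicator K x * norm (pflux p (grad u x)) \<partial>lborel)"
  have cv: "continuous_on UNIV v" using v by (meson continuous_at_imp_continuous_on has_derivative_continuous)
  have K: "compact K" by (simp add: K_def)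
  have GK: "continuous_on K (\<lambda>x. pflux p (grad u x))" using G by (simp add: K_def)
  have gK: "continuous_on K g" using g by (rule continuous_on_subset) simp
  have ic: "integrable lborel (\<lambda>x. indicator K x * norm (pflux p (grad u x)))"
    by (intro integrable_indicator_compact K continuous_on_norm GK)
  have "(\<integral>x. indicator K x * (pflux p (grad u x) \<bullet> g x) \<partial>lborel) \<le> 0 + \<epsilon> * c" if \<epsilon>: "0 < \<epsilon>" for \<epsilon>
  proof -
    have "uniformly_continuous_on (cball z (2 * s)) g"
      by (intro compact_uniformly_continuous continuous_on_subset[OF g]) auto
    then obtain d where d: "0 < d" "\<And>a b. a \<in> cball z (2 * s) \<Longrightarrow> b \<in> cball z (2 * s) \<Longrightarrow> dist b a < d \<Longrightarrow> dist (g b) (g a) < \<epsilon>"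
      using \<epsilon> unfolding uniformly_continuous_on_def by meson
    define r where "r = min (d / 2) (s / 2)"
    have r: "0 < r" "r < d" "r \<le> s / 2" using d s by (auto simp: r_def)
    obtain \<rho> :: "real ^ 'n \<Rightarrow> real" where \<rho>: "mollifier r \<rho>" using mollifier_exists[OF r(1)] .
    have sm: "smooth_supported (cball 0 r) \<rho>" and \<rho>0: "\<And>x. 0 \<le> \<rho> x" using \<rho> by (auto simp: mollifier_def)
    define \<phi> where "\<phi> = conv v \<rho>"
    have \<phi>0: "\<phi> x = 0" if "x \<notin> K" for x
    proof -
      have "\<rho> y *\<^sub>R v (x + y) = 0" for y
      proof (cases "norm y \<le> r")
        case True
        have "s < norm (x - z)" using that by (simp add: K_def dist_norm norm_minus_commute)
        then have "s / 2 < norm (x + y - z)"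
          using norm_triangle_ineq2[of "x - z" "- y"] True r by (simp add: algebra_simps)
        then show ?thesis by (simp add: v0)
      next
        case False
        then show ?thesis using smooth_supported_outside[OF sm, of y] by simp
      qed
      then have "(\<lambda>y. \<rho> y *\<^sub>R v (x + y)) = (\<lambda>y. 0)" by blast
      then show ?thesis unfolding \<phi>_def conv_def by (simp only: integral_zero)
    qed
    have Ck: "Ck_on k UNIV \<phi>" for k unfolding \<phi>_def by (rule conv_Ck[OF cv sm])
    have sub: "closure {x. \<phi> x \<noteq> 0} \<subseteq> K" using \<phi>0 K by (intro closure_minimal compact_imp_closed) auto
    moreover have "compact (closure {x. \<phi> x \<noteq> 0})"
      using closed_Int_compact[OF closed_closure K, of "{x. \<phi> x \<noteq> 0}"] sub by (simp add: Int_absorb2)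
    ultimately have "\<phi> \<in> test_functions \<Omega>"
      using Ck B unfolding test_functions_def K_def by blast
    moreover have "\<forall>x. 0 \<le> \<phi> x"
      unfolding \<phi>_def conv_def using \<rho>0 pos by (auto intro!: integral_nonneg_AE)
    ultimately have le: "(LINT x:\<Omega>|lebesgue. pflux p (grad u x) \<bullet> grad \<phi> x) \<le> 0"
      using weak unfolding weak_pLaplace_ge0_def pflux_def by blast
    have gr: "grad \<phi> = conv g \<rho>"
    proof
      fix x
      have "GDERIV \<phi> x :> conv g \<rho> x"
        using conv_C1_has_derivative[OF v g \<rho>, of x] by (simp add: gderiv_def \<phi>_def inner_commute)
      then show "grad \<phi> x = conv g \<rho> x" by (rule grad_eqI)
    qed
    have sm\<phi>: "smooth_supported K \<phi>" using Ck K \<phi>0 by (simp add: smooth_supported_def)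
    have gc: "continuous_on A (grad \<phi>)" for A
      using smooth_supported_continuous[OF smooth_supported_grad[OF sm\<phi>]]
        continuous_on_vec_lambda[of A "\<lambda>i x. grad \<phi> x $ i"] by simp
    have g0: "grad \<phi> x = 0" if "x \<notin> K" for x
      using smooth_supported_outside[OF smooth_supported_grad[OF sm\<phi>] that] by (simp add: vec_eq_iff)
    have le': "(\<integral>x. indicator K x * (pflux p (grad u x) \<bullet> grad \<phi> x) \<partial>lborel) \<le> 0"
      using weak_integral_eq[OF K _ GK gc g0, of \<Omega>] le B by (simp add: K_def)
    have near: "norm (grad \<phi> x - g x) \<le> \<epsilon>" if x: "x \<in> K" for x
      unfolding gr
    proof (rule conv_bound[OF \<rho> g])
      fix y :: "real ^ 'n" assume y: "norm y \<le> r"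
      have xz: "norm (x - z) \<le> s" using x by (simp add: K_def dist_norm norm_minus_commute)
      have "norm (x + y - z) \<le> 2 * s"
        using norm_triangle_ineq[of "x - z" y] xz y r s by (simp add: algebra_simps)
      then have "x + y \<in> cball z (2 * s)" "x \<in> cball z (2 * s)"
        using xz s by (auto simp: dist_norm norm_minus_commute)
      then show "norm (g (x + y) - g x) \<le> \<epsilon>"
        using d(2)[of x "x + y"] y r by (simp add: dist_norm)
    qed
    have i2: "integrable lborel (\<lambda>x. indicator K x * (pflux p (grad u x) \<bullet> grad \<phi> x))"
      by (intro integrable_indicator_compact K continuous_on_inner GK gc)
    have "(\<integral>x. indicator K x * (pflux p (grad u x) \<bullet> g x) \<partial>lborel)
        \<le> (\<integral>x. indicator K x * (pflux p (grad u x) \<bullet> grad \<phi> x) + \<epsilon> * (indicator K x * norm (pflux p (grad u x))) \<partial>lborel)"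
    proof (rule integral_mono)
      show "integrable lborel (\<lambda>x. indicator K x * (pflux p (grad u x) \<bullet> g x))"
        by (intro integrable_indicator_compact K continuous_on_inner GK gK)
      show "integrable lborel (\<lambda>x. indicator K x * (pflux p (grad u x) \<bullet> grad \<phi> x) + \<epsilon> * (indicator K x * norm (pflux p (grad u x))))"
        using i2 ic by simp
      fix x
      show "indicator K x * (pflux p (grad u x) \<bullet> g x)
          \<le> indicator K x * (pflux p (grad u x) \<bullet> grad \<phi> x) + \<epsilon> * (indicator K x * norm (pflux p (grad u x)))"
      proof (cases "x \<in> K")
        case True
        have "pflux p (grad u x) \<bullet> (g x - grad \<phi> x) \<le> norm (pflux p (grad u x)) * \<epsilon>"
          using order_trans[OF norm_cauchy_schwarz mult_left_mono[OF _ norm_ge_zero]] near[OF True]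
          by (simp add: norm_minus_commute)
        then show ?thesis using True by (simp add: inner_diff_right mult.commute)
      qed simp
    qed
    also have "\<dots> = (\<integral>x. indicator K x * (pflux p (grad u x) \<bullet> grad \<phi> x) \<partial>lborel) + \<epsilon> * c"
      unfolding c_def using i2 ic by simp
    finally show ?thesis using le' by linarith
  qed
  then show ?thesis unfolding K_def[symmetric] by (rule le_if_le_add_small)
qed

text \<open>The square makes the truncation continuously differentiable, as
  \<open>weak_C1_test\<close> demands.\<close>

lemma positive_part_sq_has_derivative: "((\<lambda>t. (max 0 t)\<^sup>2) has_real_derivative 2 * max 0 t) (at t)" for t :: real
proof -
  have "((\<lambda>t. (max 0 t)\<^sup>2) has_derivative (\<lambda>e. (2 * max 0 t) \<bullet> e)) (at t)"
  proof (rule has_derivative_quadratic_bound[where r = 1 and C = 1])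
    fix e :: real
    show "\<bar>(max 0 (t + e))\<^sup>2 - (max 0 t)\<^sup>2 - (2 * max 0 t) \<bullet> e\<bar> \<le> 1 * (norm e)\<^sup>2"
    proof (cases "0 \<le> t"; cases "0 \<le> t + e")
      assume te: "0 \<le> t" "\<not> 0 \<le> t + e"
      then have "t * (t + 2 * e) \<le> 0" by (intro mult_nonneg_nonpos) auto
      moreover have "0 \<le> (t + e)\<^sup>2" "0 \<le> e * e" by auto
      ultimately show ?thesis using te
        by (simp add: max_def power2_eq_square abs_le_iff algebra_simps)
    next
      assume "\<not> 0 \<le> t" "0 \<le> t + e"
      then have "(t + e)\<^sup>2 \<le> e\<^sup>2" by (intro power_mono) auto
      then show ?thesis using \<open>\<not> 0 \<le> t\<close> \<open>0 \<le> t + e\<close> by (simp add: max_def)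
    qed (auto simp: max_def power2_eq_square algebra_simps)
  qed simp
  then show ?thesis by (simp add: has_field_derivative_def)
qed

lemma visc_if_weak:
  fixes u :: "real ^ 'n \<Rightarrow> real"
  assumes p: "1 < p" and \<Omega>: "open \<Omega>" and u: "Ck_on 1 \<Omega> u"
    and nz: "\<And>x. x \<in> \<Omega> \<Longrightarrow> grad u x \<noteq> 0"
    and weak: "weak_pLaplace_ge0 p \<Omega> u"
  shows "feeble_visc_ge0 (pLaplace_op p) \<Omega> u"
  unfolding feeble_visc_ge0_def
proof (intro ballI, clarify, rule ccontr)
  fix z P X assume z: "z \<in> \<Omega>" and jet: "(P, X) \<in> feeble_superjet u z" and "\<not> 0 \<le> pLaplace_op p P X"
  then have neg: "pLaplace_op p P X < 0" by simp
  have P: "P \<noteq> 0" using jet by (simp add: feeble_superjet_def)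
  have ud: "(u has_derivative (\<lambda>e. grad u x \<bullet> e)) (at x)" if "x \<in> \<Omega>" for x
    using u that gderiv_grad unfolding Ck_on_1_iff gderiv_def by (metis (no_types, lifting) inner_commute has_derivative_eq_rhs ext)
  have gc: "continuous_on \<Omega> (grad u)" using u unfolding Ck_on_1_iff by blast
  have uc: "continuous_on \<Omega> u" using ud by (meson continuous_at_imp_continuous_on has_derivative_continuous)
  define N where "N = (norm P)\<^sup>2 * (real CARD('n) + p - 2)"
  have n1: "1 \<le> real CARD('n)" using zero_less_card_finite[where 'a='n] by linarith
  have "0 < real CARD('n) + p - 2" using p n1 by linarith
  then have N: "0 < N" unfolding N_def using P by (intro mult_pos_pos) auto
  \<comment> \<open>Adding \<open>2 * \<eta>\<close> times the identity then raises the operator by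
    half of its distance to zero, so it stays negative.\<close>
  define \<eta> where "\<eta> = - pLaplace_op p P X / (4 * N)"
  have \<eta>: "0 < \<eta>" using neg N by (simp add: \<eta>_def divide_neg_pos)
  \<comment> \<open>One \<open>\<eta>\<close> absorbs the remainder of the jet, the other separates
    the paraboloid from \<open>u\<close> by \<open>\<eta> / 2\<close> times the squared
    distance.\<close>
  define Y where "Y = X + (2 * \<eta>) *\<^sub>R mat 1"
  have negY: "pLaplace_op p P Y < 0"
  proof -
    have "pLaplace_op p P Y = pLaplace_op p P X + 2 * \<eta> * N" by (simp add: Y_def pLaplace_op_add_mat N_def)
    also have "2 * \<eta> * N = - pLaplace_op p P X / 2" using N by (simp add: \<eta>_def)
    finally show ?thesis using neg by simp
  qed
  define Q where "Q x = P + Y *v (x - z)" for x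
  have Qd: "(Q has_derivative (\<lambda>e. Y *v e)) (at x)" for x
  proof -
    have "((\<lambda>x. x - z) has_derivative (\<lambda>e. e)) (at x)" by (auto intro!: derivative_eq_intros)
    from has_derivative_add[OF has_derivative_const bounded_linear.has_derivative[OF matrix_vector_mul_bounded_linear[of Y] this]]
    show ?thesis unfolding Q_def[abs_def] by simp
  qed
  have Qc: "continuous_on A Q" for A using Qd by (meson continuous_at_imp_continuous_on has_derivative_continuous)
  have opc: "continuous_on UNIV (\<lambda>x. pLaplace_op p (Q x) Y)"
    unfolding pLaplace_op_eq
    by (intro continuous_intros Qc linear_continuous_on_compose[OF Qc matrix_vector_mul_linear])
  obtain \<rho> where \<rho>: "0 < \<rho>" "\<And>h. norm h \<le> \<rho> \<Longrightarrow> u (z + h) \<le> u z + P \<bullet> h + 1 / 2 * (h \<bullet> ((X + \<eta> *\<^sub>R mat 1) *v h))"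
    using superjet_touches_above[OF jet \<eta>] by (auto simp: touches_above_def)
  have "\<exists>s>0. cball z s \<subseteq> {x. pLaplace_op p (Q x) Y < 0} \<inter> {x. Q x \<noteq> 0} \<inter> \<Omega> \<inter> ball z \<rho>"
  proof (rule open_contains_cball[THEN iffD1, rule_format])
    have "open {x. pLaplace_op p (Q x) Y < 0}" by (rule open_Collect_less[OF opc]) simp
    moreover have "open {x. Q x \<noteq> 0}" by (rule open_Collect_neq[OF Qc]) simp
    ultimately show "open ({x. pLaplace_op p (Q x) Y < 0} \<inter> {x. Q x \<noteq> 0} \<inter> \<Omega> \<inter> ball z \<rho>)" using \<Omega> by auto
    show "z \<in> {x. pLaplace_op p (Q x) Y < 0} \<inter> {x. Q x \<noteq> 0} \<inter> \<Omega> \<inter> ball z \<rho>"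
      using negY P z \<rho> by (simp add: Q_def)
  qed
  then obtain s where s: "0 < s" "cball z s \<subseteq> {x. pLaplace_op p (Q x) Y < 0} \<inter> {x. Q x \<noteq> 0} \<inter> \<Omega> \<inter> ball z \<rho>"
    by blast
  define K where "K = cball z s"
  have K: "compact K" "K \<subseteq> \<Omega>" "\<And>x. x \<in> K \<Longrightarrow> pLaplace_op p (Q x) Y < 0" "\<And>x. x \<in> K \<Longrightarrow> Q x \<noteq> 0" "K \<subseteq> ball z \<rho>"
    using s(2) by (auto simp: K_def)
  define \<psi> where "\<psi> x = u z + P \<bullet> (x - z) + 1 / 2 * ((x - z) \<bullet> (Y *v (x - z)))" for x
  have Ysym: "transpose Y = Y" using jet unfolding Y_def by (intro transpose_add_mat) (simp add: feeble_superjet_def)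
  have \<psi>d: "(\<psi> has_derivative (\<lambda>e. Q x \<bullet> e)) (at x)" for x
  proof -
    have 1: "((\<lambda>x. x - z) has_derivative (\<lambda>e. e)) (at x)" by (auto intro!: derivative_eq_intros)
    have 2: "((\<lambda>x. Y *v (x - z)) has_derivative (\<lambda>e. Y *v e)) (at x)"
      by (rule bounded_linear.has_derivative[OF matrix_vector_mul_bounded_linear[of Y] 1])
    have "(\<psi> has_derivative (\<lambda>e. 0 + P \<bullet> e + 1 / 2 * ((x - z) \<bullet> (Y *v e) + e \<bullet> (Y *v (x - z))))) (at x)"
      unfolding \<psi>_def[abs_def]
      by (intro has_derivative_add has_derivative_const has_derivative_mult_right has_derivative_inner[OF 1 2]
          bounded_linear.has_derivative[OF bounded_linear_inner_right 1])
    moreover have "0 + P \<bullet> e + 1 / 2 * ((x - z) \<bullet> (Y *v e) + e \<bullet> (Y *v (x - z))) = Q x \<bullet> e" for e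
      using symmetric_inner[OF Ysym, of "x - z" e] by (simp add: Q_def inner_add_left inner_commute[of "Y *v (x - z)"])
    ultimately show ?thesis by simp
  qed
  \<comment> \<open>This is the separation at distance \<open>s / 2\<close>. Hence
    \<open>u - \<psi> + \<delta>\<close> is nonpositive in \<open>K\<close> from there on, while it
    equals \<open>\<delta>\<close> at \<open>z\<close>.\<close>
  define \<delta> where "\<delta> = \<eta> * s\<^sup>2 / 8"
  have \<delta>: "0 < \<delta>" using \<eta> s by (simp add: \<delta>_def)
  define d where "d x = u x - \<psi> x + \<delta>" for x
  have d_neg: "d x \<le> 0" if "s / 2 \<le> norm (x - z)" "x \<in> K" for x
  proof -
    define h where "h = x - z"
    have "norm h \<le> \<rho>" using that(2) K(5) by (auto simp: h_def dist_norm norm_minus_commute less_imp_le)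
    from \<rho>(2)[OF this] have "u x \<le> \<psi> x - \<eta> / 2 * (norm h)\<^sup>2"
      unfolding \<psi>_def Y_def quadratic_add_mat h_def[symmetric] by (simp add: h_def algebra_simps)
    moreover have "\<eta> / 2 * (s / 2)\<^sup>2 \<le> \<eta> / 2 * (norm h)\<^sup>2"
      using that(1) \<eta> s by (intro mult_left_mono power_mono) (auto simp: h_def)
    ultimately show ?thesis by (simp add: d_def \<delta>_def power2_eq_square)
  qed
  \<comment> \<open>Away from \<open>z\<close> the sign of \<open>d\<close> is unknown, hence the
    cut at the ball. It creates no singularity, because the positive part already vanishes between
    the radii \<open>s / 2\<close> and \<open>s\<close>.\<close>
  define m where "m x = (if x \<in> ball z s then max 0 (d x) else 0)" for x
  define v where "v x = (m x)\<^sup>2" for x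
  define g where "g x = (2 * m x) *\<^sub>R (grad u x - Q x)" for x
  have m0: "m x = 0" if "x \<notin> cball z (s / 2)" for x
    using that d_neg[of x] by (auto simp: m_def K_def dist_norm norm_minus_commute)
  have cover: "UNIV = ball z s \<union> - cball z (s / 2)" using s(1) by auto
  have ballO: "ball z s \<subseteq> \<Omega>" using K(2) by (auto simp: K_def)
  have vd: "(v has_derivative (\<lambda>e. g x \<bullet> e)) (at x)" for x
  proof (cases "x \<in> ball z s")
    case True
    then have "x \<in> \<Omega>" using ballO by blast
    have "(d has_derivative (\<lambda>e. grad u x \<bullet> e - Q x \<bullet> e + 0)) (at x)"
      unfolding d_def[abs_def] by (intro has_derivative_add has_derivative_diff ud[OF \<open>x \<in> \<Omega>\<close>] \<psi>d has_derivative_const)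
    from has_derivative_compose[OF this positive_part_sq_has_derivative[unfolded has_field_derivative_def]]
    have "((\<lambda>x. (max 0 (d x))\<^sup>2) has_derivative (\<lambda>e. 2 * max 0 (d x) * (grad u x \<bullet> e - Q x \<bullet> e + 0))) (at x)" .
    then have "(v has_derivative (\<lambda>e. 2 * max 0 (d x) * (grad u x \<bullet> e - Q x \<bullet> e + 0))) (at x)"
      by (rule has_derivative_transform_within_open[OF _ open_ball True]) (simp add: v_def m_def)
    then show ?thesis using True by (simp add: g_def m_def inner_diff_left)
  next
    case False
    then have x: "x \<in> - cball z (s / 2)" using cover by blast
    have "((\<lambda>x. 0) has_derivative (\<lambda>h. 0)) (at x)" by simp
    then have "(v has_derivative (\<lambda>h. 0)) (at x)"
      by (rule has_derivative_transform_within_open[OF _ _ x]) (use m0 in \<open>auto simp: v_def\<close>)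
    then show ?thesis using m0[of x] x by (simp add: g_def)
  qed
  have gcont: "continuous_on UNIV g"
    unfolding cover
  proof (rule continuous_on_open_Un)
    have "continuous_on (ball z s) (\<lambda>x. (2 * max 0 (d x)) *\<^sub>R (grad u x - Q x))"
      unfolding d_def using \<psi>d ballO
      by (intro continuous_intros Qc continuous_on_subset[OF gc] continuous_on_subset[OF uc])
         (auto intro: continuous_at_imp_continuous_on has_derivative_continuous)
    then show "continuous_on (ball z s) g" by (rule continuous_on_eq) (simp add: g_def m_def)
    have "continuous_on (- cball z (s / 2)) (\<lambda>x. 0 :: real ^ 'n)" by simp
    then show "continuous_on (- cball z (s / 2)) g" by (rule continuous_on_eq) (use m0 in \<open>auto simp: g_def\<close>)
  qed auto
  have Gu: "continuous_on K (\<lambda>x. pflux p (grad u x))"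
    by (intro continuous_on_pflux continuous_on_subset[OF gc] K(2)) (use nz K(2) in blast)
  have 1: "(\<integral>x. indicator K x * (pflux p (grad u x) \<bullet> g x) \<partial>lborel) \<le> 0"
    unfolding K_def
  proof (rule weak_C1_test[OF weak s(1) _ _ vd gcont])
    show "cball z s \<subseteq> \<Omega>" using K(2) by (simp add: K_def)
    show "continuous_on (cball z s) (\<lambda>x. pflux p (grad u x))" using Gu by (simp add: K_def)
    show "v x = 0" if "s / 2 < norm (x - z)" for x
      using m0[of x] that by (simp add: v_def dist_norm norm_minus_commute)
    show "0 \<le> v x" for x by (simp add: v_def)
  qed
  define f where "f x = v x * (norm (Q x) powr (p - 4) * pLaplace_op p (Q x) Y)" for x
  have vK: "v x = 0" if "x \<notin> K" for x using that s(1) by (auto simp: v_def m_def K_def)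
  \<comment> \<open>The field \<open>Q\<close> is the gradient of the paraboloid, and its operator
    is negative on \<open>K\<close>; after integration by parts the flux of \<open>Q\<close> tested
    with \<open>v\<close> is positive.\<close>
  have "(\<integral>x. indicator K x * (pflux p (Q x) \<bullet> g x) \<partial>lborel) = - (\<integral>x. indicator K x * f x \<partial>lborel)"
    unfolding f_def
    by (rule pflux_integration_by_parts[OF K(1) vd gcont vK Qd]) (use K(4) in auto)
  also have "\<dots> = (\<integral>x. - (indicator K x * f x) \<partial>lborel)" by simp
  also have "0 < \<dots>"
  proof -
    have vc: "continuous_on K v" using vd by (meson continuous_at_imp_continuous_on has_derivative_continuous)
    have opK: "continuous_on K (\<lambda>x. pLaplace_op p (Q x) Y)" using opc by (rule continuous_on_subset) simp
    have fc: "continuous_on K f" unfolding f_def using K(4) by (intro continuous_intros vc Qc opK) auto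
    have fi: "integrable lborel (\<lambda>x. - (indicator K x * f x))"
      using integrable_indicator_compact[OF K(1) fc] by simp
    have zK: "z \<in> K" using s(1) by (simp add: K_def)
    have f_le: "f x \<le> 0" if "x \<in> K" for x
      using K(3)[OF that] by (auto simp: f_def v_def intro!: mult_nonneg_nonpos)
    have "v z = \<delta>\<^sup>2" using s(1) \<delta> by (simp add: v_def m_def d_def \<psi>_def)
    then have fz: "f z < 0"
      using K(3,4)[OF zK] \<delta> by (simp add: f_def mult_pos_neg)
    have "continuous_on (ball z s) f" using fc by (rule continuous_on_subset) (auto simp: K_def)
    then have "isCont f z" using s(1) by (simp add: continuous_on_eq_continuous_at)
    then have "\<forall>\<^sub>F x in nhds z. f x < f z / 2"
      using fz by (intro order_tendstoD) (auto simp: continuous_at tendsto_nhds_iff isCont_def)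
    then obtain t0 where t0: "0 < t0" "\<And>x. dist x z < t0 \<Longrightarrow> f x < f z / 2"
      unfolding eventually_nhds_metric by blast
    define t where "t = min (t0 / 2) s"
    have t: "0 < t" "t < t0" "t \<le> s" using t0 s(1) by (auto simp: t_def)
    show ?thesis
    proof (rule integral_pos_if_pos_on_ball[OF fi _ t(1)])
      show "0 \<le> - (indicator K x * f x)" for x using f_le[of x] by (auto simp: indicator_def)
      show "0 < - (f z / 2)" using fz by simp
      show "- (f z / 2) \<le> - (indicator K x * f x)" if "norm (x - z) \<le> t" for x
      proof -
        have "x \<in> K" using that t by (simp add: K_def dist_norm norm_minus_commute)
        then show ?thesis using t0(2)[of x] that t by (simp add: dist_norm)
      qed
    qed
  qed
  finally have 2: "0 < (\<integral>x. indicator K x * (pflux p (Q x) \<bullet> g x) \<partial>lborel)" .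
  have gK: "continuous_on K g" using gcont by (rule continuous_on_subset) simp
  have "(\<integral>x. indicator K x * (pflux p (Q x) \<bullet> g x) \<partial>lborel) \<le> (\<integral>x. indicator K x * (pflux p (grad u x) \<bullet> g x) \<partial>lborel)"
  proof (rule integral_mono)
    show "integrable lborel (\<lambda>x. indicator K x * (pflux p (Q x) \<bullet> g x))"
      by (intro integrable_indicator_compact K(1) continuous_on_inner continuous_on_pflux Qc gK K(4))
    show "integrable lborel (\<lambda>x. indicator K x * (pflux p (grad u x) \<bullet> g x))"
      by (intro integrable_indicator_compact K(1) continuous_on_inner Gu gK)
    fix x
    \<comment> \<open>The test gradient \<open>g\<close> is a nonnegative multiple of
      \<open>grad u - Q\<close>, so monotonicity compares the two fluxes pointwise. This contradicts
      facts 1 and 2.\<close>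
    have "0 \<le> 2 * m x * ((pflux p (grad u x) - pflux p (Q x)) \<bullet> (grad u x - Q x))"
      by (intro mult_nonneg_nonneg pflux_monotone p) (auto simp: m_def)
    then have "pflux p (Q x) \<bullet> g x \<le> pflux p (grad u x) \<bullet> g x"
      by (simp add: g_def inner_diff_left algebra_simps)
    then show "indicator K x * (pflux p (Q x) \<bullet> g x) \<le> indicator K x * (pflux p (grad u x) \<bullet> g x)"
      by (intro mult_left_mono) auto
  qed
  with 1 2 show False by linarith
qed

section \<open>Minimality under affine perturbations\<close>

lemma Linf_norm_le:
  assumes "S \<in> sets lebesgue" "continuous_on S v" "\<And>x. x \<in> S \<Longrightarrow> norm (v x) \<le> c"
  shows "Linf_norm S v \<le> ereal c"
  unfolding Linf_norm_def
proof (rule esssup_I)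
  have "continuous_on S (\<lambda>x. norm (v x))" by (intro continuous_on_norm assms(2))
  from continuous_imp_measurable_on_sets_lebesgue[OF this assms(1)]
  show "(\<lambda>x. ereal (norm (v x))) \<in> borel_measurable (lebesgue_on S)" by simp
  show "AE x in lebesgue_on S. ereal (norm (v x)) \<le> ereal c"
    by (rule AE_I2) (use assms(3) in \<open>simp add: space_restrict_space\<close>)
qed

text \<open>If the norm at \<open>x\<close> were larger, it would be larger on a nonempty open part
  of \<open>S\<close>, which is not negligible. That \<open>x\<close> may lie on the boundary is
  essential for \<open>max_grad_set\<close>.\<close>

lemma Linf_norm_ge:
  fixes S :: "(real ^ 'n) set"
  assumes S: "open S" and v: "continuous_on (closure S) v" and x: "x \<in> closure S"
  shows "ereal (norm (v x)) \<le> Linf_norm S v"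
proof (rule ccontr)
  assume "\<not> ?thesis"
  then have "Linf_norm S v < ereal (norm (v x))" by simp
  then obtain t where t: "Linf_norm S v < ereal t" "t < norm (v x)"
    using ereal_dense2 by (metis less_ereal.simps(1))
  have nv: "continuous_on (closure S) (\<lambda>x. norm (v x))" by (intro continuous_on_norm v)
  then obtain d where d: "0 < d" "\<And>y. y \<in> closure S \<Longrightarrow> dist y x < d \<Longrightarrow> dist (norm (v y)) (norm (v x)) < norm (v x) - t"
    using x t(2) unfolding continuous_on_iff by (metis diff_gt_0_iff_gt)
  define U where "U = S \<inter> ball x d"
  have U: "open U" "U \<noteq> {}"
  proof -
    show "open U" using S by (auto simp: U_def)
    obtain y where "y \<in> S" "dist y x < d" using x d(1) unfolding closure_approachable by blast
    then show "U \<noteq> {}" by (auto simp: U_def dist_commute)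
  qed
  have big: "t < norm (v y)" if "y \<in> U" for y
    using d(2)[of y] that closure_subset[of S] by (auto simp: U_def dist_commute dist_real_def)
  have "AE y in lebesgue_on S. ereal (norm (v y)) \<le> Linf_norm S v"
    unfolding Linf_norm_def by (rule esssup_AE)
  then have "AE y in lebesgue. y \<in> S \<longrightarrow> ereal (norm (v y)) \<le> Linf_norm S v"
    using S by (subst (asm) AE_restrict_space_iff) auto
  then obtain N where "\<And>y. y \<in> space lebesgue - N \<Longrightarrow> y \<in> S \<longrightarrow> ereal (norm (v y)) \<le> Linf_norm S v"
    and N: "N \<in> null_sets lebesgue"
    by (rule AE_E3) blast
  then have sub: "{y. \<not> (y \<in> S \<longrightarrow> ereal (norm (v y)) \<le> Linf_norm S v)} \<subseteq> N" by auto
  have "U \<subseteq> {y. \<not> (y \<in> S \<longrightarrow> ereal (norm (v y)) \<le> Linf_norm S v)}"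
  proof
    fix y assume y: "y \<in> U"
    have "Linf_norm S v < ereal (norm (v y))" using t(1) big[OF y] by (meson ereal_less(3) less_ereal.simps(1) less_trans)
    then show "y \<in> {y. \<not> (y \<in> S \<longrightarrow> ereal (norm (v y)) \<le> Linf_norm S v)}" using y by (auto simp: U_def)
  qed
  then have "negligible U" using N sub by (meson negligible_iff_null_sets negligible_subset subset_trans)
  then show False using open_not_negligible[OF U] by simp
qed

text \<open>The essential supremum of a nonmeasurable function is a default value, so measurability
  of the two norms is matched first.\<close>

lemma Linf_norm_cong:
  assumes "\<And>x. x \<in> S \<Longrightarrow> norm (v x) = norm (w x)"
  shows "Linf_norm S v = Linf_norm S w"
proof -
  have sp: "x \<in> space (lebesgue_on S) \<Longrightarrow> ereal (norm (v x)) = ereal (norm (w x))" for x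
    using assms by (simp add: space_restrict_space)
  show ?thesis
  proof (cases "(\<lambda>x. ereal (norm (v x))) \<in> borel_measurable (lebesgue_on S)")
    case True
    moreover from True have "(\<lambda>x. ereal (norm (w x))) \<in> borel_measurable (lebesgue_on S)"
      using measurable_cong[of "lebesgue_on S" "\<lambda>x. ereal (norm (v x))" "\<lambda>x. ereal (norm (w x))" borel] sp by blast
    ultimately show ?thesis unfolding Linf_norm_def
      by (intro antisym esssup_AE_mono AE_I2) (simp_all add: sp)
  next
    case False
    moreover from False have "(\<lambda>x. ereal (norm (w x))) \<notin> borel_measurable (lebesgue_on S)"
      using measurable_cong[of "lebesgue_on S" "\<lambda>x. ereal (norm (v x))" "\<lambda>x. ereal (norm (w x))" borel] sp by blast
    ultimately show ?thesis unfolding Linf_norm_def by (simp add: esssup_non_measurable)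
  qed
qed

lemma grad_affine:
  fixes l :: "real ^ 'n \<Rightarrow> real"
  assumes "linear l"
  shows "(\<lambda>y. l y + c) differentiable (at x)"
  using assms by (intro differentiable_add linear_imp_differentiable differentiable_const)

lemma grad_inner: "grad (\<lambda>y. y \<bullet> a + c) x = a" for a :: "real ^ 'n"
proof (rule grad_eqI)
  show "GDERIV (\<lambda>y. y \<bullet> a + c) x :> a"
    unfolding gderiv_def
    using has_derivative_add[OF bounded_linear_imp_has_derivative[OF bounded_linear_inner_left, of a] has_derivative_const[of c]]
    by simp
qed

lemma grad_const: "grad (\<lambda>_. c) x = (0 :: real ^ 'n)"
  by (rule grad_eqI) (simp add: gderiv_def)

text \<open>Up to the factor 2, the operator is the first order change of the squared norm of the
  gradient \<open>P\<close> when it moves in the direction of the admissible affine slopes.\<close>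

lemma pLaplace_op_inner:
  fixes X :: "real ^ 'n ^ 'n"
  shows "(((p - 2) *\<^sub>R X + (mat 1 \<bullet> X) *\<^sub>R mat 1) *v P) \<bullet> P = pLaplace_op p P X"
  by (simp add: pLaplace_op_eq matrix_vector_mult_add_rdistrib scaleR_matrix_vector_assoc[symmetric]
      inner_add_left inner_mat_1 dot_square_norm inner_commute[of P])

lemma superjet_gradient:
  fixes u :: "real ^ 'n \<Rightarrow> real"
  assumes "u differentiable (at x)" and jet: "(P, X) \<in> feeble_superjet u x"
  shows "P = grad u x"
proof -
  define Y where "Y = X + 1 *\<^sub>R mat 1"
  obtain \<rho> where \<rho>: "0 < \<rho>" "\<And>h. norm h \<le> \<rho> \<Longrightarrow> u (x + h) \<le> u x + P \<bullet> h + 1 / 2 * (h \<bullet> (Y *v h))"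
    using superjet_touches_above[OF jet, of 1] by (auto simp: touches_above_def Y_def)
  have d: "(u has_derivative (\<lambda>e. grad u x \<bullet> e)) (at x)"
    using gderiv_grad[OF assms(1)] by (simp add: gderiv_def inner_commute)
  show ?thesis
  proof (rule gradient_unique_if_touched[OF d \<rho>(1)])
    fix k :: "real ^ 'n" assume k: "norm k < \<rho>"
    show "u (x + k) \<le> u x + P \<bullet> k + (onorm ((*v) Y) / 2) * (norm k)\<^sup>2"
      using \<rho>(2)[of k] k quadratic_le_onorm[of k Y] by simp
  qed
qed

section \<open>Minimality and the viscosity inequality\<close>

definition minimality_plus :: "real \<Rightarrow> (real ^ 'n) set \<Rightarrow> (real ^ 'n \<Rightarrow> real) \<Rightarrow> bool" where
  "minimality_plus p \<Omega> u \<longleftrightarrow> (\<forall>\<Omega>'. open \<Omega>' \<and> \<Omega>' \<noteq> {} \<and> compactly_inside \<Omega>' \<Omega> \<longrightarrow>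
     (\<forall>A\<in>affine_class_plus p u \<Omega>'. Linf_norm \<Omega>' (grad u) \<le> Linf_norm \<Omega>' (\<lambda>x. grad u x + grad A x)))"

definition minimality_minus :: "real \<Rightarrow> (real ^ 'n) set \<Rightarrow> (real ^ 'n \<Rightarrow> real) \<Rightarrow> bool" where
  "minimality_minus p \<Omega> u \<longleftrightarrow> (\<forall>\<Omega>'. open \<Omega>' \<and> \<Omega>' \<noteq> {} \<and> compactly_inside \<Omega>' \<Omega> \<longrightarrow>
     (\<forall>A\<in>affine_class_minus p u \<Omega>'. Linf_norm \<Omega>' (grad u) \<le> Linf_norm \<Omega>' (\<lambda>x. grad u x + grad A x)))"

text \<open>At a point \<open>x\<close> of maximal \<open>norm (grad u x)\<close>, adding a
  nonnegative multiple of \<open>a\<close> with \<open>0 \<le> a \<bullet> grad u x\<close> cannot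
  lower the norm, and \<open>Linf_norm_ge\<close> takes that point into account even on the
  boundary.\<close>

lemma minimality_if_visc:
  fixes u :: "real ^ 'n \<Rightarrow> real"
  assumes u: "Ck_on 1 \<Omega> u" and visc: "feeble_visc_ge0 (pLaplace_op p) \<Omega> u"
  shows "minimality_plus p \<Omega> u"
  unfolding minimality_plus_def
proof (intro allI impI ballI)
  fix S A assume S: "open S \<and> S \<noteq> {} \<and> compactly_inside S \<Omega>" and A: "A \<in> affine_class_plus p u S"
  have gc: "continuous_on (closure S) (grad u)"
    using u S unfolding Ck_on_1_iff compactly_inside_def by (meson continuous_on_subset)
  show "Linf_norm S (grad u) \<le> Linf_norm S (\<lambda>x. grad u x + grad A x)"
  proof (cases "\<exists>c. A = (\<lambda>_. c)")
    case True
    then have "grad A x = 0" for x using grad_const by auto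
    then show ?thesis by simp
  next
    case False
    then obtain \<xi> x X where \<xi>: "0 \<le> \<xi>" and x: "x \<in> max_grad_set u S" and X: "X \<in> D2_plus u x"
      and gA: "\<And>y. grad A y = \<xi> *\<^sub>R (((p - 2) *\<^sub>R X + (mat 1 \<bullet> X) *\<^sub>R mat 1) *v grad u x)"
      using A unfolding affine_class_plus_def by blast
    define a where "a = ((p - 2) *\<^sub>R X + (mat 1 \<bullet> X) *\<^sub>R mat 1) *v grad u x"
    have xS: "x \<in> closure S" and max: "ereal (norm (grad u x)) = Linf_norm S (grad u)"
      using x by (auto simp: max_grad_set_def)
    have "0 \<le> pLaplace_op p (grad u x) X"
      using visc X xS S unfolding feeble_visc_ge0_def D2_plus_def compactly_inside_def by blast
    then have a: "0 \<le> a \<bullet> grad u x" unfolding a_def pLaplace_op_inner .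
    have "(norm (grad u x))\<^sup>2 \<le> (norm (grad u x + \<xi> *\<^sub>R a))\<^sup>2"
      unfolding norm_add_sq using \<xi> a by (simp add: inner_commute)
    then have "norm (grad u x) \<le> norm (grad u x + \<xi> *\<^sub>R a)" by (rule power2_le_imp_le) simp
    then have "Linf_norm S (grad u) \<le> ereal (norm (grad u x + \<xi> *\<^sub>R a))" unfolding max[symmetric] by simp
    also have "\<dots> \<le> Linf_norm S (\<lambda>x. grad u x + \<xi> *\<^sub>R a)"
      by (rule Linf_norm_ge[OF _ _ xS]) (use S gc in \<open>auto intro!: continuous_intros\<close>)
    finally show ?thesis by (simp add: gA a_def)
  qed
qed

lemma visc_if_minimality:
  fixes u :: "real ^ 'n \<Rightarrow> real"
  assumes \<Omega>: "open \<Omega>" and u: "Ck_on 1 \<Omega> u"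
    and nmin: "\<And>x. x \<in> \<Omega> \<Longrightarrow> \<not> has_local_min_at (\<lambda>y. norm (grad u y)) x"
    and mini: "minimality_plus p \<Omega> u"
  shows "feeble_visc_ge0 (pLaplace_op p) \<Omega> u"
  unfolding feeble_visc_ge0_def
proof (intro ballI, clarify, rule ccontr)
  fix x P X assume x: "x \<in> \<Omega>" and jet: "(P, X) \<in> feeble_superjet u x" and neg: "\<not> 0 \<le> pLaplace_op p P X"
  have gc: "continuous_on \<Omega> (grad u)" and P: "P = grad u x"
    using u superjet_gradient[OF _ jet] x unfolding Ck_on_1_iff by auto
  define a where "a = ((p - 2) *\<^sub>R X + (mat 1 \<bullet> X) *\<^sub>R mat 1) *v grad u x"
  define c where "c = - (a \<bullet> grad u x)"
  have c: "0 < c" using neg unfolding c_def a_def pLaplace_op_inner P by simp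
  have a0: "a \<noteq> 0" using c by (auto simp: c_def)
  \<comment> \<open>At \<open>x\<close> the product is \<open>- c\<close>; on a small ball it stays
    below \<open>- c / 2\<close>, which leaves room for the second order term.\<close>
  have "open {y \<in> \<Omega>. a \<bullet> grad u y < - c / 2}"
  proof -
    have "continuous_on \<Omega> (\<lambda>y. a \<bullet> grad u y)" by (intro continuous_intros gc)
    from continuous_on_open_vimage[THEN iffD1, OF \<Omega> this, rule_format, of "{..<- c / 2}"]
    have "open ((\<lambda>y. a \<bullet> grad u y) -` {..<- c / 2} \<inter> \<Omega>)" by simp
    also have "(\<lambda>y. a \<bullet> grad u y) -` {..<- c / 2} \<inter> \<Omega> = {y \<in> \<Omega>. a \<bullet> grad u y < - c / 2}" by auto
    finally show ?thesis .
  qed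
  moreover have "x \<in> {y \<in> \<Omega>. a \<bullet> grad u y < - c / 2}" using x c by (simp add: c_def)
  ultimately obtain r where r: "0 < r" "cball x r \<subseteq> {y \<in> \<Omega>. a \<bullet> grad u y < - c / 2}"
    using open_contains_cball by blast
  \<comment> \<open>The point \<open>x\<close> is not in \<open>S\<close>, only in its closure. The
    strict inequality makes \<open>S\<close> open and places the supremum of the norm at
    \<open>x\<close>.\<close>
  define S where "S = {y \<in> ball x r. norm (grad u y) < norm (grad u x)}"
  have cS: "closure S \<subseteq> cball x r" by (rule closure_minimal) (auto simp: S_def)
  have gb: "continuous_on (cball x r) (grad u)" using gc r(2) by (auto intro: continuous_on_subset)
  have "open S"
  proof -
    have "continuous_on (ball x r) (\<lambda>y. norm (grad u y))"
      by (intro continuous_on_norm continuous_on_subset[OF gb]) auto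
    from continuous_on_open_vimage[THEN iffD1, OF open_ball this, rule_format, of "{..<norm (grad u x)}"]
    have "open ((\<lambda>y. norm (grad u y)) -` {..<norm (grad u x)} \<inter> ball x r)" by simp
    also have "(\<lambda>y. norm (grad u y)) -` {..<norm (grad u x)} \<inter> ball x r = S" by (auto simp: S_def)
    finally show ?thesis .
  qed
  have hit: "\<exists>y\<in>S. dist y x < d" if "0 < d" for d
  proof (rule ccontr)
    assume no: "\<not> ?thesis"
    have "has_local_min_at (\<lambda>y. norm (grad u y)) x"
      unfolding has_local_min_at_def eventually_nhds_metric
    proof (intro exI[of _ "min d r"] conjI allI impI)
      fix y assume "dist y x < min d r"
      then show "norm (grad u x) \<le> norm (grad u y)" using no by (force simp: S_def dist_commute)
    qed (use that r in simp)
    then show False using nmin[OF x] by blast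
  qed
  then have xS: "x \<in> closure S" unfolding closure_approachable by blast
  have "S \<noteq> {}" using hit[of 1] by auto
  have comp: "compactly_inside S \<Omega>"
    unfolding compactly_inside_def
  proof
    show "compact (closure S)"
      using cS by (metis closed_Int_compact closed_closure compact_cball Int_absorb2)
    show "closure S \<subseteq> \<Omega>" using cS r(2) by blast
  qed
  have gS: "continuous_on (closure S) (grad u)" using gb cS by (rule continuous_on_subset)
  have gS': "continuous_on S (grad u)" using gS closure_subset by (rule continuous_on_subset)
  have leb: "S \<in> sets lebesgue" using \<open>open S\<close> by simp
  have Linf: "Linf_norm S (grad u) = ereal (norm (grad u x))"
  proof (rule antisym)
    show "Linf_norm S (grad u) \<le> ereal (norm (grad u x))"
      by (rule Linf_norm_le[OF leb gS']) (simp add: S_def)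
    show "ereal (norm (grad u x)) \<le> Linf_norm S (grad u)"
      by (rule Linf_norm_ge[OF \<open>open S\<close> gS xS])
  qed
  \<comment> \<open>This value minimises
    \<open>- \<xi> * c + \<xi>\<^sup>2 * (norm a)\<^sup>2\<close>, the bound for the change of the
    squared norm; the minimum is \<open>- \<xi> * c / 2\<close>.\<close>
  define \<xi> where "\<xi> = c / (2 * (norm a)\<^sup>2)"
  have \<xi>: "0 < \<xi>" using c a0 by (simp add: \<xi>_def)
  have \<xi>a: "\<xi>\<^sup>2 * (norm a)\<^sup>2 = \<xi> * c / 2" using a0 by (simp add: \<xi>_def power2_eq_square)
  define A where "A y = y \<bullet> (\<xi> *\<^sub>R a) + 0" for y
  have gA: "grad A y = \<xi> *\<^sub>R a" for y unfolding A_def by (rule grad_inner)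
  have "linear (\<lambda>y. y \<bullet> (\<xi> *\<^sub>R a))" by (rule bounded_linear.linear[OF bounded_linear_inner_left])
  then have "affine_fun A" unfolding affine_fun_def A_def by blast
  moreover have "x \<in> max_grad_set u S" using xS Linf by (simp add: max_grad_set_def)
  moreover have "X \<in> D2_plus u x" using jet by (simp add: D2_plus_def P)
  ultimately have "A \<in> affine_class_plus p u S"
    unfolding affine_class_plus_def using gA \<xi> unfolding a_def by (auto intro!: exI[of _ \<xi>] bexI[of _ x] bexI[of _ X])
  then have le: "Linf_norm S (grad u) \<le> Linf_norm S (\<lambda>y. grad u y + \<xi> *\<^sub>R a)"
    using mini \<open>open S\<close> \<open>S \<noteq> {}\<close> comp gA unfolding minimality_plus_def by fastforce
  define b where "b = (norm (grad u x))\<^sup>2 - \<xi> * c / 2"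
  have nb: "(norm (grad u y + \<xi> *\<^sub>R a))\<^sup>2 \<le> b" if "y \<in> S" for y
  proof -
    have "y \<in> cball x r" using that by (auto simp: S_def)
    then have "a \<bullet> grad u y < - c / 2" using r(2) by blast
    then have "\<xi> * (a \<bullet> grad u y) \<le> \<xi> * (- c / 2)" using \<xi> by (intro mult_left_mono) auto
    moreover have "(norm (grad u y))\<^sup>2 \<le> (norm (grad u x))\<^sup>2"
      using that by (intro power_mono) (auto simp: S_def)
    moreover have "(norm (grad u y + \<xi> *\<^sub>R a))\<^sup>2 = (norm (grad u y))\<^sup>2 + 2 * (\<xi> * (a \<bullet> grad u y)) + \<xi> * c / 2"
      unfolding norm_add_sq by (simp add: power_mult_distrib \<xi>a inner_commute)
    ultimately show ?thesis unfolding b_def by linarith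
  qed
  have b0: "0 \<le> b" using nb \<open>S \<noteq> {}\<close> by (meson all_not_in_conv order_trans zero_le_power2)
  have "Linf_norm S (\<lambda>y. grad u y + \<xi> *\<^sub>R a) \<le> ereal (sqrt b)"
  proof (rule Linf_norm_le[OF leb])
    show "continuous_on S (\<lambda>y. grad u y + \<xi> *\<^sub>R a)" by (intro continuous_intros gS')
    show "norm (grad u y + \<xi> *\<^sub>R a) \<le> sqrt b" if "y \<in> S" for y
      using nb[OF that] by (rule real_le_rsqrt)
  qed
  from order_trans[OF le this] have "norm (grad u x) \<le> sqrt b" by (simp add: Linf)
  then have "(norm (grad u x))\<^sup>2 \<le> (sqrt b)\<^sup>2" by (intro power_mono) auto
  then show False using b0 mult_pos_pos[OF \<xi> c] by (simp add: b_def)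
qed

lemma plus_equivalences:
  fixes u :: "real ^ 'n \<Rightarrow> real"
  assumes p: "1 < p" and \<Omega>: "open \<Omega>" and u: "Ck_on 1 \<Omega> u"
    and nmin: "\<And>x. x \<in> \<Omega> \<Longrightarrow> \<not> has_local_min_at (\<lambda>y. norm (grad u y)) x"
  shows "weak_pLaplace_ge0 p \<Omega> u \<longleftrightarrow> feeble_visc_ge0 (pLaplace_op p) \<Omega> u"
    and "feeble_visc_ge0 (pLaplace_op p) \<Omega> u \<longleftrightarrow> minimality_plus p \<Omega> u"
proof -
  have nz: "grad u x \<noteq> 0" if "x \<in> \<Omega>" for x
    using nmin[OF that] by (auto simp: has_local_min_at_def)
  show "weak_pLaplace_ge0 p \<Omega> u \<longleftrightarrow> feeble_visc_ge0 (pLaplace_op p) \<Omega> u"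
    using visc_if_weak[OF p \<Omega> u nz] weak_if_visc[OF p \<Omega> u nz] by blast
  show "feeble_visc_ge0 (pLaplace_op p) \<Omega> u \<longleftrightarrow> minimality_plus p \<Omega> u"
    using minimality_if_visc[OF u] visc_if_minimality[OF \<Omega> u nmin] by blast
qed

section \<open>Reflection: from subsolutions to supersolutions\<close>

lemma grad_uminus: "f differentiable (at x) \<Longrightarrow> grad (\<lambda>x. - f x) x = - grad f x" for f :: "real ^ 'n \<Rightarrow> real"
  using gderiv_grad[of f x] by (intro grad_eqI) (simp add: gderiv_def has_derivative_minus)

lemma superjet_uminus: "(P, X) \<in> feeble_superjet (\<lambda>x. - u x) x \<longleftrightarrow> (- P, - X) \<in> feeble_subjet u x"
proof -
  have "(\<exists>r. r \<in> o[at 0](\<lambda>z. (norm z)\<^sup>2) \<and>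
       (\<forall>\<^sub>F z in at 0. - u (z + x) \<le> - u x + P \<bullet> z + 1/2 * (X \<bullet> tensor z z) + r z)) \<longleftrightarrow>
     (\<exists>r. r \<in> o[at 0](\<lambda>z. (norm z)\<^sup>2) \<and>
       (\<forall>\<^sub>F z in at 0. u (z + x) \<ge> u x + (- P) \<bullet> z + 1/2 * ((- X) \<bullet> tensor z z) + r z))"
    (is "(\<exists>r. ?L r) \<longleftrightarrow> (\<exists>r. ?R r)")
  proof
    assume "\<exists>r. ?L r"
    then obtain r where "?L r" by blast
    then have "?R (\<lambda>z. - r z)" by (auto elim!: eventually_mono)
    then show "\<exists>r. ?R r" by blast
  next
    assume "\<exists>r. ?R r"
    then obtain r where "?R r" by blast
    then have "?L (\<lambda>z. - r z)" by (auto elim!: eventually_mono)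
    then show "\<exists>r. ?L r" by blast
  qed
  moreover have "transpose (- X) = - X \<longleftrightarrow> transpose X = X" by (simp add: transpose_def vec_eq_iff)
  ultimately show ?thesis unfolding feeble_superjet_def feeble_subjet_def by simp
qed

lemma pLaplace_op_uminus: "pLaplace_op p (- P) (- X) = - pLaplace_op p P X"
proof -
  have "tensor (- P) (- P) = tensor P P" by (simp add: tensor_def)
  then show ?thesis by (simp add: pLaplace_op_def)
qed

lemma feeble_visc_uminus:
  "feeble_visc_ge0 (pLaplace_op p) \<Omega> (\<lambda>x. - u x) \<longleftrightarrow> feeble_visc_le0 (pLaplace_op p) \<Omega> u"
proof
  assume L: "feeble_visc_ge0 (pLaplace_op p) \<Omega> (\<lambda>x. - u x)"
  show "feeble_visc_le0 (pLaplace_op p) \<Omega> u"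
    unfolding feeble_visc_le0_def
  proof (intro ballI, clarify)
    fix x P X assume "x \<in> \<Omega>" "(P, X) \<in> feeble_subjet u x"
    then have "(- P, - X) \<in> feeble_superjet (\<lambda>x. - u x) x" by (simp add: superjet_uminus)
    then have "0 \<le> pLaplace_op p (- P) (- X)"
      using L \<open>x \<in> \<Omega>\<close> unfolding feeble_visc_ge0_def by blast
    then show "pLaplace_op p P X \<le> 0" by (simp add: pLaplace_op_uminus)
  qed
next
  assume R: "feeble_visc_le0 (pLaplace_op p) \<Omega> u"
  show "feeble_visc_ge0 (pLaplace_op p) \<Omega> (\<lambda>x. - u x)"
    unfolding feeble_visc_ge0_def
  proof (intro ballI, clarify)
    fix x P X assume "x \<in> \<Omega>" "(P, X) \<in> feeble_superjet (\<lambda>x. - u x) x"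
    then have "(- P, - X) \<in> feeble_subjet u x" by (simp add: superjet_uminus)
    then have "pLaplace_op p (- P) (- X) \<le> 0"
      using R \<open>x \<in> \<Omega>\<close> unfolding feeble_visc_le0_def by blast
    then show "0 \<le> pLaplace_op p P X" by (simp add: pLaplace_op_uminus)
  qed
qed

text \<open>The slope \<open>M X P\<close> is unchanged when \<open>X\<close> and \<open>P\<close>
  both change sign, so reflecting \<open>A\<close> has to reverse the sign of \<open>\<xi>\<close>.
  This matches the opposite ranges of \<open>\<xi>\<close> in the two classes.\<close>

lemma affine_class_uminus:
  fixes u :: "real ^ 'n \<Rightarrow> real"
  assumes u: "\<And>x. x \<in> closure S \<Longrightarrow> u differentiable (at x)"
  shows "(\<lambda>y. - A y) \<in> affine_class_plus p (\<lambda>x. - u x) S \<longleftrightarrow> A \<in> affine_class_minus p u S"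
proof -
  define M where "M X P = ((p - 2) *\<^sub>R X + (mat 1 \<bullet> X) *\<^sub>R mat 1) *v P" for X :: "real ^ 'n ^ 'n" and P
  have MM: "M (- X) (- P) = M X P" for X P
  proof -
    have "(p - 2) *\<^sub>R - X + (mat 1 \<bullet> - X) *\<^sub>R mat 1 = - ((p - 2) *\<^sub>R X + (mat 1 \<bullet> X) *\<^sub>R mat 1)" by simp
    moreover have "(- Z) *v (- P) = Z *v P" for Z :: "real ^ 'n ^ 'n"
      by (simp add: matrix_vector_mult_def vec_eq_iff)
    ultimately show ?thesis unfolding M_def by (simp only:)
  qed
  have const: "(\<exists>c. (\<lambda>y. - A y) = (\<lambda>_. c)) \<longleftrightarrow> (\<exists>c. A = (\<lambda>_. c))"
    by (metis (no_types, opaque_lifting) add.inverse_inverse)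
  have aff: "affine_fun (\<lambda>y. - A y)" if A: "affine_fun A" for A :: "real ^ 'n \<Rightarrow> real"
  proof -
    obtain l c where l: "linear l" "A = (\<lambda>y. l y + c)" using A unfolding affine_fun_def by blast
    have "linear (\<lambda>y. - l y)" using l(1) by (rule linear_compose_neg)
    then show ?thesis unfolding affine_fun_def l(2) by (intro exI[of _ "\<lambda>y. - l y"] exI[of _ "- c"]) auto
  qed
  have affine: "affine_fun (\<lambda>y. - A y) \<longleftrightarrow> affine_fun A" using aff[of A] aff[of "\<lambda>y. - A y"] by auto
  have gA: "grad (\<lambda>y. - A y) y = - grad A y" if "affine_fun A" for y
    using that grad_affine unfolding affine_fun_def by (metis grad_uminus)
  have gu: "grad (\<lambda>x. - u x) x = - grad u x" if "x \<in> closure S" for x by (rule grad_uminus[OF u[OF that]])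
  have max: "max_grad_set (\<lambda>x. - u x) S = max_grad_set u S"
  proof -
    have "Linf_norm S (grad (\<lambda>x. - u x)) = Linf_norm S (grad u)"
      by (rule Linf_norm_cong) (use gu closure_subset in force)
    then show ?thesis by (auto simp: max_grad_set_def gu)
  qed
  have D2: "- X \<in> D2_plus (\<lambda>x. - u x) x \<longleftrightarrow> X \<in> D2_minus u x" if "x \<in> closure S" for x X
    by (simp add: D2_plus_def D2_minus_def superjet_uminus gu[OF that])
  have "(\<exists>\<xi>\<ge>0. \<exists>x\<in>max_grad_set u S. \<exists>X\<in>D2_plus (\<lambda>x. - u x) x. \<forall>y. - grad A y = \<xi> *\<^sub>R M X (grad (\<lambda>x. - u x) x))
      \<longleftrightarrow> (\<exists>\<xi>\<le>0. \<exists>x\<in>max_grad_set u S. \<exists>X\<in>D2_minus u x. \<forall>y. grad A y = \<xi> *\<^sub>R M X (grad u x))"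
    (is "?L \<longleftrightarrow> ?R")
  proof
    assume ?L
    then obtain \<xi> x X where *: "0 \<le> \<xi>" "x \<in> max_grad_set u S" "X \<in> D2_plus (\<lambda>x. - u x) x"
      "\<And>y. - grad A y = \<xi> *\<^sub>R M X (grad (\<lambda>x. - u x) x)" by blast
    have xS: "x \<in> closure S" using *(2) by (simp add: max_grad_set_def)
    have "- X \<in> D2_minus u x" using D2[OF xS, of "- X"] *(3) by simp
    moreover have "grad A y = (- \<xi>) *\<^sub>R M (- X) (grad u x)" for y
      using *(4)[of y] MM[of X "- grad u x"] unfolding gu[OF xS] by (metis add.inverse_inverse scaleR_minus_left)
    ultimately show ?R using *(1,2) by (metis neg_le_0_iff_le)
  next
    assume ?R
    then obtain \<xi> x X where *: "\<xi> \<le> 0" "x \<in> max_grad_set u S" "X \<in> D2_minus u x"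
      "\<And>y. grad A y = \<xi> *\<^sub>R M X (grad u x)" by blast
    have xS: "x \<in> closure S" using *(2) by (simp add: max_grad_set_def)
    have "- X \<in> D2_plus (\<lambda>x. - u x) x" using D2[OF xS] *(3) by simp
    moreover have "- grad A y = (- \<xi>) *\<^sub>R M (- X) (grad (\<lambda>x. - u x) x)" for y
      using *(4)[of y] MM[of X "grad u x"] unfolding gu[OF xS] by simp
    ultimately show ?L using *(1,2) by (metis neg_0_le_iff_le)
  qed
  then show ?thesis
    unfolding affine_class_plus_def affine_class_minus_def max Un_iff mem_Collect_eq const affine M_def
    by (cases "affine_fun A") (simp_all only: gA simp_thms)
qed

lemma minimality_uminus:
  fixes u :: "real ^ 'n \<Rightarrow> real"
  assumes u: "\<And>x. x \<in> \<Omega> \<Longrightarrow> u differentiable (at x)"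
  shows "minimality_plus p \<Omega> (\<lambda>x. - u x) \<longleftrightarrow> minimality_minus p \<Omega> u"
proof -
  have "(\<forall>A\<in>affine_class_plus p (\<lambda>x. - u x) S. Linf_norm S (grad (\<lambda>x. - u x)) \<le> Linf_norm S (\<lambda>x. grad (\<lambda>x. - u x) x + grad A x))
      \<longleftrightarrow> (\<forall>A\<in>affine_class_minus p u S. Linf_norm S (grad u) \<le> Linf_norm S (\<lambda>x. grad u x + grad A x))"
    (is "?L \<longleftrightarrow> ?R") if S: "compactly_inside S \<Omega>" for S
  proof -
    have ud: "u differentiable (at x)" if "x \<in> closure S" for x
      using that S u unfolding compactly_inside_def by blast
    have gu: "grad (\<lambda>x. - u x) x = - grad u x" if "x \<in> S" for x
      using ud that closure_subset by (intro grad_uminus) blast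
    have 1: "Linf_norm S (grad (\<lambda>x. - u x)) = Linf_norm S (grad u)"
      by (rule Linf_norm_cong) (simp add: gu)
    have dA: "A differentiable (at x)" if "A \<in> affine_class_plus p (\<lambda>x. - u x) S \<or> A \<in> affine_class_minus p u S" for A x
      using that grad_affine unfolding affine_class_plus_def affine_class_minus_def affine_fun_def by auto
    have 2: "Linf_norm S (\<lambda>x. grad (\<lambda>x. - u x) x + grad (\<lambda>y. - A y) x) = Linf_norm S (\<lambda>x. grad u x + grad A x)"
      if "\<And>x. A differentiable (at x)" for A
    proof (rule Linf_norm_cong)
      fix x assume "x \<in> S"
      have "- grad u x + - grad A x = - (grad u x + grad A x)" by simp
      then show "norm (grad (\<lambda>x. - u x) x + grad (\<lambda>y. - A y) x) = norm (grad u x + grad A x)"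
        unfolding gu[OF \<open>x \<in> S\<close>] grad_uminus[OF that] by (simp only: norm_minus_cancel)
    qed
    show ?thesis
    proof
      assume L: ?L
      show ?R
      proof
        fix A assume A: "A \<in> affine_class_minus p u S"
        then have "(\<lambda>y. - A y) \<in> affine_class_plus p (\<lambda>x. - u x) S" using affine_class_uminus[OF ud] by blast
        from L[rule_format, OF this] show "Linf_norm S (grad u) \<le> Linf_norm S (\<lambda>x. grad u x + grad A x)"
          unfolding 1 using 2[of A] dA A by simp
      qed
    next
      assume R: ?R
      show ?L
      proof
        fix A assume A: "A \<in> affine_class_plus p (\<lambda>x. - u x) S"
        then have m: "(\<lambda>y. - A y) \<in> affine_class_minus p u S" using affine_class_uminus[OF ud, where A = "\<lambda>y. - A y"] by simp
        from R[rule_format, OF this] show "Linf_norm S (grad (\<lambda>x. - u x)) \<le> Linf_norm S (\<lambda>x. grad (\<lambda>x. - u x) x + grad A x)"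
          unfolding 1 using 2[of "\<lambda>y. - A y"] dA m by simp
      qed
    qed
  qed
  then show ?thesis unfolding minimality_plus_def minimality_minus_def by blast
qed

lemma weak_uminus:
  fixes u :: "real ^ 'n \<Rightarrow> real"
  assumes \<Omega>: "open \<Omega>" and u: "\<And>x. x \<in> \<Omega> \<Longrightarrow> u differentiable (at x)"
  shows "weak_pLaplace_ge0 p \<Omega> (\<lambda>x. - u x) \<longleftrightarrow> weak_pLaplace_le0 p \<Omega> u"
proof -
  have "(LINT x:\<Omega>|lebesgue. (norm (grad (\<lambda>x. - u x) x) powr (p - 2) *\<^sub>R grad (\<lambda>x. - u x) x) \<bullet> grad \<phi> x)
      = - (LINT x:\<Omega>|lebesgue. (norm (grad u x) powr (p - 2) *\<^sub>R grad u x) \<bullet> grad \<phi> x)" for \<phi>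
  proof -
    have "(LINT x:\<Omega>|lebesgue. (norm (grad (\<lambda>x. - u x) x) powr (p - 2) *\<^sub>R grad (\<lambda>x. - u x) x) \<bullet> grad \<phi> x)
       = (LINT x:\<Omega>|lebesgue. - ((norm (grad u x) powr (p - 2) *\<^sub>R grad u x) \<bullet> grad \<phi> x))"
      using \<Omega> by (intro set_lebesgue_integral_cong) (auto simp: grad_uminus[OF u])
    then show ?thesis by (simp add: set_lebesgue_integral_def)
  qed
  then show ?thesis unfolding weak_pLaplace_ge0_def weak_pLaplace_le0_def by simp
qed

theorem theorem11:
  fixes p :: real and \<Omega> :: "(real ^ 'n) set" and u :: "real ^ 'n \<Rightarrow> real"
  assumes "1 < p" and "open \<Omega>" and "Ck_on 1 \<Omega> u"
    and "\<And>x. x \<in> \<Omega> \<Longrightarrow> \<not> has_local_min_at (\<lambda>y. norm (grad u y)) x"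
  shows "(weak_pLaplace_ge0 p \<Omega> u \<longleftrightarrow> feeble_visc_ge0 (pLaplace_op p) \<Omega> u) \<and>
         (feeble_visc_ge0 (pLaplace_op p) \<Omega> u \<longleftrightarrow>
           (\<forall>\<Omega>'. open \<Omega>' \<and> \<Omega>' \<noteq> {} \<and> compactly_inside \<Omega>' \<Omega> \<longrightarrow>
              (\<forall>A\<in>affine_class_plus p u \<Omega>'.
                 Linf_norm \<Omega>' (grad u) \<le> Linf_norm \<Omega>' (\<lambda>x. grad u x + grad A x)))) \<and>
         (weak_pLaplace_le0 p \<Omega> u \<longleftrightarrow> feeble_visc_le0 (pLaplace_op p) \<Omega> u) \<and>
         (feeble_visc_le0 (pLaplace_op p) \<Omega> u \<longleftrightarrow>
           (\<forall>\<Omega>'. open \<Omega>' \<and> \<Omega>' \<noteq> {} \<and> compactly_inside \<Omega>' \<Omega> \<longrightarrow>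
              (\<forall>A\<in>affine_class_minus p u \<Omega>'.
                 Linf_norm \<Omega>' (grad u) \<le> Linf_norm \<Omega>' (\<lambda>x. grad u x + grad A x))))"
proof -
  have ud: "\<And>x. x \<in> \<Omega> \<Longrightarrow> u differentiable (at x)" and gc: "continuous_on \<Omega> (grad u)"
    using assms(3) unfolding Ck_on_1_iff by auto
  have "continuous_on \<Omega> (grad (\<lambda>x. - u x))"
    by (rule continuous_on_eq[OF continuous_on_minus[OF gc]]) (simp add: grad_uminus[OF ud])
  then have u': "Ck_on 1 \<Omega> (\<lambda>x. - u x)" unfolding Ck_on_1_iff using ud by auto
  \<comment> \<open>The gradient of the reflected function is related to that of \<open>u\<close> on
    \<open>\<Omega>\<close>, so the local comparison is restricted to a neighbourhood inside
    \<open>\<Omega>\<close>.\<close>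
  have nmin': "\<not> has_local_min_at (\<lambda>y. norm (grad (\<lambda>x. - u x) y)) x" if x: "x \<in> \<Omega>" for x
  proof
    assume "has_local_min_at (\<lambda>y. norm (grad (\<lambda>x. - u x) y)) x"
    then have "\<forall>\<^sub>F y in nhds x. norm (grad (\<lambda>x. - u x) x) \<le> norm (grad (\<lambda>x. - u x) y)"
      by (simp add: has_local_min_at_def)
    moreover have "\<forall>\<^sub>F y in nhds x. y \<in> \<Omega>" using assms(2) x by (rule eventually_nhds_in_open)
    ultimately have "\<forall>\<^sub>F y in nhds x. norm (grad u x) \<le> norm (grad u y)"
      by eventually_elim (simp add: grad_uminus[OF ud] grad_uminus[OF ud[OF x]])
    then show False using assms(4)[OF x] by (simp add: has_local_min_at_def)
  qed
  have "weak_pLaplace_le0 p \<Omega> u \<longleftrightarrow> feeble_visc_le0 (pLaplace_op p) \<Omega> u"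
    using plus_equivalences(1)[OF assms(1,2) u' nmin']
    by (simp only: weak_uminus[OF assms(2) ud] feeble_visc_uminus)
  moreover have "feeble_visc_le0 (pLaplace_op p) \<Omega> u \<longleftrightarrow> minimality_minus p \<Omega> u"
    using plus_equivalences(2)[OF assms(1,2) u' nmin']
    by (simp only: minimality_uminus[OF ud] feeble_visc_uminus)
  ultimately show ?thesis
    unfolding minimality_plus_def[symmetric] minimality_minus_def[symmetric]
    by (intro conjI plus_equivalences[OF assms]) simp_all
qed

end
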